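(* For every $f\in L^1(\mathbb{R}^N)\cap L^\infty(\mathbb{R}^N)$ there exists an entropy solution $u$ to $$b(u)+\operatorname{div}(F(u))+(-\Delta)^{\frac{s}{2}}u=f\quad\text{in }\mathbb{R}^N$$ such that $b(u)\in L^1(\mathbb{R}^N)$.
   Context: Standing assumptions: $N\in\mathbb{N}$, $s\in(0,1]$; $b:\mathbb{R}\to\mathbb{R}$ is Lipschitz continuous and nondecreasing with $b(0)=0$ and $b(r)r\geq\lambda|r|^2$ for all $r\in\mathbb{R}$, for some $\lambda>0$; $F=(F_1,\dots,F_N):\mathbb{R}\to\mathbb{R}^N$ is locally Lipschitz continuous with $F(0)=0$. The constant is $C(N,s)=\frac{s\,\Gamma(\frac{N+s}{2})}{2\pi^{\frac N2+s}\Gamma(1-\frac s2)}$. $\mathcal{D}(\mathbb{R}^N)=C_c^\infty(\mathbb{R}^N)$. Entropy solution: a function $u\in L^\infty(\mathbb{R}^N)$ is called an entropy solution to $b(u)+\operatorname{div}(F(u))+(-\Delta)^{s/2}u=f$ if for all $r>0$, all $\varphi\in\mathcal{D}(\mathbb{R}^N)$ with $\varphi\geq0$, all convex $\eta\in C^2(\mathbb{R})$ and all $\phi=(\phi_1,\dots,\phi_N):\mathbb{R}\to\mathbb{R}^N$ locally Lipschitz with $\phi_i'=\eta'F_i'$ (a.e.) for $i=1,\dots,N$, it holds $$\int_{\mathbb{R}^N}(f(x)-b(u(x)))\eta'(u(x))\varphi(x)+\phi(u(x))\cdot\nabla\varphi(x)\,dx$$ $$+C(N,s)\int_{\mathbb{R}^N}\int_{\{|z|\geq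 r\}}\eta'(u(x))\frac{u(x+z)-u(x)}{|z|^{N+s}}\varphi(x)\,dz\,dx$$ $$+C(N,s)\int_{\mathbb{R}^N}\int_{\{|z|\leq r\}}\eta(u(x))\frac{\varphi(x+z)-\varphi(x)-\nabla\varphi(x)\cdot z}{|z|^{N+s}}\,dz\,dx\geq0.$$ *)

theory Defs
  imports "HOL-Analysis.Analysis"
begin

(* Scalar functions of class C^k on the whole space; on a Euclidean space it is enough that all
   directional derivatives are of class C^(k-1). *)
fun C_class :: "nat \<Rightarrow> ('a::euclidean_space \<Rightarrow> real) \<Rightarrow> bool" where
  "C_class 0 g \<longleftrightarrow> continuous_on UNIV g"
| "C_class (Suc k) g \<longleftrightarrow>
     (\<forall>x. g differentiable (at x)) \<and> (\<forall>v. C_class k (\<lambda>x. frechet_derivative g (at x) v))"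

definition test_function :: "('a::euclidean_space \<Rightarrow> real) \<Rightarrow> bool" where
  "test_function \<phi> \<longleftrightarrow> (\<forall>k. C_class k \<phi>) \<and> compact (closure {x. \<phi> x \<noteq> 0})"

definition grad :: "(real ^ 'n \<Rightarrow> real) \<Rightarrow> real ^ 'n \<Rightarrow> real ^ 'n" where
  "grad \<phi> x = (\<chi> i. frechet_derivative \<phi> (at x) (axis i 1))"

(* The library predicate local_lipschitz is about families of functions with a parameter in its
   first argument; the family is constant here. *)
definition locally_lipschitz :: "(real \<Rightarrow> 'b::metric_space) \<Rightarrow> bool" where
  "locally_lipschitz g \<longleftrightarrow> local_lipschitz (UNIV :: real set) UNIV (\<lambda>_. g)"

definition L_infinity :: "('a::euclidean_space \<Rightarrow> real) \<Rightarrow> bool" where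
  "L_infinity u \<longleftrightarrow>
     u \<in> borel_measurable lebesgue \<and> (\<exists>C. AE x in lebesgue. \<bar>u x\<bar> \<le> C)"

definition frac_const :: "nat \<Rightarrow> real \<Rightarrow> real" where
  "frac_const N s =
     s * Gamma ((real N + s) / 2) / (2 * pi powr (real N / 2 + s) * Gamma (1 - s / 2))"

(* \<Phi> is an entropy flux for \<eta>: \<Phi>_i' = \<eta>' F_i' almost everywhere, where the equation includes
   that both derivatives exist (locally Lipschitz functions are differentiable a.e.). *)
definition entropy_flux ::
    "(real \<Rightarrow> real ^ 'n) \<Rightarrow> (real \<Rightarrow> real) \<Rightarrow> (real \<Rightarrow> real ^ 'n) \<Rightarrow> bool" where
  "entropy_flux F \<eta> \<Phi> \<longleftrightarrow> locally_lipschitz \<Phi> \<and>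
     (\<forall>i. AE t in lebesgue. \<exists>D.
        ((\<lambda>r. F r $ i) has_real_derivative D) (at t) \<and>
        ((\<lambda>r. \<Phi> r $ i) has_real_derivative (deriv \<eta> t * D)) (at t))"

(* At z = 0 the integrands over z have the value x / 0 = 0, which is irrelevant on a null set. *)
definition entropy_solution ::
    "real \<Rightarrow> (real \<Rightarrow> real) \<Rightarrow> (real \<Rightarrow> real ^ 'n) \<Rightarrow> (real ^ 'n \<Rightarrow> real) \<Rightarrow> (real ^ 'n \<Rightarrow> real) \<Rightarrow> bool"
  where
  "entropy_solution s b F f u \<longleftrightarrow> L_infinity u \<and>
     (\<forall>r>0. \<forall>\<phi> \<eta> \<Phi>.
        test_function \<phi> \<longrightarrow> (\<forall>x. \<phi> x \<ge> 0) \<longrightarrow>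
        C_class 2 \<eta> \<longrightarrow> convex_on UNIV \<eta> \<longrightarrow> entropy_flux F \<eta> \<Phi> \<longrightarrow>
        (LINT x|lebesgue.
            (f x - b (u x)) * deriv \<eta> (u x) * \<phi> x + \<Phi> (u x) \<bullet> grad \<phi> x)
        + frac_const CARD('n) s *
          (LINT x|lebesgue. (LINT z:{z. norm z \<ge> r}|lebesgue.
            deriv \<eta> (u x) * ((u (x + z) - u x) / norm z powr (real CARD('n) + s)) * \<phi> x))
        + frac_const CARD('n) s *
          (LINT x|lebesgue. (LINT z:{z. norm z \<le> r}|lebesgue.
            \<eta> (u x) * ((\<phi> (x + z) - \<phi> x - grad \<phi> x \<bullet> z) / norm z powr (real CARD('n) + s))))
        \<ge> 0)"

end

theory Submission
  imports Defs
begin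

text \<open>
  Entropy solutions are obtained as limits of a finite difference scheme on all of \<open>\<real>\<^sup>n\<close>. For a
  mesh size \<open>h\<close> and a penalisation \<open>\<epsilon>\<close>, the scheme asks for a bounded Borel function \<open>u\<close> with
  \<open>b (u x) + \<epsilon> * (u x + M) + D * u x = T u x + f x\<close> at every point \<open>x\<close>. Here \<open>D * u - T u\<close> is the
  Lax-Friedrichs discretisation of the divergence of \<open>F u\<close>, plus the fractional Laplacian with the
  jumps shorter than \<open>h\<close> left out; \<open>T\<close> is order preserving, agrees with multiplication by \<open>D\<close> on
  constants, commutes with translations, and has Lipschitz constant \<open>D\<close> in \<open>L\<^sup>1\<close>. The equation is on
  \<open>\<real>\<^sup>n\<close> and not on a lattice because then translating the datum translates the solution.

  The constants \<open>- M\<close> and \<open>M\<close> are a subsolution and a supersolution if \<open>M\<close> is the bound of \<open>f\<close>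
  divided by \<open>lam\<close>, and a monotone explicit iteration that starts from \<open>- M\<close> converges to a solution.
  The same iteration gives the \<open>L\<^sup>1\<close> contraction with constant \<open>1 / \<epsilon>\<close> for the solutions
  (\<open>sol_L1\<close>), and with constant \<open>1\<close> for their images under \<open>b\<close> (\<open>sol_reaction_L1\<close>). The penalisation
  has to be there because \<open>b\<close> may be constant on intervals, so that estimates for \<open>b u\<close> alone say
  nothing about the oscillation of \<open>u\<close>.

  For fixed \<open>\<epsilon>\<close>, the contraction bounds the \<open>L\<^sup>1\<close> distance of \<open>u\<close> and its translates by the one of
  \<open>f\<close>, which tends to \<open>0\<close> with the translation uniformly in \<open>h\<close>. This gives compactness as \<open>h\<close> tends
  to \<open>0\<close> (\<open>common_convergent_subsequence\<close>). As \<open>\<epsilon>\<close> decreases, the compactness degenerates, but the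
  solutions increase, because \<open>u + M\<close> is nonnegative; so they converge anyway, and a diagonal sequence
  converges almost everywhere to the desired function (\<open>monotone_diagonal_selection\<close>).

  The scheme satisfies a discrete entropy inequality (\<open>discrete_entropy_inequality\<close>). Its nonlocal
  part is the convexity inequality for the entropy, and its local part is the inequality
  \<open>numerical_entropy_flux\<close> between the numerical flux and its entropy counterpart. The difference
  operators are moved to the test function, and dominated convergence yields the entropy
  inequality of the limit (\<open>discrete_entropy_tendsto\<close>). Integrability of \<open>b u\<close> follows from
  Fatou's lemma and the contraction, applied to the data \<open>f\<close> and \<open>0\<close>.
\<close>

section \<open>Lebesgue measure and the kernel of the fractional Laplacian\<close>

abbreviation L1_dist :: "('a::euclidean_space \<Rightarrow> real) \<Rightarrow> ('a \<Rightarrow> real) \<Rightarrow> ennreal" where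
  "L1_dist p q \<equiv> (\<integral>\<^sup>+x. ennreal \<bar>p x - q x\<bar> \<partial>lborel)"

lemma lborel_translate: "distr lborel borel (\<lambda>x. x + a) = (lborel :: 'a::euclidean_space measure)"
  using lborel_affine[of 1 a] by (simp add: density_1 add.commute)

lemma lborel_reflect: "distr lborel borel uminus = (lborel :: 'a::euclidean_space measure)"
  using lborel_affine[of "-1" "0::'a"] by (simp add: density_1)

lemma nn_integral_translate:
  fixes g :: "'a::euclidean_space \<Rightarrow> ennreal"
  assumes "g \<in> borel_measurable borel"
  shows "(\<integral>\<^sup>+x. g (x + a) \<partial>lborel) = (\<integral>\<^sup>+x. g x \<partial>lborel)"
  using assms by (subst (2) lborel_translate[symmetric, of a]) (simp add: nn_integral_distr)

lemma integral_translate: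
  fixes g :: "'a::euclidean_space \<Rightarrow> real"
  assumes "g \<in> borel_measurable borel"
  shows "(LBINT x. g (x + a)) = (LBINT x. g x)"
  using assms by (subst (2) lborel_translate[symmetric, of a]) (simp add: integral_distr)

lemma integrable_translate:
  fixes g :: "'a::euclidean_space \<Rightarrow> real"
  assumes "integrable lborel g"
  shows "integrable lborel (\<lambda>x. g (x + a))"
proof -
  have "integrable (distr lborel borel (\<lambda>x. x + a)) g"
    using assms by (simp add: lborel_translate)
  then show ?thesis by (rule integrable_distr[rotated]) simp
qed

lemma integral_reflect:
  fixes g :: "'a::euclidean_space \<Rightarrow> real"
  assumes "g \<in> borel_measurable borel"
  shows "(LBINT x. g (- x)) = (LBINT x. g x)"
  using assms by (subst (2) lborel_reflect[symmetric]) (simp add: integral_distr)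

lemma AE_translate:
  fixes P :: "'a::euclidean_space \<Rightarrow> bool"
  assumes "AE x in lborel. P x"
  shows "AE z in lborel. P (x + z)"
proof -
  from assms obtain N where N: "N \<in> null_sets lborel" "{x. \<not> P x} \<subseteq> N"
    by (auto elim!: AE_E simp: null_sets_def)
  have "AE z in distr lborel borel (\<lambda>z. z + x). z \<notin> N"
    using AE_not_in[OF N(1)] by (subst lborel_translate)
  then have "AE z in lborel. x + z \<notin> N"
    using N(1) by (subst (asm) AE_distr_iff) (auto simp: add.commute)
  then show ?thesis by eventually_elim (use N(2) in auto)
qed

lemma integrable_bounded_mult:
  fixes w k :: "'a::euclidean_space \<Rightarrow> real"
  assumes "integrable lborel k" "w \<in> borel_measurable borel" "\<And>z. \<bar>w z\<bar> \<le> B"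
  shows "integrable lborel (\<lambda>z. w z * k z)"
proof (rule Bochner_Integration.integrable_bound)
  show "integrable lborel (\<lambda>z. B * k z)" using assms(1) by simp
  show "AE z in lborel. norm (w z * k z) \<le> norm (B * k z)"
  proof (rule AE_I2)
    fix z
    have "\<bar>w z\<bar> * \<bar>k z\<bar> \<le> \<bar>B\<bar> * \<bar>k z\<bar>" using assms(3)[of z] by (intro mult_right_mono) auto
    then show "norm (w z * k z) \<le> norm (B * k z)" by (simp add: abs_mult)
  qed
  have [measurable]: "k \<in> borel_measurable borel" using assms(1) by auto
  show "(\<lambda>z. w z * k z) \<in> borel_measurable lborel" using assms(2) by measurable
qed

text \<open>
  The density of the fractional Laplacian up to its constant; it vanishes at \<open>0\<close>, because
  \<open>0 powr a = 0\<close> and \<open>inverse 0 = 0\<close>.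
\<close>
definition levy_kernel :: "real \<Rightarrow> 'a::euclidean_space \<Rightarrow> real" where
  "levy_kernel s z = inverse (norm z powr (real DIM('a) + s))"

lemma levy_kernel_measurable [measurable]: "levy_kernel s \<in> borel_measurable borel"
  unfolding levy_kernel_def by measurable

lemma levy_kernel_nonneg [simp]: "0 \<le> levy_kernel s z"
  by (simp add: levy_kernel_def)

lemma levy_kernel_minus [simp]: "levy_kernel s (- z) = levy_kernel s z"
  by (simp add: levy_kernel_def)

text \<open>
  A substitute for polar coordinates: the function is dominated by a series of multiples of
  indicators of balls, whose volumes are explicit.
\<close>
lemma integrable_dyadic_shells:
  fixes g :: "'a::euclidean_space \<Rightarrow> real" and c R :: "nat \<Rightarrow> real"
  assumes [measurable]: "g \<in> borel_measurable borel" and g0: "\<And>z. 0 \<le> g z"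
    and c0: "\<And>j. 0 \<le> c j" and R0: "\<And>j. 0 \<le> R j"
    and shell: "\<And>z. g z \<noteq> 0 \<Longrightarrow> \<exists>j. norm z \<le> R j \<and> g z \<le> c j"
    and sum: "summable (\<lambda>j. c j * R j ^ DIM('a))"
  shows "integrable lborel g"
proof -
  have [measurable]: "cball (0::'a) (R j) \<in> sets borel" for j by simp
  have "(\<integral>\<^sup>+z. g z \<partial>lborel) \<le> (\<integral>\<^sup>+z. (\<Sum>j. ennreal (c j) * indicator (cball (0::'a) (R j)) z) \<partial>lborel)"
  proof (rule nn_integral_mono)
    fix z :: 'a
    show "ennreal (g z) \<le> (\<Sum>j. ennreal (c j) * indicator (cball 0 (R j)) z)"
    proof (cases "g z = 0")
      case False
      then obtain j where j: "norm z \<le> R j" "g z \<le> c j" using shell by blast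
      have "ennreal (g z) \<le> ennreal (c j) * indicator (cball 0 (R j)) z"
        using j by (auto simp: indicator_def ennreal_leI)
      also have "\<dots> = (\<Sum>i\<in>{j}. ennreal (c i) * indicator (cball 0 (R i)) z)"
        by (subst sum.insert) auto
      also have "\<dots> \<le> (\<Sum>j. ennreal (c j) * indicator (cball 0 (R j)) z)"
        by (rule sum_le_suminf) auto
      finally show ?thesis .
    qed simp
  qed
  also have "\<dots> = (\<Sum>j. ennreal (c j) * emeasure lborel (cball (0::'a) (R j)))"
    by (subst nn_integral_suminf) (auto simp: nn_integral_cmult_indicator)
  also have "\<dots> = (\<Sum>j. ennreal (unit_ball_vol (real DIM('a)) * (c j * R j ^ DIM('a))))"
    using R0 c0 by (intro arg_cong[where f=suminf] ext)
      (simp add: emeasure_cball ennreal_mult'[symmetric] mult_ac)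
  also have "\<dots> < \<infinity>"
  proof -
    have "summable (\<lambda>j. unit_ball_vol (real DIM('a)) * (c j * R j ^ DIM('a)))"
      by (rule summable_mult[OF sum])
    then show ?thesis
      by (subst suminf_ennreal2) (auto simp: c0 R0)
  qed
  finally show ?thesis
    by (intro integrableI_nonneg) (auto simp: g0)
qed

text \<open>
  The shell \<open>r * 2 ^ j \<le> norm z < r * 2 ^ Suc j\<close> contributes a multiple of \<open>2 powr (- s * j)\<close>.
\<close>
lemma integrable_levy_kernel_outer:
  assumes "0 < s" "0 < r"
  shows "integrable lborel (\<lambda>z::'a::euclidean_space. indicator {z. r \<le> norm z} z * levy_kernel s z)"
proof (rule integrable_dyadic_shells)
  let ?d = "real DIM('a)"
  define c where "c j = (r * 2 ^ j) powr (- (?d + s))" for j :: nat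
  define R where "R j = r * 2 ^ Suc j" for j :: nat
  show "0 \<le> c j" "0 \<le> R j" for j using assms by (auto simp: c_def R_def)
  show "summable (\<lambda>j. c j * R j ^ DIM('a))"
  proof -
    have "c j * R j ^ DIM('a) = 2 ^ DIM('a) * r powr (- s) * (2 powr (- s)) ^ j" for j
    proof -
      have "R j ^ DIM('a) = 2 ^ DIM('a) * (r * 2 ^ j) powr ?d"
        using assms by (simp add: R_def powr_realpow power_mult_distrib)
      moreover have "c j * (r * 2 ^ j) powr ?d = (r * 2 ^ j) powr (- s)"
        using assms by (simp add: c_def powr_add[symmetric])
      moreover have "(r * 2 ^ j) powr (- s) = r powr (- s) * (2 powr (- s)) ^ j"
        using assms by (simp add: powr_mult powr_powr powr_realpow[symmetric] mult.commute)
      ultimately show ?thesis by (simp add: mult_ac)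
    qed
    moreover have "\<bar>2 powr (- s)\<bar> < (1::real)"
      using assms by (simp add: powr_minus_divide)
    ultimately show ?thesis by (simp add: summable_geometric summable_mult)
  qed
  show "\<exists>j. norm z \<le> R j \<and> indicator {z. r \<le> norm z} z * levy_kernel s z \<le> c j"
    if "indicator {z. r \<le> norm z} z * levy_kernel s z \<noteq> 0" for z :: 'a
  proof -
    have z: "r \<le> norm z" using that by (auto simp: indicator_def split: if_splits)
    define j where "j = nat \<lfloor>log 2 (norm z / r)\<rfloor>"
    have pos: "0 < norm z / r" using z assms by (intro divide_pos_pos) auto
    have l0: "0 \<le> log 2 (norm z / r)" using z pos assms by (subst zero_le_log_cancel_iff) auto
    have j: "real j \<le> log 2 (norm z / r)" "log 2 (norm z / r) < real j + 1"
      using l0 unfolding j_def by linarith+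
    have 1: "2 ^ j \<le> norm z / r"
      using j(1) pos by (simp add: le_log_iff powr_realpow)
    have "norm z / r < 2 powr (real j + 1)" using j(2) pos by (simp add: log_less_iff)
    then have 2: "norm z / r < 2 ^ Suc j" using powr_realpow[of 2 "Suc j"] by (simp add: add.commute)
    have "r * 2 ^ j \<le> norm z" using 1 assms by (simp add: field_simps)
    then have "levy_kernel s z \<le> c j"
      using assms unfolding levy_kernel_def c_def powr_minus
      by (intro le_imp_inverse_le powr_mono2) auto
    moreover have "norm z \<le> R j" using 2 assms by (simp add: field_simps R_def)
    ultimately show ?thesis using z by auto
  qed
qed (auto simp: zero_le_mult_iff)

text \<open>
  The quadratic factor is the size of a second order Taylor remainder. The shell of outer radius
  \<open>r / 2 ^ j\<close> contributes a multiple of \<open>2 powr (- (2 - s) * j)\<close>.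
\<close>
lemma integrable_levy_kernel_inner:
  assumes "0 < s" "s < 2" "0 < r"
  shows "integrable lborel
    (\<lambda>z::'a::euclidean_space. indicator {z. norm z \<le> r} z * ((norm z)\<^sup>2 * levy_kernel s z))"
proof (rule integrable_dyadic_shells)
  let ?d = "real DIM('a)"
  define R where "R j = r / 2 ^ j" for j :: nat
  define c where "c j = (R j)\<^sup>2 * (R (Suc j)) powr (- (?d + s))" for j :: nat
  have R: "0 < R j" for j using assms by (auto simp: R_def)
  show "0 \<le> c j" "0 \<le> R j" for j using R by (auto simp: c_def less_imp_le)
  show "summable (\<lambda>j. c j * R j ^ DIM('a))"
  proof -
    have half: "(R j / 2) powr a = R j powr a * 2 powr (- a)" for a j
      using R[of j] powr_divide[of "R j" 2 a] powr_minus_divide[of 2 a] by simp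
    have "c j * R j ^ DIM('a) = 2 powr (?d + s) * r powr (2 - s) * ((1/2) powr (2 - s)) ^ j" for j
    proof -
      have "c j * R j ^ DIM('a) = R j powr 2 * (R j / 2) powr (- (?d + s)) * R j powr ?d"
        using R[of j] by (simp add: c_def powr_realpow) (simp add: R_def mult.commute)
      also have "(R j / 2) powr (- (?d + s)) = R j powr (- (?d + s)) * 2 powr (?d + s)"
        using half[where a = "- (?d + s)"] by (simp only: minus_minus)
      also have "R j powr 2 * (R j powr (- (?d + s)) * 2 powr (?d + s)) * R j powr ?d
          = 2 powr (?d + s) * (R j powr 2 * R j powr (- (?d + s)) * R j powr ?d)" by (simp only: mult_ac)
      also have "R j powr 2 * R j powr (- (?d + s)) * R j powr ?d = R j powr (2 - s)"
        by (simp only: powr_add[symmetric]) simp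
      also have "R j powr (2 - s) = r powr (2 - s) * ((1/2) powr (2 - s)) ^ j"
        using assms by (simp add: R_def powr_divide powr_powr powr_realpow[symmetric] field_simps)
      finally show ?thesis by (simp add: mult_ac)
    qed
    moreover have "\<bar>(1/2) powr (2 - s)\<bar> < (1::real)"
      using assms powr_less_mono2[of "2 - s" "1/2" 1] by simp
    ultimately show ?thesis by (simp add: summable_geometric summable_mult)
  qed
  show "\<exists>j. norm z \<le> R j \<and> indicator {z. norm z \<le> r} z * ((norm z)\<^sup>2 * levy_kernel s z) \<le> c j"
    if "indicator {z. norm z \<le> r} z * ((norm z)\<^sup>2 * levy_kernel s z) \<noteq> 0" for z :: 'a
  proof -
    have z: "norm z \<le> r" "0 < norm z" using that by (auto simp: indicator_def split: if_splits)
    define j where "j = nat \<lfloor>log 2 (r / norm z)\<rfloor>"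
    have l0: "0 \<le> log 2 (r / norm z)" using z assms by (simp add: zero_le_log_cancel_iff)
    have j: "real j \<le> log 2 (r / norm z)" "log 2 (r / norm z) < real j + 1"
      using l0 unfolding j_def by linarith+
    have pos: "0 < r / norm z" using z assms by auto
    have 1: "2 ^ j \<le> r / norm z"
      using j(1) pos by (simp add: le_log_iff powr_realpow)
    have "r / norm z < 2 powr (real j + 1)" using j(2) pos by (simp add: log_less_iff)
    then have 2: "r / norm z < 2 ^ Suc j" using powr_realpow[of 2 "Suc j"] by (simp add: add.commute)
    have le: "norm z \<le> R j" using 1 z by (simp add: field_simps R_def)
    have "R (Suc j) \<le> norm z" using 2 z by (simp add: field_simps R_def)
    then have "levy_kernel s z \<le> R (Suc j) powr (- (?d + s))"
      using assms R[of "Suc j"] unfolding levy_kernel_def powr_minus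
      by (intro le_imp_inverse_le powr_mono2) auto
    then have "(norm z)\<^sup>2 * levy_kernel s z \<le> c j"
      unfolding c_def using le by (intro mult_mono power_mono) auto
    with le show ?thesis using z by auto
  qed
qed (auto simp: zero_le_mult_iff)

section \<open>Continuity of translations in the mean\<close>

definition translation_continuous :: "('a::euclidean_space \<Rightarrow> real) \<Rightarrow> bool" where
  "translation_continuous f \<longleftrightarrow>
     (\<forall>e>0. \<exists>d>0. \<forall>y. norm y < d \<longrightarrow> L1_dist (\<lambda>x. f (x + y)) f \<le> ennreal e)"

text \<open>
  Translations do not change \<open>L\<^sup>1\<close> distances, so an \<open>L\<^sup>1\<close> approximation costs its error twice,
  whatever the translation is.
\<close>
lemma translation_continuous_closure:
  fixes f :: "'a::euclidean_space \<Rightarrow> real"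
  assumes [measurable]: "f \<in> borel_measurable borel"
    and approx: "\<And>e. e > 0 \<Longrightarrow> \<exists>g. g \<in> borel_measurable borel \<and> translation_continuous g \<and>
        (L1_dist f g) \<le> ennreal e"
  shows "translation_continuous f"
  unfolding translation_continuous_def
proof (intro allI impI)
  fix e :: real assume "e > 0"
  then obtain g where g [measurable]: "g \<in> borel_measurable borel"
    and gc: "translation_continuous g" and fg: "L1_dist f g \<le> ennreal (e/3)"
    using approx[of "e/3"] by auto
  obtain d where d: "d > 0"
    "\<And>y. norm y < d \<Longrightarrow> L1_dist (\<lambda>x. g (x + y)) g \<le> ennreal (e/3)"
    using gc \<open>e > 0\<close> unfolding translation_continuous_def by (meson divide_pos_pos zero_less_numeral)
  show "\<exists>d>0. \<forall>y. norm y < d \<longrightarrow> L1_dist (\<lambda>x. f (x + y)) f \<le> ennreal e"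
  proof (intro exI[of _ d] conjI allI impI)
    fix y :: 'a assume y: "norm y < d"
    have "L1_dist (\<lambda>x. f (x + y)) f
        \<le> (\<integral>\<^sup>+x. ennreal \<bar>f (x + y) - g (x + y)\<bar> + ennreal \<bar>g (x + y) - g x\<bar> + ennreal \<bar>f x - g x\<bar> \<partial>lborel)"
      by (rule nn_integral_mono) (simp add: ennreal_plus[symmetric] ennreal_leI del: ennreal_plus)
    also have "\<dots> = L1_dist (\<lambda>x. f (x + y)) (\<lambda>x. g (x + y))
        + L1_dist (\<lambda>x. g (x + y)) g + L1_dist f g"
      by (simp add: nn_integral_add)
    also have "L1_dist (\<lambda>x. f (x + y)) (\<lambda>x. g (x + y)) = L1_dist f g"
      by (rule nn_integral_translate[where g = "\<lambda>x. ennreal \<bar>f x - g x\<bar>"]) measurable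
    also have "L1_dist f g + L1_dist (\<lambda>x. g (x + y)) g
        + L1_dist f g \<le> ennreal (e/3) + ennreal (e/3) + ennreal (e/3)"
      by (intro add_mono fg d y)
    also have "\<dots> = ennreal e" using \<open>e > 0\<close> by (simp add: ennreal_plus[symmetric] del: ennreal_plus)
    finally show "L1_dist (\<lambda>x. f (x + y)) f \<le> ennreal e" .
  qed (use d in auto)
qed

lemma translation_continuous_limit:
  fixes f :: "'a::euclidean_space \<Rightarrow> real"
  assumes g: "\<And>i. integrable lborel (g i)" "\<And>i. translation_continuous (g i)"
    and lim: "\<And>x. (\<lambda>i. g i x) \<longlonglongrightarrow> f x"
    and h: "integrable lborel h" "\<And>i x. \<bar>g i x\<bar> \<le> h x" and f: "integrable lborel f"
  shows "translation_continuous f"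
proof (rule translation_continuous_closure)
  have [measurable]: "f \<in> borel_measurable borel" "g i \<in> borel_measurable borel" for i
    using f g(1)[of i] by auto
  show "f \<in> borel_measurable borel" by measurable
  fix e :: real assume "e > 0"
  have "(\<lambda>i. \<integral>x. \<bar>f x - g i x\<bar> \<partial>lborel) \<longlonglongrightarrow> (\<integral>x. 0 \<partial>(lborel::'a measure))"
  proof (rule integral_dominated_convergence[where w = "\<lambda>x. \<bar>f x\<bar> + h x"])
    show "AE x in lborel. (\<lambda>i. \<bar>f x - g i x\<bar>) \<longlonglongrightarrow> 0"
    proof (rule AE_I2)
      show "(\<lambda>i. \<bar>f x - g i x\<bar>) \<longlonglongrightarrow> 0" for x
        using tendsto_rabs[OF tendsto_diff[OF tendsto_const lim[of x], of "f x"]] by simp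
    qed
    show "AE x in lborel. norm \<bar>f x - g i x\<bar> \<le> \<bar>f x\<bar> + h x" for i
      by (rule AE_I2) (use h(2)[of i] in \<open>smt (verit) real_norm_def\<close>)
  qed (use f h in auto)
  then have "\<forall>\<^sub>F i in sequentially. (LBINT x. \<bar>f x - g i x\<bar>) < e"
    using \<open>e > 0\<close> by (intro order_tendstoD) auto
  then obtain i where i: "(LBINT x. \<bar>f x - g i x\<bar>) < e"
    by (auto simp: eventually_sequentially)
  have "L1_dist f (g i) = ennreal (LBINT x. \<bar>f x - g i x\<bar>)"
    by (rule nn_integral_eq_integral) (use f g in auto)
  then show "\<exists>g. g \<in> borel_measurable borel \<and> translation_continuous g \<and>
        (L1_dist f g) \<le> ennreal e"
    using i g(2)[of i] by (intro exI[of _ "g i"]) (auto simp: ennreal_leI)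
qed

lemma translation_continuous_Lipschitz:
  fixes f :: "'a::euclidean_space \<Rightarrow> real"
  assumes L: "\<And>x y. \<bar>f x - f y\<bar> \<le> L * norm (x - y)" and S [measurable]: "S \<in> sets borel"
    and fin: "emeasure lborel S < \<infinity>" and supp: "\<And>x. x \<notin> S \<Longrightarrow> f x = 0"
  shows "translation_continuous f"
  unfolding translation_continuous_def
proof (intro allI impI)
  fix e :: real assume "e > 0"
  define m where "m = measure lborel S"
  have m: "emeasure lborel S = ennreal m" "0 \<le> m"
    using fin unfolding m_def by (auto simp: emeasure_eq_ennreal_measure)
  have L0: "0 \<le> L" 
    using L[of "SOME b. b \<in> Basis" 0] by (smt (verit) SOME_Basis diff_zero mult_minus_left norm_Basis mult_cancel_left1)
  define d where "d = e / (2 * (L + 1) * (m + 1))"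
  have d: "d > 0" using \<open>e > 0\<close> L0 m by (simp add: d_def)
  show "\<exists>d>0. \<forall>y. norm y < d \<longrightarrow> L1_dist (\<lambda>x. f (x + y)) f \<le> ennreal e"
  proof (intro exI[of _ d] conjI allI impI d)
    fix y :: 'a assume y: "norm y < d"
    have "L1_dist (\<lambda>x. f (x + y)) f
        \<le> (\<integral>\<^sup>+x. ennreal (L * d) * indicator S (x + y) + ennreal (L * d) * indicator S x \<partial>lborel)"
    proof (rule nn_integral_mono)
      fix x :: 'a
      have "\<bar>f (x + y) - f x\<bar> \<le> L * norm y" using L[of "x + y" x] by simp
      also have "\<dots> \<le> L * d" using y L0 by (intro mult_left_mono) auto
      finally have "\<bar>f (x + y) - f x\<bar> \<le> L * d" .
      then show "ennreal \<bar>f (x + y) - f x\<bar>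
          \<le> ennreal (L * d) * indicator S (x + y) + ennreal (L * d) * indicator S x"
        using supp[of x] supp[of "x + y"] L0 d
        by (auto simp: indicator_def ennreal_plus[symmetric] ennreal_leI simp del: ennreal_plus)
    qed
    also have "\<dots> = ennreal (L * d) * (\<integral>\<^sup>+x. indicator S (x + y) \<partial>lborel)
        + ennreal (L * d) * (\<integral>\<^sup>+x. indicator S x \<partial>lborel)"
      by (simp add: nn_integral_add nn_integral_cmult)
    also have "(\<integral>\<^sup>+x. indicator S (x + y) \<partial>lborel) = (\<integral>\<^sup>+x. indicator S x \<partial>lborel)"
      by (rule nn_integral_translate[where g = "indicator S"]) measurable
    also have "ennreal (L * d) * (\<integral>\<^sup>+x. indicator S x \<partial>lborel)
        + ennreal (L * d) * (\<integral>\<^sup>+x. indicator S x \<partial>lborel) = ennreal (2 * (L * d) * m)"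
      using L0 d m by (simp add: ennreal_plus[symmetric] ennreal_mult'[symmetric] del: ennreal_plus)
    also have "2 * (L * d) * m \<le> e"
    proof -
      have "2 * (L * d) * m = e * ((L / (L + 1)) * (m / (m + 1)))"
        using L0 m unfolding d_def by (simp add: divide_simps)
      also have "\<dots> \<le> e * (1 * 1)"
        using L0 m \<open>e > 0\<close> by (intro mult_left_mono mult_mono) (auto simp: divide_simps)
      finally show ?thesis by simp
    qed
    then have "ennreal (2 * (L * d) * m) \<le> ennreal e" by (rule ennreal_leI)
    finally show "L1_dist (\<lambda>x. f (x + y)) f \<le> ennreal e" .
  qed
qed

text \<open>
  The indicator is the increasing limit of the Lipschitz functions \<open>min 1 (n * infdist x (- U))\<close>,
  which vanish outside \<open>U\<close>.
\<close>
lemma translation_continuous_open: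
  fixes U :: "'a::euclidean_space set"
  assumes U: "open U" "emeasure lborel U < \<infinity>"
  shows "translation_continuous (indicator U)"
proof -
  define g where "g n x = min 1 (real n * infdist x (- U))" for n :: nat and x :: 'a
  have ne: "- U \<noteq> {}"
  proof
    assume "- U = {}"
    then have "U = UNIV" by auto
    with U(2) show False by simp
  qed
  have [measurable]: "U \<in> sets borel" using U by auto
  have out: "g n x = 0" if "x \<notin> U" for n x
    using that by (simp add: g_def)
  have lip: "\<bar>g n x - g n y\<bar> \<le> real n * norm (x - y)" for n x y
  proof -
    have "\<bar>g n x - g n y\<bar> \<le> \<bar>real n * infdist x (- U) - real n * infdist y (- U)\<bar>"
      unfolding g_def by linarith
    also have "\<dots> = real n * \<bar>infdist x (- U) - infdist y (- U)\<bar>"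
      by (simp add: abs_mult right_diff_distrib[symmetric])
    also have "\<dots> \<le> real n * dist x y"
      by (intro mult_left_mono infdist_triangle_abs) auto
    finally show ?thesis by (simp add: dist_norm)
  qed
  have g1: "\<bar>g n x\<bar> \<le> indicator U x" for n x
    using out[of x n] infdist_nonneg[of x "- U"] by (auto simp: g_def indicator_def)
  have int: "integrable lborel (indicator U :: 'a \<Rightarrow> real)"
    using U by (intro integrable_real_indicator) auto
  have meas [measurable]: "g n \<in> borel_measurable borel" for n
    unfolding g_def by (intro borel_measurable_continuous_onI continuous_intros)
  have gi: "integrable lborel (g n)" for n
    by (rule Bochner_Integration.integrable_bound[OF int]) (use g1 in auto)
  have gt: "translation_continuous (g n)" for n
    by (rule translation_continuous_Lipschitz[where S = U and L = n]) (use lip out U in auto)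
  have lim: "(\<lambda>n. g n x) \<longlonglongrightarrow> indicator U x" for x
  proof (cases "x \<in> U")
    case True
    then have pos: "infdist x (- U) > 0"
      using U ne infdist_pos_not_in_closed[of "- U" x] by auto
    obtain k where k: "1 \<le> real k * infdist x (- U)"
      using reals_Archimedean3[OF pos] by (meson less_imp_le)
    have "g n x = 1" if "n \<ge> k" for n
    proof -
      have "real k * infdist x (- U) \<le> real n * infdist x (- U)"
        using that pos by (intro mult_right_mono) auto
      with k show ?thesis by (simp add: g_def)
    qed
    then have "\<forall>\<^sub>F n in sequentially. g n x = 1"
      using eventually_sequentially by blast
    then show ?thesis using True by (simp add: tendsto_eventually)
  qed (simp add: out)
  show ?thesis
    by (rule translation_continuous_limit[where h = "indicator U", OF gi gt lim int g1 int])
qed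

lemma translation_continuous_zero: "translation_continuous (\<lambda>_. 0)"
  unfolding translation_continuous_def by (auto intro!: exI[of _ 1])

lemma translation_continuous_cmult:
  fixes f :: "'a::euclidean_space \<Rightarrow> real"
  assumes [measurable]: "f \<in> borel_measurable borel" and f: "translation_continuous f"
  shows "translation_continuous (\<lambda>x. f x * c)"
proof (cases "c = 0")
  case True then show ?thesis by (simp add: translation_continuous_zero)
next
  case False
  show ?thesis unfolding translation_continuous_def
  proof (intro allI impI)
    fix e :: real assume "e > 0"
    then obtain d where d: "d > 0"
      "\<And>y. norm y < d \<Longrightarrow> L1_dist (\<lambda>x. f (x + y)) f \<le> ennreal (e / \<bar>c\<bar>)"
      using f False unfolding translation_continuous_def by (meson divide_pos_pos zero_less_abs_iff)
    have "(\<integral>\<^sup>+x. \<bar>f (x + y) * c - f x * c\<bar> \<partial>lborel) \<le> ennreal e" if "norm y < d" for y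
    proof -
      have "\<bar>f (x + y) * c - f x * c\<bar> = \<bar>c\<bar> * \<bar>f (x + y) - f x\<bar>" for x
        by (metis abs_mult left_diff_distrib mult.commute)
      then have "(\<integral>\<^sup>+x. \<bar>f (x + y) * c - f x * c\<bar> \<partial>lborel)
          = (\<integral>\<^sup>+x. ennreal \<bar>c\<bar> * ennreal \<bar>f (x + y) - f x\<bar> \<partial>lborel)"
        by (simp add: ennreal_mult')
      also have "\<dots> = ennreal \<bar>c\<bar> * L1_dist (\<lambda>x. f (x + y)) f"
        by (rule nn_integral_cmult) measurable
      also have "\<dots> \<le> ennreal \<bar>c\<bar> * ennreal (e / \<bar>c\<bar>)" by (intro mult_left_mono d that) auto
      also have "\<dots> = ennreal e" using False \<open>e > 0\<close> by (simp add: ennreal_mult'[symmetric])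
      finally show ?thesis .
    qed
    with d show "\<exists>d>0. \<forall>y. norm y < d \<longrightarrow> (\<integral>\<^sup>+x. \<bar>f (x + y) * c - f x * c\<bar> \<partial>lborel) \<le> ennreal e"
      by blast
  qed
qed

lemma translation_continuous_add:
  fixes f g :: "'a::euclidean_space \<Rightarrow> real"
  assumes [measurable]: "f \<in> borel_measurable borel" "g \<in> borel_measurable borel"
    and f: "translation_continuous f" and g: "translation_continuous g"
  shows "translation_continuous (\<lambda>x. f x + g x)"
  unfolding translation_continuous_def
proof (intro allI impI)
  fix e :: real assume e: "e > 0"
  then have e2: "e / 2 > 0" by simp
  obtain d where d: "d > 0"
      "\<And>y. norm y < d \<Longrightarrow> L1_dist (\<lambda>x. f (x + y)) f \<le> ennreal (e/2)"
    using f e2 unfolding translation_continuous_def by blast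
  obtain d' where d': "d' > 0"
      "\<And>y. norm y < d' \<Longrightarrow> L1_dist (\<lambda>x. g (x + y)) g \<le> ennreal (e/2)"
    using g e2 unfolding translation_continuous_def by blast
  show "\<exists>d>0. \<forall>y. norm y < d \<longrightarrow> (\<integral>\<^sup>+x. \<bar>f (x + y) + g (x + y) - (f x + g x)\<bar> \<partial>lborel) \<le> ennreal e"
  proof (intro exI[of _ "min d d'"] conjI allI impI)
    fix y :: 'a assume y: "norm y < min d d'"
    have "(\<integral>\<^sup>+x. \<bar>f (x + y) + g (x + y) - (f x + g x)\<bar> \<partial>lborel)
        \<le> (\<integral>\<^sup>+x. ennreal \<bar>f (x + y) - f x\<bar> + ennreal \<bar>g (x + y) - g x\<bar> \<partial>lborel)"
      by (rule nn_integral_mono) (simp add: ennreal_plus[symmetric] ennreal_leI del: ennreal_plus)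
    also have "\<dots> = L1_dist (\<lambda>x. f (x + y)) f + L1_dist (\<lambda>x. g (x + y)) g"
      by (rule nn_integral_add) auto
    also have "\<dots> \<le> ennreal (e/2) + ennreal (e/2)" using y by (intro add_mono d d') auto
    also have "\<dots> = ennreal e" using e by (simp add: ennreal_plus[symmetric] del: ennreal_plus)
    finally show "(\<integral>\<^sup>+x. \<bar>f (x + y) + g (x + y) - (f x + g x)\<bar> \<partial>lborel) \<le> ennreal e" .
  qed (use d d' in auto)
qed

text \<open>
  Outer regularity reduces indicators of Borel sets to those of open sets; sums and dominated
  limits do the rest.
\<close>
lemma translation_continuous_integrable:
  fixes f :: "'a::euclidean_space \<Rightarrow> real"
  assumes "integrable lborel f"
  shows "translation_continuous f"
  using assms
proof (induction rule: integrable_induct)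
  case (base A c)
  have A [measurable]: "A \<in> sets borel" using base by simp
  have "translation_continuous (indicator A :: 'a \<Rightarrow> real)"
  proof (rule translation_continuous_closure)
    fix e :: real assume e: "e > 0"
    obtain U where U: "open U" "A \<subseteq> U" "emeasure lborel (U - A) < ennreal e"
      using outer_regular_lborel[OF A, of e] e by auto
    have [measurable]: "U \<in> sets borel" using U by auto
    have "U = A \<union> (U - A)" using U by auto
    then have "emeasure lborel U \<le> emeasure lborel A + emeasure lborel (U - A)"
      using emeasure_subadditive[of A lborel "U - A"] by simp
    also have "\<dots> < \<infinity>" using base(2) U(3) by (metis ennreal_add_less_top ennreal_less_top infinity_ennreal_def less_trans)
    finally have fin: "emeasure lborel U < \<infinity>" .
    have "(\<integral>\<^sup>+x. \<bar>indicator A x - indicator U x :: real\<bar> \<partial>lborel) = (\<integral>\<^sup>+x. indicator (U - A) x \<partial>lborel)"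
      using U(2) by (intro nn_integral_cong) (auto simp: indicator_def)
    also have "\<dots> \<le> ennreal e" using U(3) by simp
    finally show "\<exists>g. g \<in> borel_measurable borel \<and> translation_continuous g \<and>
        (\<integral>\<^sup>+x. \<bar>(indicator A x :: real) - g x\<bar> \<partial>lborel) \<le> ennreal e"
      using translation_continuous_open[OF U(1) fin] by (intro exI[of _ "indicator U"]) auto
  qed measurable
  then show ?case using translation_continuous_cmult[of "indicator A" c] by simp
next
  case (add f g)
  then show ?case by (intro translation_continuous_add) auto
next
  case (lim f s)
  show ?case
    by (rule translation_continuous_limit[where g = s and h = "\<lambda>x. 2 * \<bar>f x\<bar>"]) (use lim in auto)
qed

section \<open>Averages over small cubes\<close>

definition cube_index :: "nat \<Rightarrow> real ^ 'n \<Rightarrow> int ^ 'n" where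
  "cube_index j x = (\<chi> i. \<lfloor>real (Suc j) * x $ i\<rfloor>)"

text \<open>
  The half-open cube of side \<open>1 / Suc j\<close> with index \<open>q\<close>. Indexing by integer vectors makes the
  cubes a countable family.
\<close>
definition cube :: "nat \<Rightarrow> int ^ 'n \<Rightarrow> (real ^ 'n) set" where
  "cube j q = {y. cube_index j y = q}"

definition cube_average :: "nat \<Rightarrow> (real ^ 'n \<Rightarrow> real) \<Rightarrow> int ^ 'n \<Rightarrow> real" where
  "cube_average j u q = real (Suc j) ^ CARD('n) * (LBINT y. indicator (cube j q) y * u y)"

lemma cube_index_measurable [measurable]: "(cube_index j :: real ^ 'n \<Rightarrow> _) \<in> measurable borel (count_space UNIV)"
proof -
  have "(cube_index j :: real ^ 'n \<Rightarrow> _) -` {q} \<in> sets borel" for q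
  proof -
    have "cube_index j -` {q} = (\<Inter>i\<in>UNIV. {x :: real ^ 'n. \<lfloor>real (Suc j) * x $ i\<rfloor> = q $ i})"
      by (auto simp: cube_index_def vec_eq_iff)
    moreover have "{x::real^'n. \<lfloor>real (Suc j) * x $ i\<rfloor> = q $ i} \<in> sets borel" for i
    proof -
      have "{x::real^'n. \<lfloor>real (Suc j) * x $ i\<rfloor> = q $ i}
          = {x. of_int (q $ i) \<le> real (Suc j) * x $ i} \<inter> {x. real (Suc j) * x $ i < of_int (q $ i) + 1}"
        by (auto simp: floor_eq_iff)
      also have "\<dots> \<in> sets borel"
        by (intro sets.Int borel_closed borel_open closed_Collect_le open_Collect_less continuous_intros)
      finally show ?thesis .
    qed
    ultimately show ?thesis by (simp only:) (rule sets.finite_INT, auto)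
  qed
  then show ?thesis by (simp add: measurable_count_space_eq_countable)
qed

lemma cube_measurable [measurable]: "cube j q \<in> sets borel"
proof -
  have "cube_index j -` {q} \<inter> space borel \<in> sets borel"
    by (rule measurable_sets[OF cube_index_measurable]) auto
  then show ?thesis by (simp add: cube_def vimage_def)
qed

lemma emeasure_box_cart:
  fixes a b :: "real ^ 'n"
  assumes "\<And>i. a $ i \<le> b $ i"
  shows "emeasure lborel (cbox a b) = ennreal (\<Prod>i\<in>UNIV. b $ i - a $ i)"
    and "emeasure lborel (box a b) = ennreal (\<Prod>i\<in>UNIV. b $ i - a $ i)"
proof -
  have "cbox a b \<noteq> {}" using assms by (auto simp: mem_box_cart intro!: exI[of _ a] simp: set_eq_iff)
  then have c: "measure lborel (cbox a b) = (\<Prod>i\<in>UNIV. b $ i - a $ i)" by (rule content_cbox_cart)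
  have "emeasure lborel (cbox a b) = ennreal (measure lborel (cbox a b))"
    by (intro emeasure_eq_ennreal_measure) (simp add: emeasure_lborel_cbox_eq)
  with c show 1: "emeasure lborel (cbox a b) = ennreal (\<Prod>i\<in>UNIV. b $ i - a $ i)" by simp
  have "a \<bullet> v \<le> b \<bullet> v" if "v \<in> Basis" for v
    using that assms by (auto simp: Basis_vec_def inner_axis)
  then have "emeasure lborel (box a b) = emeasure lborel (cbox a b)"
    by (simp add: emeasure_lborel_cbox_eq emeasure_lborel_box_eq)
  with 1 show "emeasure lborel (box a b) = ennreal (\<Prod>i\<in>UNIV. b $ i - a $ i)" by simp
qed

lemma emeasure_cube: "emeasure lborel (cube j q :: (real ^ 'n) set) = ennreal (1 / real (Suc j) ^ CARD('n))"
proof -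
  define a b :: "real ^ 'n" where "a = (\<chi> i. of_int (q $ i) / real (Suc j))"
    and "b = (\<chi> i. (of_int (q $ i) + 1) / real (Suc j))"
  have ab: "a $ i \<le> b $ i" for i by (simp add: a_def b_def divide_right_mono)
  have d: "b $ i - a $ i = 1 / real (Suc j)" for i
    by (simp add: a_def b_def diff_divide_distrib[symmetric])
  have "box a b \<subseteq> cube j q"
    by (auto simp: mem_box_cart a_def b_def cube_def cube_index_def vec_eq_iff floor_eq_iff field_simps
        intro: less_imp_le)
  moreover have "cube j q \<subseteq> cbox a b"
    by (fastforce simp: mem_box_cart a_def b_def cube_def cube_index_def vec_eq_iff floor_eq_iff field_simps
        intro: less_imp_le)
  ultimately have "emeasure lborel (box a b) \<le> emeasure lborel (cube j q)"
      "emeasure lborel (cube j q) \<le> emeasure lborel (cbox a b)"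
    by (auto intro!: emeasure_mono)
  then show ?thesis
    unfolding emeasure_box_cart[OF ab] d by (simp add: power_one_over)
qed

lemma integrable_bounded_on_finite:
  fixes u :: "'a::euclidean_space \<Rightarrow> real"
  assumes [measurable]: "A \<in> sets borel" "u \<in> borel_measurable borel"
    and "emeasure lborel A < \<infinity>" "\<And>x. \<bar>u x\<bar> \<le> M"
  shows "integrable lborel (\<lambda>x. indicator A x * u x)"
proof -
  have "integrable lborel (\<lambda>x. u x * indicator A x)"
    using assms(3) by (intro integrable_bounded_mult[where B = M] assms(2,4) integrable_real_indicator) auto
  then show ?thesis by (simp add: mult.commute)
qed

lemma cube_average_bound:
  fixes u :: "real ^ 'n \<Rightarrow> real"
  assumes [measurable]: "u \<in> borel_measurable borel" and M: "\<And>x. \<bar>u x\<bar> \<le> M"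
  shows "\<bar>cube_average j u q\<bar> \<le> M"
proof -
  have fin: "emeasure lborel (cube j q) < \<infinity>" by (simp add: emeasure_cube)
  have int: "integrable lborel (\<lambda>y. indicator (cube j q) y * M)"
    using integrable_bounded_on_finite[of "cube j q" "\<lambda>_. M" "\<bar>M\<bar>"] fin by simp
  have "\<bar>\<integral>y. indicator (cube j q) y * u y \<partial>lborel\<bar> \<le> (LBINT y. indicator (cube j q) y * M)"
    by (rule integral_abs_bound_integral[OF integrable_bounded_on_finite[OF _ _ fin M] int])
      (use M in \<open>auto simp: indicator_def\<close>)
  also have "\<dots> = M / real (Suc j) ^ CARD('n)"
    using fin by (simp add: measure_def emeasure_cube)
  finally show ?thesis
    unfolding cube_average_def by (simp add: abs_mult field_simps)
qed

text \<open>
  Two points of one cube differ by a vector \<open>t\<close> of the box \<open>T\<close>. So the error is at most the mean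
  over the cube of the differences, and Fubini's theorem turns its integral into an integral over
  \<open>T\<close> of the \<open>L\<^sup>1\<close> distances of \<open>u\<close> and its translates. The factor is the ratio of the volumes of
  \<open>T\<close> and of a cube.
\<close>
lemma cube_average_L1:
  fixes u :: "real ^ 'n \<Rightarrow> real"
  assumes [measurable]: "u \<in> borel_measurable borel" and M: "\<And>x. \<bar>u x\<bar> \<le> M"
    and shift: "\<And>t. (\<And>i. \<bar>t $ i\<bar> < 1 / real (Suc j)) \<Longrightarrow> L1_dist (\<lambda>x. u (x + t)) u \<le> ennreal e"
    and e: "0 \<le> e"
  shows "(\<integral>\<^sup>+x. \<bar>u x - cube_average j u (cube_index j x)\<bar> \<partial>lborel) \<le> ennreal (2 ^ CARD('n) * e)"
proof -
  let ?a = "real (Suc j) ^ CARD('n)"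
  define T :: "(real ^ 'n) set" where "T = box (\<chi> i. - (1 / real (Suc j))) (\<chi> i. 1 / real (Suc j)) "
  have T: "t \<in> T \<longleftrightarrow> (\<forall>i. \<bar>t $ i\<bar> < 1 / real (Suc j))" for t :: "real ^ 'n"
    by (auto simp: T_def mem_box_cart abs_less_iff) (metis minus_less_iff)+
  have [measurable]: "T \<in> sets borel" by (simp add: T_def)
  have emT: "emeasure lborel T = ennreal ((2 / real (Suc j)) ^ CARD('n))"
    unfolding T_def by (subst emeasure_box_cart) (auto simp: prod_constant intro!: order_trans[of _ 0])
  have pt: "ennreal \<bar>u x - cube_average j u (cube_index j x)\<bar>
      \<le> ennreal ?a * (\<integral>\<^sup>+t. indicator T t * ennreal \<bar>u (x + t) - u x\<bar> \<partial>lborel)" for x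
  proof -
    let ?Q = "cube j (cube_index j x)"
    have fin: "emeasure lborel ?Q < \<infinity>" by (simp add: emeasure_cube)
    have i1: "integrable lborel (\<lambda>y. indicator ?Q y * u y)"
      by (rule integrable_bounded_on_finite[OF _ _ fin M]) auto
    have i2: "integrable lborel (\<lambda>y. indicator ?Q y * u x)"
      by (rule integrable_bounded_on_finite[OF _ _ fin M]) auto
    have "?a * (LBINT y. indicator ?Q y * u x) = u x"
      by (simp add: measure_def emeasure_cube)
    then have "u x - cube_average j u (cube_index j x) =
        ?a * ((LBINT y. indicator ?Q y * u x) - (LBINT y. indicator ?Q y * u y))"
      by (simp add: cube_average_def right_diff_distrib)
    also have "\<dots> = ?a * (LBINT y. indicator ?Q y * u x - indicator ?Q y * u y)"
      by (simp add: Bochner_Integration.integral_diff[OF i2 i1])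
    finally have "ennreal \<bar>u x - cube_average j u (cube_index j x)\<bar>
        = ennreal ?a * ennreal \<bar>\<integral>y. indicator ?Q y * u x - indicator ?Q y * u y \<partial>lborel\<bar>"
      by (simp add: abs_mult ennreal_mult')
    also have "ennreal \<bar>\<integral>y. indicator ?Q y * u x - indicator ?Q y * u y \<partial>lborel\<bar>
        \<le> (\<integral>\<^sup>+y. ennreal (norm (indicator ?Q y * u x - indicator ?Q y * u y)) \<partial>lborel)"
      using integral_norm_bound_ennreal[OF Bochner_Integration.integrable_diff[OF i2 i1]] by simp
    also have "\<dots> \<le> (\<integral>\<^sup>+y. indicator T (y - x) * ennreal \<bar>u y - u x\<bar> \<partial>lborel)"
    proof (rule nn_integral_mono)
      fix y
      show "ennreal (norm (indicator ?Q y * u x - indicator ?Q y * u y))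
          \<le> indicator T (y - x) * ennreal \<bar>u y - u x\<bar>"
      proof (cases "y \<in> ?Q")
        case True
        have "\<bar>y $ i - x $ i\<bar> < 1 / real (Suc j)" for i
        proof -
          have "\<lfloor>real (Suc j) * y $ i\<rfloor> = \<lfloor>real (Suc j) * x $ i\<rfloor>"
            using True by (simp add: cube_def cube_index_def vec_eq_iff)
          then have "\<bar>real (Suc j) * y $ i - real (Suc j) * x $ i\<bar> < 1" by linarith
          then have "real (Suc j) * \<bar>y $ i - x $ i\<bar> < 1"
            by (metis abs_mult abs_of_nat right_diff_distrib)
          then show ?thesis by (simp add: field_simps)
        qed
        then have "y - x \<in> T" by (simp add: T)
        then show ?thesis using True by (simp add: abs_minus_commute)
      qed simp
    qed
    also have "\<dots> = (\<integral>\<^sup>+t. indicator T (t + x - x) * ennreal \<bar>u (t + x) - u x\<bar> \<partial>lborel)"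
      by (rule nn_integral_translate[symmetric]) measurable
    finally show ?thesis by (simp add: add.commute mult_left_mono)
  qed
  have "(\<integral>\<^sup>+x. \<bar>u x - cube_average j u (cube_index j x)\<bar> \<partial>lborel)
      \<le> (\<integral>\<^sup>+x. ennreal ?a * (\<integral>\<^sup>+t. indicator T t * ennreal \<bar>u (x + t) - u x\<bar> \<partial>lborel) \<partial>lborel)"
    by (rule nn_integral_mono) (rule pt)
  also have "\<dots> = ennreal ?a * (\<integral>\<^sup>+x. (\<integral>\<^sup>+t. indicator T t * ennreal \<bar>u (x + t) - u x\<bar> \<partial>lborel) \<partial>lborel)"
    by (rule nn_integral_cmult) measurable
  also have "(\<integral>\<^sup>+x. (\<integral>\<^sup>+t. indicator T t * ennreal \<bar>u (x + t) - u x\<bar> \<partial>lborel) \<partial>lborel)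
      = (\<integral>\<^sup>+t. (\<integral>\<^sup>+x. indicator T t * ennreal \<bar>u (x + t) - u x\<bar> \<partial>lborel) \<partial>lborel)"
    by (rule lborel_pair.Fubini') measurable
  also have "\<dots> \<le> (\<integral>\<^sup>+t. ennreal e * indicator T t \<partial>lborel)"
  proof (rule nn_integral_mono)
    fix t :: "real ^ 'n"
    show "(\<integral>\<^sup>+x. indicator T t * ennreal \<bar>u (x + t) - u x\<bar> \<partial>lborel) \<le> ennreal e * indicator T t"
    proof (cases "t \<in> T")
      case True
      then show ?thesis using shift[of t] T by simp
    qed simp
  qed
  also have "\<dots> = ennreal e * emeasure lborel T"
    by (rule nn_integral_cmult_indicator) simp
  also have "ennreal ?a * (ennreal e * emeasure lborel T) = ennreal (2 ^ CARD('n) * e)"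
    unfolding emT using e by (simp add: ennreal_mult'[symmetric] power_divide field_simps)
  finally show ?thesis by (simp add: mult_left_mono)
qed

section \<open>Compactness and the choice of a convergent sequence\<close>

definition bounded_field :: "real \<Rightarrow> ('a::euclidean_space \<Rightarrow> real) \<Rightarrow> bool" where
  "bounded_field M u \<longleftrightarrow> u \<in> borel_measurable borel \<and> (\<forall>x. \<bar>u x\<bar> \<le> M)"

lemma bounded_fieldD:
  assumes "bounded_field M u"
  shows "u \<in> borel_measurable borel" "\<bar>u x\<bar> \<le> M" "u x \<le> M" "- M \<le> u x"
  using assms by (auto simp: bounded_field_def abs_le_iff) (metis minus_le_iff)

text \<open>
  A countable product of compact intervals is compact and metrisable, hence sequentially compact.
\<close>
lemma bounded_families_convergent_subsequence:
  fixes A :: "nat \<Rightarrow> 'i::countable \<Rightarrow> real"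
  assumes "\<And>k i. \<bar>A k i\<bar> \<le> M"
  shows "\<exists>\<sigma> a. strict_mono \<sigma> \<and> (\<forall>i. (\<lambda>k. A (\<sigma> k) i) \<longlonglongrightarrow> a i)"
proof -
  have "compact (PiE UNIV (\<lambda>_::'i. {-M..M}))"
    unfolding compactin_euclidean_iff[symmetric] euclidean_product_topology[symmetric]
    by (subst compactin_PiE) auto
  then have "seq_compact (PiE UNIV (\<lambda>_::'i. {-M..M}))" by (rule compact_imp_seq_compact)
  moreover have "\<forall>k. A k \<in> PiE UNIV (\<lambda>_::'i. {-M..M})"
    using assms by (auto simp: abs_le_iff minus_le_iff)
  ultimately obtain a \<sigma> where "strict_mono \<sigma>" and lim: "(A \<circ> \<sigma>) \<longlonglongrightarrow> a"
    by (rule seq_compactE) 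
  moreover have "(\<lambda>k. A (\<sigma> k) i) \<longlonglongrightarrow> a i" for i
    using continuous_on_tendsto_compose[OF continuous_on_product_coordinates[of i] lim] by simp
  ultimately show ?thesis by blast
qed

text \<open>
  The sequences below converge only locally in \<open>L\<^sup>1\<close>. A finite measure that is at most Lebesgue
  measure and has the same null sets replaces the family of all bounded regions by a single
  \<open>L\<^sup>1\<close> distance, in which bounded functions are integrable.
\<close>
locale finite_reference_measure = finite_measure W for W :: "'a::euclidean_space measure" +
  assumes sets_W [measurable_cong]: "sets W = sets borel"
    and W_le: "g \<in> borel_measurable borel \<Longrightarrow> (\<integral>\<^sup>+x. g x \<partial>W) \<le> (\<integral>\<^sup>+x. g x \<partial>lborel)"
    and AE_W: "(AE x in W. P x) \<Longrightarrow> (AE x in lborel. P x)"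
begin

definition dist1 :: "('a \<Rightarrow> real) \<Rightarrow> ('a \<Rightarrow> real) \<Rightarrow> real" where
  "dist1 p q = (\<integral>x. \<bar>p x - q x\<bar> \<partial>W)"

lemma integrable_W_bounded:
  fixes g :: "'a \<Rightarrow> real"
  assumes "g \<in> borel_measurable borel" "\<And>x. \<bar>g x\<bar> \<le> B"
  shows "integrable W g"
  using assms by (intro integrable_const_bound[of _ B]) auto

lemma dist1_integrable:
  assumes "bounded_field M p" "bounded_field M q"
  shows "integrable W (\<lambda>x. \<bar>p x - q x\<bar>)"
proof (rule integrable_W_bounded[of _ "2 * M"])
  show "(\<lambda>x. \<bar>p x - q x\<bar>) \<in> borel_measurable borel"
    using bounded_fieldD(1)[OF assms(1)] bounded_fieldD(1)[OF assms(2)] by measurable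
  show "\<bar>\<bar>p x - q x\<bar>\<bar> \<le> 2 * M" for x
    using bounded_fieldD(2)[OF assms(1), of x] bounded_fieldD(2)[OF assms(2), of x] by linarith
qed

lemma dist1_nonneg: "0 \<le> dist1 p q"
  by (simp add: dist1_def)

lemma dist1_triangle:
  assumes "bounded_field M p" "bounded_field M q" "bounded_field M g"
  shows "dist1 p g \<le> dist1 p q + dist1 q g"
proof -
  note i = dist1_integrable[OF assms(1,3)] dist1_integrable[OF assms(1,2)] dist1_integrable[OF assms(2,3)]
  have "dist1 p g \<le> (\<integral>x. \<bar>p x - q x\<bar> + \<bar>q x - g x\<bar> \<partial>W)"
    unfolding dist1_def by (intro integral_mono Bochner_Integration.integrable_add i) auto
  then show ?thesis unfolding dist1_def using i by simp
qed

lemma dist1_tendsto_0: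
  assumes p: "\<And>k. bounded_field M (p k)" "bounded_field M q" and lim: "AE x in W. (\<lambda>k. p k x) \<longlonglongrightarrow> q x"
  shows "(\<lambda>k. dist1 (p k) q) \<longlonglongrightarrow> 0"
proof -
  have [measurable]: "p k \<in> borel_measurable borel" "q \<in> borel_measurable borel" for k
    using p by (auto intro: bounded_fieldD)
  have "(\<lambda>k. dist1 (p k) q) \<longlonglongrightarrow> (\<integral>x. 0 \<partial>W)"
    unfolding dist1_def
  proof (rule integral_dominated_convergence[where w = "\<lambda>_. 2 * M"])
    show "AE x in W. (\<lambda>k. \<bar>p k x - q x\<bar>) \<longlonglongrightarrow> 0"
      using lim
    proof eventually_elim
      case (elim x)
      show ?case using tendsto_rabs[OF tendsto_diff[OF elim tendsto_const[of "q x"]]] by simp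
    qed
    show "AE x in W. norm \<bar>p k x - q x\<bar> \<le> 2 * M" for k
    proof (rule AE_I2)
      fix x
      show "norm \<bar>p k x - q x\<bar> \<le> 2 * M"
        using bounded_fieldD(2)[OF p(1), of k x] bounded_fieldD(2)[OF p(2), of x] by simp
    qed
  qed auto
  then show ?thesis by simp
qed

lemma dist1_AE_subsequence:
  assumes p: "\<And>k. bounded_field M (p k)" "bounded_field M q" and lim: "(\<lambda>k. dist1 (p k) q) \<longlonglongrightarrow> 0"
  shows "\<exists>r. strict_mono r \<and> (AE x in W. (\<lambda>k. p (r k) x) \<longlonglongrightarrow> q x)"
proof -
  have [measurable]: "p k \<in> borel_measurable borel" "q \<in> borel_measurable borel" for k
    using p by (auto intro: bounded_fieldD)
  have "integrable W (\<lambda>x. p k x - q x)" for k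
    by (rule Bochner_Integration.integrable_bound[OF dist1_integrable[OF p(1,2), of k]]) auto
  then obtain r where r: "strict_mono r" "AE x in W. (\<lambda>k. p (r k) x - q x) \<longlonglongrightarrow> 0"
    using tendsto_L1_AE_subseq[of W "\<lambda>k x. p k x - q x"] lim unfolding dist1_def by auto
  have "AE x in W. (\<lambda>k. p (r k) x) \<longlonglongrightarrow> q x"
    using r(2) by eventually_elim (simp add: LIM_zero_iff)
  with r(1) show ?thesis by blast
qed

text \<open>
  Completeness of \<open>L\<^sup>1\<close> for uniformly bounded sequences, with a limit that is bounded at every
  point and not only almost everywhere.
\<close>
lemma dist1_complete:
  assumes u: "\<And>k. bounded_field M (u k)"
    and Cauchy: "\<And>e. e > 0 \<Longrightarrow> \<exists>K. \<forall>k\<ge>K. \<forall>l\<ge>K. dist1 (u k) (u l) < e"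
  shows "\<exists>v. bounded_field M v \<and> (\<lambda>k. dist1 (u k) v) \<longlonglongrightarrow> 0"
proof -
  note uD = bounded_fieldD[OF u]
  note [measurable] = uD(1)
  have M0: "0 \<le> M" using uD(2)[of 0 undefined] by linarith
  obtain r where r: "strict_mono r" "AE x in W. Cauchy (\<lambda>i. u (r i) x)"
  proof (rule cauchy_L1_AE_cauchy_subseq[where s = u and M = W])
    show "integrable W (u k)" for k by (rule integrable_W_bounded[OF uD(1,2)])
    show "\<exists>N. \<forall>i\<ge>N. \<forall>j\<ge>N. (LINT x|W. norm (u i x - u j x)) < e" if "e > 0" for e
      using Cauchy[OF that] by (simp add: dist1_def)
  qed
  \<comment> \<open>The truncation keeps the bound where the subsequence does not converge.\<close>
  define L where "L x = lim (\<lambda>i. u (r i) x)" for x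
  define v where "v x = (if \<bar>L x\<bar> \<le> M then L x else 0)" for x
  have [measurable]: "L \<in> borel_measurable borel"
    unfolding L_def by (rule borel_measurable_lim_metric) measurable
  have "v \<in> borel_measurable borel" unfolding v_def by measurable
  then have v: "bounded_field M v" using M0 by (simp add: bounded_field_def v_def)
  have v_lim: "(\<lambda>i. u (r i) x) \<longlonglongrightarrow> v x" if "Cauchy (\<lambda>i. u (r i) x)" for x
  proof -
    have lim: "(\<lambda>i. u (r i) x) \<longlonglongrightarrow> L x"
      using that by (simp add: L_def Cauchy_convergent_iff convergent_LIMSEQ_iff)
    have "\<bar>L x\<bar> \<le> M" by (rule tendsto_upperbound[OF tendsto_rabs[OF lim]]) (auto simp: uD(2))
    with lim show ?thesis by (simp add: v_def)
  qed
  have sub: "(\<lambda>i. dist1 (u (r i)) v) \<longlonglongrightarrow> 0"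
    by (rule dist1_tendsto_0[OF u v]) (use r(2) v_lim in \<open>auto elim!: eventually_mono\<close>)
  have "(\<lambda>k. dist1 (u k) v) \<longlonglongrightarrow> 0"
  proof (rule LIMSEQ_I)
    fix e :: real assume "e > 0"
    then obtain K where K: "\<And>k l. k \<ge> K \<Longrightarrow> l \<ge> K \<Longrightarrow> dist1 (u k) (u l) < e / 2"
      using Cauchy[of "e/2"] by auto
    have "\<forall>\<^sub>F i in sequentially. dist1 (u (r i)) v < e / 2"
      using sub \<open>e > 0\<close> by (intro order_tendstoD) auto
    then obtain i where i: "dist1 (u (r i)) v < e / 2" "K \<le> i"
      using eventually_happens'[OF sequentially_bot eventually_conj[OF _ eventually_ge_at_top[of K]]] by blast
    have ri: "K \<le> r i" using i(2) seq_suble[OF r(1), of i] by linarith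
    have "norm (dist1 (u k) v - 0) < e" if "k \<ge> K" for k
      using dist1_triangle[OF u u v, of k "r i"] K[OF that ri] i(1) dist1_nonneg[of "u k" v] by simp
    then show "\<exists>no. \<forall>n\<ge>no. norm (dist1 (u n) v - 0) < e" by blast
  qed
  with v show ?thesis by blast
qed

end

text \<open>
  The density is \<open>1\<close> on the unit ball and the integrable kernel outside.
\<close>
lemma finite_reference_measure_exists: "\<exists>W :: 'a::euclidean_space measure. finite_reference_measure W"
proof -
  define w where "w x = indicator (ball 0 1) x + indicator {x. 1 \<le> norm x} x * levy_kernel 1 x" for x :: 'a
  have "emeasure lborel (ball (0::'a) 1) < \<infinity>" using emeasure_bounded_finite[of "ball (0::'a) 1"] by simp
  then have wi: "integrable lborel w" unfolding w_def
    by (intro Bochner_Integration.integrable_add integrable_levy_kernel_outer) (auto intro!: integrable_real_indicator)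
  then have [measurable]: "w \<in> borel_measurable borel" by auto
  have w: "0 < w x" "w x \<le> 1" for x
  proof -
    have "0 < w x \<and> w x \<le> 1"
    proof (cases "norm x < 1")
      case False
      then have "1 \<le> norm x powr (real DIM('a) + 1)" using ge_one_powr_ge_zero[of "norm x" "real DIM('a) + 1"] by simp
      then show ?thesis using False by (auto simp: w_def levy_kernel_def inverse_le_1_iff)
    qed (simp add: w_def)
    then show "0 < w x" "w x \<le> 1" by auto
  qed
  have "finite_measure (density lborel w)"
  proof (rule finite_measureI)
    have "(\<integral>\<^sup>+x. w x \<partial>lborel) = ennreal (LBINT x. w x)"
      by (rule nn_integral_eq_integral[OF wi]) (simp add: w less_imp_le)
    then show "emeasure (density lborel w) (space (density lborel w)) \<noteq> \<infinity>"
      by (simp add: emeasure_density)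
  qed
  moreover have "finite_reference_measure_axioms (density lborel w)"
  proof
    show "sets (density lborel w) = sets borel" by simp
    show "(\<integral>\<^sup>+x. g x \<partial>density lborel w) \<le> (\<integral>\<^sup>+x. g x \<partial>lborel)" if [measurable]: "g \<in> borel_measurable borel" for g
    proof -
      have "(\<integral>\<^sup>+x. g x \<partial>density lborel w) = (\<integral>\<^sup>+x. ennreal (w x) * g x \<partial>lborel)"
        by (rule nn_integral_density) measurable
      also have "\<dots> \<le> (\<integral>\<^sup>+x. 1 * g x \<partial>lborel)"
        using w(2) by (intro nn_integral_mono mult_right_mono) (auto simp: ennreal_le_1)
      finally show ?thesis by simp
    qed
    show "AE x in lborel. P x" if "AE x in density lborel w. P x" for P
      using that w(1) by (simp add: AE_density)
  qed
  ultimately show ?thesis unfolding finite_reference_measure_def by blast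
qed

text \<open>
  The compactness criterion of Frechet, Kolmogorov and Riesz, for countably many sequences at once.
  All averages over all cubes converge along one subsequence. By equicontinuity, the averages
  over fine cubes are close to the functions, uniformly in \<open>k\<close>, so the functions are a Cauchy
  sequence. A common subsequence is needed to compare the limits for different \<open>m\<close>.
\<close>
lemma common_convergent_subsequence:
  fixes u :: "nat \<Rightarrow> nat \<Rightarrow> real ^ 'n \<Rightarrow> real"
  assumes W: "finite_reference_measure W"
    and u: "\<And>m k. bounded_field M (u m k)"
    and equi: "\<And>m e. e > 0 \<Longrightarrow> \<exists>d>0. \<forall>k y. norm y < d \<longrightarrow>
        L1_dist (\<lambda>x. u m k (x + y)) (u m k) \<le> ennreal e"
  shows "\<exists>\<sigma> v. strict_mono \<sigma> \<and> (\<forall>m. bounded_field M (v m) \<and>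
      (\<lambda>k. finite_reference_measure.dist1 W (u m (\<sigma> k)) (v m)) \<longlonglongrightarrow> 0)"
proof -
  interpret W: finite_reference_measure W by fact
  note uD = bounded_fieldD[OF u]
  note [measurable] = uD(1)
  define A where "A k i = (case i of (m, j, q) \<Rightarrow> cube_average j (u m k) q)" for k i
  have "\<bar>A k i\<bar> \<le> M" for k i
    using cube_average_bound[OF uD(1,2)] by (auto simp: A_def split: prod.split)
  then obtain \<sigma> a where \<sigma>: "strict_mono \<sigma>" and a: "\<And>i. (\<lambda>k. A (\<sigma> k) i) \<longlonglongrightarrow> a i"
    using bounded_families_convergent_subsequence[of A M] by blast
  have "\<exists>v. bounded_field M v \<and> (\<lambda>k. W.dist1 (u m (\<sigma> k)) v) \<longlonglongrightarrow> 0" for m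
  proof (rule W.dist1_complete[OF u])
    fix e :: real assume e: "e > 0"
    \<comment> \<open>The factor \<open>2 ^ CARD('n)\<close> is the price of averaging over cubes, and four errors add up to \<open>e\<close>.\<close>
    define e' where "e' = e / (4 * 2 ^ CARD('n))"
    have e': "e' > 0" using e by (simp add: e'_def)
    obtain d where d: "d > 0" "\<And>k y. norm y < d \<Longrightarrow>
        L1_dist (\<lambda>x. u m k (x + y)) (u m k) \<le> ennreal e'"
      using equi[OF e', of m] by blast
    obtain j where j: "real CARD('n) / d < real (Suc j)"
      by (meson less_Suc_eq_0_disj of_nat_less_iff order_less_trans reals_Archimedean2 lessI)
    define P where "P k x = cube_average j (u m (\<sigma> k)) (cube_index j x)" for k x
    have P: "bounded_field M (P k)" for k
      unfolding bounded_field_def P_def using cube_average_bound[OF uD(1,2)]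
      by (auto intro: measurable_compose[OF cube_index_measurable])
    note [measurable] = bounded_fieldD(1)[OF P]
    have near: "W.dist1 (u m (\<sigma> k)) (P k) \<le> e / 4" for k
    proof -
      have "(\<integral>\<^sup>+x. \<bar>u m (\<sigma> k) x - P k x\<bar> \<partial>W) \<le> L1_dist (u m (\<sigma> k)) (P k)"
        by (rule W.W_le) measurable
      also have "\<dots> \<le> ennreal (2 ^ CARD('n) * e')"
        unfolding P_def
      proof (rule cube_average_L1[OF uD(1,2)])
        fix t :: "real ^ 'n" assume t: "\<And>i. \<bar>t $ i\<bar> < 1 / real (Suc j)"
        have "norm t \<le> (\<Sum>i\<in>UNIV. \<bar>t $ i\<bar>)" by (rule norm_le_l1_cart)
        also have "\<dots> \<le> (\<Sum>i\<in>(UNIV::'n set). 1 / real (Suc j))"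
          using t by (intro sum_mono) (simp add: less_imp_le)
        also have "\<dots> = real CARD('n) / real (Suc j)" by simp
        also have "\<dots> < d" using j d(1) by (simp add: field_simps)
        finally show "(\<integral>\<^sup>+x. \<bar>u m (\<sigma> k) (x + t) - u m (\<sigma> k) x\<bar> \<partial>lborel) \<le> ennreal e'"
          by (rule d(2))
      qed (use e' in auto)
      also have "2 ^ CARD('n) * e' = e / 4" by (simp add: e'_def)
      finally have "enn2real (\<integral>\<^sup>+x. \<bar>u m (\<sigma> k) x - P k x\<bar> \<partial>W) \<le> e / 4"
        using e by (intro enn2real_leI) auto
      moreover have "W.dist1 (u m (\<sigma> k)) (P k) = enn2real (\<integral>\<^sup>+x. \<bar>u m (\<sigma> k) x - P k x\<bar> \<partial>W)"
        unfolding W.dist1_def by (rule integral_eq_nn_integral) auto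
      ultimately show ?thesis by simp
    qed
    define P' where "P' x = a (m, j, cube_index j x)" for x
    have Plim: "(\<lambda>k. P k x) \<longlonglongrightarrow> P' x" for x
      using a[of "(m, j, cube_index j x)"] by (simp add: A_def P_def P'_def)
    have "P' \<in> borel_measurable borel"
      unfolding P'_def by (rule measurable_compose[OF cube_index_measurable]) simp
    moreover have "\<bar>P' x\<bar> \<le> M" for x
      by (rule tendsto_upperbound[OF tendsto_rabs[OF Plim]]) (auto simp: bounded_fieldD(2)[OF P])
    ultimately have P': "bounded_field M P'" by (simp add: bounded_field_def)
    have "\<forall>\<^sub>F k in sequentially. W.dist1 (P k) P' < e / 4"
      using W.dist1_tendsto_0[OF P P' AE_I2[OF Plim]] e by (intro order_tendstoD) auto
    then obtain K where K: "\<And>k. k \<ge> K \<Longrightarrow> W.dist1 (P k) P' < e / 4"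
      by (auto simp: eventually_sequentially)
    have "W.dist1 (u m (\<sigma> k)) (u m (\<sigma> l)) < e" if kl: "k \<ge> K" "l \<ge> K" for k l
    proof -
      have half: "W.dist1 (u m (\<sigma> k)) P' < e / 2" if "k \<ge> K" for k
        using W.dist1_triangle[OF u P P', of m "\<sigma> k" k] near[of k] K[OF that] by linarith
      then show ?thesis
        using W.dist1_triangle[OF u P' u, of m "\<sigma> k" m "\<sigma> l"] half[OF kl(1)] half[OF kl(2)]
        by (simp add: W.dist1_def abs_minus_commute)
    qed
    then show "\<exists>K. \<forall>k\<ge>K. \<forall>l\<ge>K. W.dist1 (u m (\<sigma> k)) (u m (\<sigma> l)) < e" by blast
  qed
  then have "\<exists>v. \<forall>m. bounded_field M (v m) \<and> (\<lambda>k. W.dist1 (u m (\<sigma> k)) (v m)) \<longlonglongrightarrow> 0"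
    by (intro choice allI)
  then show ?thesis using \<sigma> by blast
qed

text \<open>
  The equicontinuity may degenerate as \<open>m\<close> grows. But the order in \<open>m\<close> passes to the limits \<open>V m\<close>
  in \<open>k\<close>, and bounded increasing sequences converge to their supremum. Indices \<open>k\<close> that
  grow fast enough with \<open>m\<close> then give a diagonal sequence with the same limit.
\<close>
lemma monotone_diagonal_selection:
  fixes U :: "nat \<Rightarrow> nat \<Rightarrow> real ^ 'n \<Rightarrow> real"
  assumes U: "\<And>m k. bounded_field M (U m k)"
    and equi: "\<And>m e. e > 0 \<Longrightarrow> \<exists>d>0. \<forall>k y. norm y < d \<longrightarrow>
        L1_dist (\<lambda>x. U m k (x + y)) (U m k) \<le> ennreal e"
    and mono: "\<And>m m' k x. m \<le> m' \<Longrightarrow> U m k x \<le> U m' k x"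
  shows "\<exists>u \<mu> \<kappa>. bounded_field M u \<and> (\<forall>j. j \<le> \<mu> j \<and> j \<le> \<kappa> j) \<and>
    (AE x in lborel. (\<lambda>j. U (\<mu> j) (\<kappa> j) x) \<longlonglongrightarrow> u x)"
proof -
  obtain W :: "(real ^ 'n) measure" where W: "finite_reference_measure W"
    using finite_reference_measure_exists by blast
  interpret W: finite_reference_measure W by fact
  obtain \<sigma> V where \<sigma>: "strict_mono \<sigma>" and V: "\<And>m. bounded_field M (V m)"
    and lim: "\<And>m. (\<lambda>k. W.dist1 (U m (\<sigma> k)) (V m)) \<longlonglongrightarrow> 0"
    using common_convergent_subsequence[of W M U, OF W U equi] by blast
  note VD = bounded_fieldD[OF V]
  note [measurable] = VD(1)
  \<comment> \<open>The order holds before the limit, so the positive part of the wrong difference has integral \<open>0\<close>.\<close>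
  have V_mono: "AE x in W. V m x \<le> V (Suc m) x" for m
  proof -
    define g where "g x = max 0 (V m x - V (Suc m) x)" for x
    have [measurable]: "g \<in> borel_measurable borel" unfolding g_def by measurable
    have g0: "0 \<le> g x" for x by (simp add: g_def)
    have gi: "integrable W g"
      by (rule Bochner_Integration.integrable_bound[OF W.dist1_integrable[OF V V, of m "Suc m"]])
        (auto simp: g_def)
    have "(\<integral>x. g x \<partial>W) \<le> 0"
    proof (rule tendsto_lowerbound)
      show "(\<lambda>k. W.dist1 (U m (\<sigma> k)) (V m) + W.dist1 (U (Suc m) (\<sigma> k)) (V (Suc m))) \<longlonglongrightarrow> 0"
        using tendsto_add[OF lim[of m] lim[of "Suc m"]] by simp
      have "(\<integral>x. g x \<partial>W) \<le> W.dist1 (U m (\<sigma> k)) (V m) + W.dist1 (U (Suc m) (\<sigma> k)) (V (Suc m))" for k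
      proof -
        note i = W.dist1_integrable[OF U V, of m "\<sigma> k" m] W.dist1_integrable[OF U V, of "Suc m" "\<sigma> k" "Suc m"]
        have "(\<integral>x. g x \<partial>W) \<le> (\<integral>x. \<bar>U m (\<sigma> k) x - V m x\<bar> + \<bar>U (Suc m) (\<sigma> k) x - V (Suc m) x\<bar> \<partial>W)"
        proof (rule integral_mono[OF gi])
          fix x
          show "g x \<le> \<bar>U m (\<sigma> k) x - V m x\<bar> + \<bar>U (Suc m) (\<sigma> k) x - V (Suc m) x\<bar>"
            using mono[of m "Suc m" "\<sigma> k" x] unfolding g_def by linarith
        qed (use i in auto)
        then show ?thesis using i by (simp add: W.dist1_def)
      qed
      then show "\<forall>\<^sub>F k in sequentially. (\<integral>x. g x \<partial>W)
          \<le> W.dist1 (U m (\<sigma> k)) (V m) + W.dist1 (U (Suc m) (\<sigma> k)) (V (Suc m))" by simp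
    qed simp
    moreover have "0 \<le> (\<integral>x. g x \<partial>W)" by (simp add: g0)
    ultimately have "(\<integral>x. g x \<partial>W) = 0" by linarith
    then have "AE x in W. g x = 0"
      using integral_nonneg_eq_0_iff_AE[OF gi] g0 by simp
    then show ?thesis by eventually_elim (simp add: g_def max_def split: if_splits)
  qed
  define u where "u x = (SUP m. V m x)" for x
  have bdd: "bdd_above (range (\<lambda>m. V m x))" for x
    using VD(3) by (intro bdd_aboveI[of _ M]) auto
  have u: "bounded_field M u"
  proof -
    have "u \<in> borel_measurable borel"
      unfolding u_def by (rule borel_measurable_cSUP) (use bdd in auto)
    moreover have "\<bar>u x\<bar> \<le> M" for x
    proof -
      have "u x \<le> M" unfolding u_def using VD(3) by (intro cSUP_least) auto
      moreover have "V 0 x \<le> u x" unfolding u_def by (rule cSUP_upper[OF _ bdd]) simp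
      ultimately show ?thesis using VD(4)[of 0 x] by linarith
    qed
    ultimately show ?thesis by (simp add: bounded_field_def)
  qed
  have "AE x in W. (\<lambda>m. V m x) \<longlonglongrightarrow> u x"
  proof -
    have "AE x in W. \<forall>m. V m x \<le> V (Suc m) x" using V_mono by (simp add: AE_all_countable)
    then show ?thesis
    proof eventually_elim
      case (elim x)
      then have "incseq (\<lambda>m. V m x)" by (intro incseq_SucI) simp
      then show ?case unfolding u_def by (rule LIMSEQ_incseq_SUP[OF bdd])
    qed
  qed
  then have Vu: "(\<lambda>m. W.dist1 (V m) u) \<longlonglongrightarrow> 0" by (rule W.dist1_tendsto_0[OF V u])
  have "\<exists>k\<ge>m. W.dist1 (U m (\<sigma> k)) (V m) < 1 / real (Suc m)" for m
  proof -
    have "\<forall>\<^sub>F k in sequentially. W.dist1 (U m (\<sigma> k)) (V m) < 1 / real (Suc m)"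
      using lim[of m] by (intro order_tendstoD) auto
    then show ?thesis
      using eventually_happens'[OF sequentially_bot eventually_conj[OF _ eventually_ge_at_top[of m]]] by blast
  qed
  then obtain \<kappa> where \<kappa>: "\<And>m. m \<le> \<kappa> m" "\<And>m. W.dist1 (U m (\<sigma> (\<kappa> m))) (V m) < 1 / real (Suc m)"
    by metis
  define y where "y m = U m (\<sigma> (\<kappa> m))" for m
  have y: "bounded_field M (y m)" for m by (simp add: y_def U)
  have "(\<lambda>m. W.dist1 (y m) u) \<longlonglongrightarrow> 0"
  proof (rule tendsto_sandwich[OF _ _ tendsto_const])
    show "(\<lambda>m. 1 / real (Suc m) + W.dist1 (V m) u) \<longlonglongrightarrow> 0"
      using tendsto_add[OF LIMSEQ_inverse_real_of_nat Vu] by (simp add: inverse_eq_divide)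
    have "W.dist1 (y m) u \<le> 1 / real (Suc m) + W.dist1 (V m) u" for m
      using W.dist1_triangle[OF y V u, of m m] \<kappa>(2)[of m] by (simp add: y_def)
    then show "\<forall>\<^sub>F m in sequentially. W.dist1 (y m) u \<le> 1 / real (Suc m) + W.dist1 (V m) u" by simp
  qed (simp add: W.dist1_nonneg)
  then obtain \<rho> where \<rho>: "strict_mono \<rho>" "AE x in W. (\<lambda>j. y (\<rho> j) x) \<longlonglongrightarrow> u x"
    using W.dist1_AE_subsequence[of M y u, OF y u] by blast
  have l1: "AE x in lborel. (\<lambda>j. U (\<rho> j) (\<sigma> (\<kappa> (\<rho> j))) x) \<longlonglongrightarrow> u x"
    using W.AE_W[OF \<rho>(2)] by (simp add: y_def)
  have l2: "j \<le> \<rho> j \<and> j \<le> \<sigma> (\<kappa> (\<rho> j))" for j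
    using seq_suble[OF \<rho>(1), of j] \<kappa>(1)[of "\<rho> j"] seq_suble[OF \<sigma>, of "\<kappa> (\<rho> j)"] by linarith
  show ?thesis
    by (rule exI[of _ u], rule exI[of _ \<rho>], rule exI[of _ "\<lambda>j. \<sigma> (\<kappa> (\<rho> j))"]) (simp only: l1 l2 u simp_thms)
qed

section \<open>Order preserving implicit equations\<close>

text \<open>
  The properties of the discretised operator on which existence and stability of the scheme rest:
  \<open>D * u x - T u x\<close> compares \<open>u x\<close> with the values of \<open>u\<close> at other points, \<open>T_mono\<close> is the discrete
  maximum principle, and \<open>T_L1\<close> is what \<open>L\<^sup>1\<close> contraction needs.
\<close>
locale monotone_averaging =
  fixes M D :: real and T :: "('a::euclidean_space \<Rightarrow> real) \<Rightarrow> 'a \<Rightarrow> real"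
  assumes D_nonneg: "0 \<le> D"
    and T_measurable: "bounded_field M u \<Longrightarrow> T u \<in> borel_measurable borel"
    and T_mono: "bounded_field M u \<Longrightarrow> bounded_field M v \<Longrightarrow> (\<And>x. u x \<le> v x) \<Longrightarrow> T u x \<le> T v x"
    and T_const: "\<bar>c\<bar> \<le> M \<Longrightarrow> T (\<lambda>_. c) x = D * c"
    and T_lim: "(\<And>n. bounded_field M (U n)) \<Longrightarrow> bounded_field M u \<Longrightarrow> (\<And>x. (\<lambda>n. U n x) \<longlonglongrightarrow> u x) \<Longrightarrow>
        (\<lambda>n. T (U n) x) \<longlonglongrightarrow> T u x"
    and T_translate: "bounded_field M u \<Longrightarrow> T (\<lambda>x. u (x + y)) x = T u (x + y)"
    and T_L1: "bounded_field M u \<Longrightarrow> bounded_field M v \<Longrightarrow>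
        L1_dist (T u) (T v) \<le> ennreal D * L1_dist u v"

lemma monotone_averaging_add:
  assumes "monotone_averaging M D1 T1" and "monotone_averaging M D2 T2"
  shows "monotone_averaging M (D1 + D2) (\<lambda>u x. T1 u x + T2 u x)"
proof -
  interpret T1: monotone_averaging M D1 T1 by fact
  interpret T2: monotone_averaging M D2 T2 by fact
  show ?thesis
  proof
    fix u v :: "'a \<Rightarrow> real" assume uv: "bounded_field M u" "bounded_field M v"
    have [measurable]: "T1 u \<in> borel_measurable borel" "T1 v \<in> borel_measurable borel"
      "T2 u \<in> borel_measurable borel" "T2 v \<in> borel_measurable borel"
      using uv by (auto intro: T1.T_measurable T2.T_measurable)
    have "(\<integral>\<^sup>+x. \<bar>T1 u x + T2 u x - (T1 v x + T2 v x)\<bar> \<partial>lborel)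
        \<le> (\<integral>\<^sup>+x. ennreal \<bar>T1 u x - T1 v x\<bar> + ennreal \<bar>T2 u x - T2 v x\<bar> \<partial>lborel)"
      by (rule nn_integral_mono) (simp add: ennreal_plus[symmetric] ennreal_leI del: ennreal_plus)
    also have "\<dots> = L1_dist (T1 u) (T1 v) + L1_dist (T2 u) (T2 v)"
      by (rule nn_integral_add) auto
    also have "\<dots> \<le> ennreal D1 * L1_dist u v + ennreal D2 * L1_dist u v"
      by (intro add_mono T1.T_L1 T2.T_L1 uv)
    also have "\<dots> = ennreal (D1 + D2) * L1_dist u v"
      using T1.D_nonneg T2.D_nonneg by (simp add: distrib_right)
    finally show "(\<integral>\<^sup>+x. \<bar>T1 u x + T2 u x - (T1 v x + T2 v x)\<bar> \<partial>lborel)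
        \<le> ennreal (D1 + D2) * L1_dist u v" .
  qed (auto simp: T1.D_nonneg T2.D_nonneg T1.T_const T2.T_const T1.T_translate T2.T_translate distrib_right
      intro!: add_mono T1.T_mono T2.T_mono tendsto_add T1.T_lim T2.T_lim borel_measurable_add
        T1.T_measurable T2.T_measurable)
qed

lemma monotone_averaging_zero: "monotone_averaging M 0 (\<lambda>u x. 0)"
  by standard auto

lemma monotone_averaging_sum:
  assumes "finite I" "\<And>i. i \<in> I \<Longrightarrow> monotone_averaging M (D i) (T i)"
  shows "monotone_averaging M (\<Sum>i\<in>I. D i) (\<lambda>u x. \<Sum>i\<in>I. T i u x)"
  using assms
proof (induction I rule: finite_induct)
  case empty then show ?case by (simp add: monotone_averaging_zero)
next
  case (insert i I)
  then show ?case by (simp add: monotone_averaging_add)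
qed

text \<open>
  The equation is \<open>b (u x) + \<epsilon> * (u x + M) + D * u x = T u x + f x\<close>. The penalisation \<open>\<epsilon> * (u x + M)\<close>
  makes the problem strictly monotone also where \<open>b\<close> is constant; it is shifted by \<open>M\<close> in order to be
  nonnegative, so that solutions are monotone in \<open>\<epsilon>\<close>.
\<close>
locale implicit_equation = monotone_averaging M D T
  for M D :: real and T :: "('a::euclidean_space \<Rightarrow> real) \<Rightarrow> 'a \<Rightarrow> real" +
  fixes b :: "real \<Rightarrow> real" and L :: real
  assumes M_nonneg: "0 \<le> M" and b_mono: "mono b" and L_nonneg: "0 \<le> L"
    and b_lipschitz: "\<And>r r'. \<bar>b r - b r'\<bar> \<le> L * \<bar>r - r'\<bar>"
begin

text \<open>
  The bounds say that the constants \<open>- M\<close> and \<open>M\<close> are a subsolution and a supersolution.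
\<close>
definition datum :: "('a \<Rightarrow> real) \<Rightarrow> bool" where
  "datum f \<longleftrightarrow> f \<in> borel_measurable borel \<and> (\<forall>x. b (- M) \<le> f x \<and> f x \<le> b M)"

text \<open>
  The step size is so small that \<open>relax\<close> is nondecreasing. It does not depend on \<open>\<epsilon>\<close>, so the
  iterates for different values of \<open>\<epsilon>\<close> can be compared.
\<close>
definition \<tau> :: real where "\<tau> = 1 / (L + 1 + D)"

definition relax :: "real \<Rightarrow> real \<Rightarrow> real" where
  "relax \<epsilon> r = r - \<tau> * (b r + \<epsilon> * (r + M) + D * r)"

text \<open>
  The fixed points are the solutions of the equation, and \<open>step \<epsilon> f\<close> is order preserving. An explicit step
  avoids inverting the function \<open>\<lambda>r. b r + D * r\<close>.
\<close>
definition step :: "real \<Rightarrow> ('a \<Rightarrow> real) \<Rightarrow> ('a \<Rightarrow> real) \<Rightarrow> 'a \<Rightarrow> real" where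
  "step \<epsilon> f u x = relax \<epsilon> (u x) + \<tau> * (T u x + f x)"

fun iterate :: "real \<Rightarrow> ('a \<Rightarrow> real) \<Rightarrow> nat \<Rightarrow> 'a \<Rightarrow> real" where
  "iterate \<epsilon> f 0 = (\<lambda>_. - M)"
| "iterate \<epsilon> f (Suc n) = step \<epsilon> f (iterate \<epsilon> f n)"

definition sol :: "real \<Rightarrow> ('a \<Rightarrow> real) \<Rightarrow> 'a \<Rightarrow> real" where
  "sol \<epsilon> f x = lim (\<lambda>n. iterate \<epsilon> f n x)"

lemma \<tau>_pos: "0 < \<tau>" using D_nonneg L_nonneg by (simp add: \<tau>_def)

lemma b_continuous: "continuous_on UNIV b"
proof -
  have "L-lipschitz_on UNIV b"
    using b_lipschitz L_nonneg by (intro lipschitz_onI) (auto simp: dist_real_def)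
  then show ?thesis by (rule lipschitz_on_continuous_on)
qed

lemma b_measurable [measurable]: "b \<in> borel_measurable borel"
  by (rule borel_measurable_continuous_onI[OF b_continuous])

text \<open>
  The upper bound drops the contribution of \<open>b\<close>, which is nonnegative: this is where the factor
  \<open>1 - \<tau> * (\<epsilon> + D)\<close> of the contraction comes from.
\<close>
lemma relax_increment:
  assumes "r \<le> r'" "0 \<le> \<epsilon>" "\<epsilon> \<le> 1"
  shows "0 \<le> relax \<epsilon> r' - relax \<epsilon> r" "relax \<epsilon> r' - relax \<epsilon> r \<le> (1 - \<tau> * (\<epsilon> + D)) * (r' - r)"
proof -
  have eq: "relax \<epsilon> r' - relax \<epsilon> r = (r' - r) - \<tau> * ((b r' - b r) + (\<epsilon> + D) * (r' - r))"
    by (simp add: relax_def algebra_simps)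
  have b: "0 \<le> b r' - b r" "b r' - b r \<le> L * (r' - r)"
    using monoD[OF b_mono assms(1)] b_lipschitz[of r' r] assms(1) by auto
  have "\<epsilon> * (r' - r) \<le> 1 * (r' - r)" using assms by (intro mult_right_mono) auto
  with b have "(b r' - b r) + (\<epsilon> + D) * (r' - r) \<le> (L + 1 + D) * (r' - r)"
    by (simp add: algebra_simps)
  then have "\<tau> * ((b r' - b r) + (\<epsilon> + D) * (r' - r)) \<le> \<tau> * ((L + 1 + D) * (r' - r))"
    using \<tau>_pos by (intro mult_left_mono) auto
  also have "\<dots> = r' - r" using D_nonneg L_nonneg by (simp add: \<tau>_def)
  finally show "0 \<le> relax \<epsilon> r' - relax \<epsilon> r" using eq by simp
  have "0 \<le> \<tau> * (b r' - b r)" using \<tau>_pos b by simp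
  then show "relax \<epsilon> r' - relax \<epsilon> r \<le> (1 - \<tau> * (\<epsilon> + D)) * (r' - r)"
    unfolding eq by (simp add: algebra_simps)
qed

text \<open>
  A smaller \<open>\<epsilon>\<close> gives a larger value, because \<open>v x + M\<close> is nonnegative.
\<close>
lemma step_mono:
  assumes "bounded_field M u" "bounded_field M v" "\<And>x. u x \<le> v x" "\<And>x. f x \<le> g x"
    and "0 \<le> \<epsilon>'" "\<epsilon>' \<le> \<epsilon>" "\<epsilon> \<le> 1"
  shows "step \<epsilon> f u x \<le> step \<epsilon>' g v x"
proof -
  have "relax \<epsilon> (u x) \<le> relax \<epsilon> (v x)" using relax_increment(1)[of "u x" "v x" \<epsilon>] assms by auto
  also have "\<dots> \<le> relax \<epsilon>' (v x)"
  proof -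
    have "\<epsilon>' * (v x + M) \<le> \<epsilon> * (v x + M)"
      using bounded_fieldD(4)[OF assms(2), of x] assms by (intro mult_right_mono) auto
    then show ?thesis unfolding relax_def using \<tau>_pos by simp
  qed
  finally have "relax \<epsilon> (u x) \<le> relax \<epsilon>' (v x)" .
  moreover have "\<tau> * (T u x + f x) \<le> \<tau> * (T v x + g x)"
    using \<tau>_pos assms by (intro mult_left_mono add_mono T_mono) auto
  ultimately show ?thesis by (simp add: step_def)
qed

lemma step_lower:
  assumes "datum f" "0 \<le> \<epsilon>" "\<epsilon> \<le> 1"
  shows "- M \<le> step \<epsilon> f (\<lambda>_. - M) x"
proof -
  have "step \<epsilon> f (\<lambda>_. - M) x = - M + \<tau> * (f x - b (- M))"
    unfolding step_def relax_def using T_const[of "- M" x] M_nonneg by (simp add: algebra_simps)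
  moreover have "0 \<le> \<tau> * (f x - b (- M))" using \<tau>_pos assms by (auto simp: datum_def)
  ultimately show ?thesis by simp
qed

lemma step_upper:
  assumes "datum f" "0 \<le> \<epsilon>" "\<epsilon> \<le> 1"
  shows "step \<epsilon> f (\<lambda>_. M) x \<le> M"
proof -
  have "step \<epsilon> f (\<lambda>_. M) x = M - \<tau> * (b M - f x + \<epsilon> * (M + M))"
    unfolding step_def relax_def using T_const[of M x] M_nonneg by (simp add: algebra_simps)
  moreover have "0 \<le> \<tau> * (b M - f x + \<epsilon> * (M + M))"
    using \<tau>_pos assms M_nonneg by (intro mult_nonneg_nonneg add_nonneg_nonneg) (auto simp: datum_def)
  ultimately show ?thesis by simp
qed

lemma step_bounded_field:
  assumes u: "bounded_field M u" and f: "datum f" and \<epsilon>: "0 \<le> \<epsilon>" "\<epsilon> \<le> 1"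
  shows "bounded_field M (step \<epsilon> f u)"
proof -
  have [measurable]: "u \<in> borel_measurable borel" "T u \<in> borel_measurable borel" "f \<in> borel_measurable borel"
    using u f by (auto simp: bounded_fieldD T_measurable datum_def)
  have "(\<lambda>x. step \<epsilon> f u x) \<in> borel_measurable borel"
    unfolding step_def relax_def by measurable
  moreover have "\<bar>step \<epsilon> f u x\<bar> \<le> M" for x
  proof -
    have c: "bounded_field M (\<lambda>_. - M)" "bounded_field M (\<lambda>_. M)"
      using M_nonneg by (auto simp: bounded_field_def)
    have "step \<epsilon> f (\<lambda>_. - M) x \<le> step \<epsilon> f u x"
      by (rule step_mono[OF c(1) u]) (use bounded_fieldD[OF u] \<epsilon> in auto)
    moreover have "step \<epsilon> f u x \<le> step \<epsilon> f (\<lambda>_. M) x"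
      by (rule step_mono[OF u c(2)]) (use bounded_fieldD[OF u] \<epsilon> in auto)
    ultimately show ?thesis using step_lower[OF f \<epsilon>, of x] step_upper[OF f \<epsilon>, of x] by linarith
  qed
  ultimately show ?thesis by (simp add: bounded_field_def)
qed

text \<open>
  The bound \<open>A / \<epsilon>\<close> is the fixed point of \<open>\<lambda>a. (1 - \<tau> * \<epsilon>) * a + \<tau> * A\<close>; the terms with \<open>D\<close>
  cancel, since \<open>T\<close> has Lipschitz constant \<open>D\<close>.
\<close>
lemma step_L1:
  assumes u: "bounded_field M u" and v: "bounded_field M v" and f: "datum f" and g: "datum g"
    and \<epsilon>: "0 < \<epsilon>" "\<epsilon> \<le> 1" and A: "L1_dist f g \<le> ennreal A" "0 \<le> A"
    and uv: "L1_dist u v \<le> ennreal (A / \<epsilon>)"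
  shows "L1_dist (step \<epsilon> f u) (step \<epsilon> g v) \<le> ennreal (A / \<epsilon>)"
proof -
  have [measurable]: "u \<in> borel_measurable borel" "T u \<in> borel_measurable borel" "f \<in> borel_measurable borel"
    "v \<in> borel_measurable borel" "T v \<in> borel_measurable borel" "g \<in> borel_measurable borel"
    using u f v g by (auto simp: bounded_fieldD T_measurable datum_def)
  define k where "k = 1 - \<tau> * (\<epsilon> + D)"
  have k0: "0 \<le> k"
  proof -
    have "0 \<le> k * (1 - 0)" using relax_increment[of 0 1 \<epsilon>] \<epsilon> unfolding k_def by linarith
    then show ?thesis by simp
  qed
  have relax: "\<bar>relax \<epsilon> r - relax \<epsilon> r'\<bar> \<le> k * \<bar>r - r'\<bar>" for r r'
    using relax_increment[of r r' \<epsilon>] relax_increment[of r' r \<epsilon>] \<epsilon> unfolding k_def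
    by (cases "r \<le> r'") (auto simp: abs_if)
  have "L1_dist (step \<epsilon> f u) (step \<epsilon> g v) \<le>
      (\<integral>\<^sup>+x. ennreal k * ennreal \<bar>u x - v x\<bar> + (ennreal \<tau> * ennreal \<bar>T u x - T v x\<bar>
        + ennreal \<tau> * ennreal \<bar>f x - g x\<bar>) \<partial>lborel)"
  proof (rule nn_integral_mono)
    fix x
    have "step \<epsilon> f u x - step \<epsilon> g v x
        = (relax \<epsilon> (u x) - relax \<epsilon> (v x)) + (\<tau> * (T u x - T v x) + \<tau> * (f x - g x))"
      by (simp add: step_def algebra_simps)
    also have "\<bar>\<dots>\<bar> \<le> k * \<bar>u x - v x\<bar> + (\<bar>\<tau> * (T u x - T v x)\<bar> + \<bar>\<tau> * (f x - g x)\<bar>)"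
      using relax[of "u x" "v x"] by linarith
    also have "\<dots> = k * \<bar>u x - v x\<bar> + (\<tau> * \<bar>T u x - T v x\<bar> + \<tau> * \<bar>f x - g x\<bar>)"
      using \<tau>_pos by (simp add: abs_mult)
    finally have "ennreal \<bar>step \<epsilon> f u x - step \<epsilon> g v x\<bar>
        \<le> ennreal (k * \<bar>u x - v x\<bar> + (\<tau> * \<bar>T u x - T v x\<bar> + \<tau> * \<bar>f x - g x\<bar>))"
      by (rule ennreal_leI)
    then show "ennreal \<bar>step \<epsilon> f u x - step \<epsilon> g v x\<bar> \<le> ennreal k * ennreal \<bar>u x - v x\<bar> +
        (ennreal \<tau> * ennreal \<bar>T u x - T v x\<bar> + ennreal \<tau> * ennreal \<bar>f x - g x\<bar>)"
      using k0 \<tau>_pos by (simp add: ennreal_mult'')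
  qed
  also have "\<dots> = ennreal k * L1_dist u v + (ennreal \<tau> * L1_dist (T u) (T v)
        + ennreal \<tau> * L1_dist f g)"
    by (simp add: nn_integral_add nn_integral_cmult)
  also have "\<dots> \<le> ennreal k * ennreal (A / \<epsilon>) + (ennreal \<tau> * (ennreal D * ennreal (A / \<epsilon>)) + ennreal \<tau> * ennreal A)"
    by (intro add_mono mult_left_mono order_trans[OF T_L1[OF u v]] uv A) auto
  also have "\<dots> = ennreal (k * (A / \<epsilon>) + (\<tau> * (D * (A / \<epsilon>)) + \<tau> * A))"
    using k0 \<tau>_pos D_nonneg A \<epsilon> by (simp add: ennreal_mult[symmetric] ennreal_plus[symmetric] del: ennreal_plus)
  also have "k * (A / \<epsilon>) + (\<tau> * (D * (A / \<epsilon>)) + \<tau> * A) = A / \<epsilon>"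
    using \<epsilon> by (simp add: k_def field_simps)
  finally show ?thesis .
qed

lemma iterate_bounded_field:
  assumes "datum f" "0 \<le> \<epsilon>" "\<epsilon> \<le> 1"
  shows "bounded_field M (iterate \<epsilon> f n)"
proof (induction n)
  case 0 then show ?case using M_nonneg by (auto simp: bounded_field_def)
next
  case (Suc n) then show ?case using assms by (simp add: step_bounded_field)
qed

lemma iterate_mono:
  assumes "datum f" "0 \<le> \<epsilon>" "\<epsilon> \<le> 1"
  shows "iterate \<epsilon> f n x \<le> iterate \<epsilon> f (Suc n) x"
proof (induction n arbitrary: x)
  case 0 then show ?case using step_lower[OF assms] by simp
next
  case (Suc n)
  show ?case unfolding iterate.simps
    by (rule step_mono) (use Suc assms iterate_bounded_field[OF assms] in \<open>auto simp del: iterate.simps simp: iterate.simps(2)[symmetric]\<close>)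
qed

lemma sol_limit:
  assumes "datum f" "0 \<le> \<epsilon>" "\<epsilon> \<le> 1"
  shows "(\<lambda>n. iterate \<epsilon> f n x) \<longlonglongrightarrow> sol \<epsilon> f x"
proof -
  have "incseq (\<lambda>n. iterate \<epsilon> f n x)" using iterate_mono[OF assms] by (rule incseq_SucI)
  then have "convergent (\<lambda>n. iterate \<epsilon> f n x)"
    using bounded_fieldD(3)[OF iterate_bounded_field[OF assms]]
    by (meson convergentI incseq_convergent)
  then show ?thesis by (simp add: sol_def convergent_LIMSEQ_iff)
qed

lemma sol_bounded_field:
  assumes "datum f" "0 \<le> \<epsilon>" "\<epsilon> \<le> 1"
  shows "bounded_field M (sol \<epsilon> f)"
proof -
  note it = bounded_fieldD[OF iterate_bounded_field[OF assms]]
  have "sol \<epsilon> f \<in> borel_measurable borel"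
    by (rule borel_measurable_LIMSEQ_real[OF sol_limit[OF assms]]) (auto intro: it)
  moreover have "\<bar>sol \<epsilon> f x\<bar> \<le> M" for x
    by (rule tendsto_upperbound[OF tendsto_rabs[OF sol_limit[OF assms]]]) (simp_all add: it(2))
  ultimately show ?thesis by (simp add: bounded_field_def)
qed

text \<open>
  The limit of the iteration is a fixed point of \<open>step\<close>, because \<open>b\<close> and \<open>T\<close> are continuous along
  pointwise convergent sequences.
\<close>
lemma sol_equation:
  assumes "datum f" "0 \<le> \<epsilon>" "\<epsilon> \<le> 1"
  shows "b (sol \<epsilon> f x) + \<epsilon> * (sol \<epsilon> f x + M) + D * sol \<epsilon> f x = T (sol \<epsilon> f) x + f x"
proof -
  let ?u = "sol \<epsilon> f"
  have lim: "(\<lambda>n. iterate \<epsilon> f n x) \<longlonglongrightarrow> ?u x" for x by (rule sol_limit[OF assms])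
  have "(\<lambda>n. b (iterate \<epsilon> f n x)) \<longlonglongrightarrow> b (?u x)"
    using continuous_on_tendsto_compose[OF b_continuous lim] by simp
  then have "(\<lambda>n. step \<epsilon> f (iterate \<epsilon> f n) x) \<longlonglongrightarrow> step \<epsilon> f ?u x"
    unfolding step_def relax_def
    by (intro tendsto_intros lim T_lim iterate_bounded_field sol_bounded_field assms)
  moreover have "(\<lambda>n. step \<epsilon> f (iterate \<epsilon> f n) x) \<longlonglongrightarrow> ?u x"
    using LIMSEQ_Suc[OF lim[of x]] by simp
  ultimately have "?u x = step \<epsilon> f ?u x" using LIMSEQ_unique by blast
  then have "\<tau> * (b (?u x) + \<epsilon> * (?u x + M) + D * ?u x) = \<tau> * (T ?u x + f x)"
    unfolding step_def relax_def by linarith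
  then show ?thesis using \<tau>_pos by (metis mult_left_cancel less_irrefl)
qed

lemma sol_antimono:
  assumes "datum f" "0 \<le> \<epsilon>'" "\<epsilon>' \<le> \<epsilon>" "\<epsilon> \<le> 1"
  shows "sol \<epsilon> f x \<le> sol \<epsilon>' f x"
proof -
  have "iterate \<epsilon> f n x \<le> iterate \<epsilon>' f n x" for n x
  proof (induction n arbitrary: x)
    case (Suc n)
    show ?case unfolding iterate.simps
      by (rule step_mono) (use Suc assms iterate_bounded_field[OF assms(1)] in auto)
  qed simp
  then show ?thesis using assms by (intro LIMSEQ_le[OF sol_limit sol_limit]) auto
qed

lemma datum_translate: "datum f \<Longrightarrow> datum (\<lambda>x. f (x + y))"
  by (auto simp: datum_def)

lemma sol_translate:
  assumes "datum f" "0 \<le> \<epsilon>" "\<epsilon> \<le> 1"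
  shows "sol \<epsilon> (\<lambda>x. f (x + y)) x = sol \<epsilon> f (x + y)"
proof -
  have "iterate \<epsilon> (\<lambda>x. f (x + y)) n = (\<lambda>x. iterate \<epsilon> f n (x + y))" for n
  proof (induction n)
    case (Suc n)
    show ?case
      unfolding iterate.simps Suc step_def
      using T_translate[OF iterate_bounded_field[OF assms], of n y] by auto
  qed simp
  then show ?thesis unfolding sol_def by simp
qed

text \<open>
  The iterates for both data start from the same constant, so the estimate holds for them by
  induction, and Fatou's lemma transfers it to the limits.
\<close>
lemma sol_L1:
  assumes f: "datum f" and g: "datum g"
    and \<epsilon>: "0 < \<epsilon>" "\<epsilon> \<le> 1" and A: "L1_dist f g \<le> ennreal A" "0 \<le> A"
  shows "L1_dist (sol \<epsilon> f) (sol \<epsilon> g) \<le> ennreal (A / \<epsilon>)"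
proof -
  note \<epsilon>' = less_imp_le[OF \<epsilon>(1)] \<epsilon>(2)
  have it: "L1_dist (iterate \<epsilon> f n) (iterate \<epsilon> g n) \<le> ennreal (A / \<epsilon>)" for n
  proof (induction n)
    case (Suc n)
    show ?case unfolding iterate.simps
      by (rule step_L1[OF iterate_bounded_field iterate_bounded_field f g \<epsilon> A Suc]) (use f g \<epsilon>' in auto)
  qed simp
  have [measurable]: "iterate \<epsilon> f n \<in> borel_measurable borel" "iterate \<epsilon> g n \<in> borel_measurable borel" for n
    using iterate_bounded_field f g \<epsilon>' by (auto intro: bounded_fieldD)
  have "L1_dist (sol \<epsilon> f) (sol \<epsilon> g)
      = (\<integral>\<^sup>+x. liminf (\<lambda>n. ennreal \<bar>iterate \<epsilon> f n x - iterate \<epsilon> g n x\<bar>) \<partial>lborel)"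
    by (intro nn_integral_cong lim_imp_Liminf[symmetric] tendsto_ennrealI tendsto_intros sol_limit f g \<epsilon>') auto
  also have "\<dots> \<le> liminf (\<lambda>n. L1_dist (iterate \<epsilon> f n) (iterate \<epsilon> g n))"
    by (rule nn_integral_liminf) measurable
  also have "\<dots> \<le> ennreal (A / \<epsilon>)"
    by (rule Liminf_le) (auto simp: it)
  finally show ?thesis .
qed

text \<open>
  In contrast to \<open>sol_L1\<close>, the constant does not depend on \<open>\<epsilon>\<close>. In the difference of the two
  equations, the terms with \<open>b\<close>, \<open>\<epsilon>\<close> and \<open>D\<close> have the same sign, so their absolute values add up. After
  integration the term with \<open>D\<close> cancels against the bound for \<open>T\<close>; that term is finite by \<open>sol_L1\<close>.
\<close>
lemma sol_reaction_L1:
  assumes f: "datum f" and g: "datum g"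
    and \<epsilon>: "0 < \<epsilon>" "\<epsilon> \<le> 1" and A: "L1_dist f g \<le> ennreal A" "0 \<le> A"
  shows "(\<integral>\<^sup>+x. \<bar>b (sol \<epsilon> f x) - b (sol \<epsilon> g x)\<bar> \<partial>lborel) \<le> ennreal A"
proof -
  note \<epsilon>' = less_imp_le[OF \<epsilon>(1)] \<epsilon>(2)
  let ?u = "sol \<epsilon> f" and ?v = "sol \<epsilon> g"
  note u = sol_bounded_field[OF f \<epsilon>'] and v = sol_bounded_field[OF g \<epsilon>']
  have [measurable]: "?u \<in> borel_measurable borel" "T ?u \<in> borel_measurable borel" "f \<in> borel_measurable borel"
    "?v \<in> borel_measurable borel" "T ?v \<in> borel_measurable borel" "g \<in> borel_measurable borel"
    using u f v g by (auto simp: bounded_fieldD T_measurable datum_def)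
  define I where "I = (\<integral>\<^sup>+x. \<bar>?u x - ?v x\<bar> \<partial>lborel)"
  have fin: "I < \<infinity>" unfolding I_def
    using sol_L1[OF assms] by (simp add: ennreal_less_top order_le_less_trans)
  have pt: "D * \<bar>?u x - ?v x\<bar> + \<bar>b (?u x) - b (?v x)\<bar> \<le> \<bar>T ?u x - T ?v x\<bar> + \<bar>f x - g x\<bar>" for x
  proof -
    have eq: "(b (?u x) - b (?v x)) + (\<epsilon> + D) * (?u x - ?v x) = (T ?u x - T ?v x) + (f x - g x)"
      using sol_equation[OF f \<epsilon>', of x] sol_equation[OF g \<epsilon>', of x] by (simp add: algebra_simps)
    have "\<bar>(b (?u x) - b (?v x)) + (\<epsilon> + D) * (?u x - ?v x)\<bar>
        = \<bar>b (?u x) - b (?v x)\<bar> + (\<epsilon> + D) * \<bar>?u x - ?v x\<bar>"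
    proof (cases "?u x \<le> ?v x")
      case True
      then have "b (?u x) \<le> b (?v x)" "(\<epsilon> + D) * ?u x \<le> (\<epsilon> + D) * ?v x"
        using monoD[OF b_mono] \<epsilon> D_nonneg by (auto intro: mult_left_mono)
      then show ?thesis using True by (simp add: abs_if algebra_simps)
    next
      case False
      then have "b (?v x) \<le> b (?u x)" "(\<epsilon> + D) * ?v x \<le> (\<epsilon> + D) * ?u x"
        using monoD[OF b_mono, of "?v x" "?u x"] \<epsilon> D_nonneg by (auto intro: mult_left_mono)
      then show ?thesis using False by (simp add: abs_if algebra_simps)
    qed
    moreover have "D * \<bar>?u x - ?v x\<bar> \<le> (\<epsilon> + D) * \<bar>?u x - ?v x\<bar>"
      using \<epsilon> by (intro mult_right_mono) auto
    ultimately show ?thesis using eq by linarith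
  qed
  have "ennreal D * I + (\<integral>\<^sup>+x. \<bar>b (?u x) - b (?v x)\<bar> \<partial>lborel)
      = (\<integral>\<^sup>+x. ennreal D * ennreal \<bar>?u x - ?v x\<bar> + ennreal \<bar>b (?u x) - b (?v x)\<bar> \<partial>lborel)"
    unfolding I_def by (simp add: nn_integral_add nn_integral_cmult)
  also have "\<dots> \<le> (\<integral>\<^sup>+x. ennreal \<bar>T ?u x - T ?v x\<bar> + ennreal \<bar>f x - g x\<bar> \<partial>lborel)"
  proof (rule nn_integral_mono)
    fix x
    show "ennreal D * ennreal \<bar>?u x - ?v x\<bar> + ennreal \<bar>b (?u x) - b (?v x)\<bar>
        \<le> ennreal \<bar>T ?u x - T ?v x\<bar> + ennreal \<bar>f x - g x\<bar>"
      using ennreal_leI[OF pt[of x]] D_nonneg by (simp add: ennreal_mult'')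
  qed
  also have "\<dots> = (\<integral>\<^sup>+x. \<bar>T ?u x - T ?v x\<bar> \<partial>lborel) + L1_dist f g"
    by (rule nn_integral_add) auto
  also have "\<dots> \<le> ennreal D * I + ennreal A"
    unfolding I_def by (intro add_mono T_L1 u v A)
  finally have "(\<integral>\<^sup>+x. \<bar>b (?u x) - b (?v x)\<bar> \<partial>lborel) \<le> ennreal A \<or> ennreal D * I = \<infinity>"
    by (simp add: ennreal_add_left_cancel_le disj_commute)
  then show ?thesis using fin by (auto simp: ennreal_mult_eq_top_iff)
qed

end

section \<open>Numerical fluxes and convolutions as averages\<close>

text \<open>
  For nondecreasing functions, the absolute values of the increments of \<open>g\<^sub>1\<close> and \<open>g\<^sub>2\<close> add up to
  the absolute value of the increment of \<open>\<lambda>r. 2 * K * r\<close>. After a translation of both terms to the same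
  point, this gives the exact constant \<open>K / h\<close> in \<open>L\<^sup>1\<close>.
\<close>
lemma monotone_averaging_flux:
  fixes g\<^sub>1 g\<^sub>2 :: "real \<Rightarrow> real" and a :: "'a::euclidean_space"
  assumes cont: "continuous_on UNIV g\<^sub>1" "continuous_on UNIV g\<^sub>2"
    and mono: "mono_on {-M..M} g\<^sub>1" "mono_on {-M..M} g\<^sub>2"
    and sum: "\<And>r. g\<^sub>1 r + g\<^sub>2 r = 2 * K * r" and K: "0 \<le> K" and h: "0 < h"
  shows "monotone_averaging M (K / h) (\<lambda>u x. (g\<^sub>1 (u (x + a)) + g\<^sub>2 (u (x - a))) / (2 * h))"
proof
  have [measurable]: "g\<^sub>1 \<in> borel_measurable borel" "g\<^sub>2 \<in> borel_measurable borel"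
    using cont by (auto intro: borel_measurable_continuous_onI)
  show "0 \<le> K / h" using K h by simp
  show "(\<lambda>x. (g\<^sub>1 (u (x + a)) + g\<^sub>2 (u (x - a))) / (2 * h)) \<in> borel_measurable borel"
    if "bounded_field M u" for u :: "'a \<Rightarrow> real"
  proof -
    have [measurable]: "u \<in> borel_measurable borel" using that by (rule bounded_fieldD)
    show ?thesis by measurable
  qed
  show "(g\<^sub>1 (u (x + a)) + g\<^sub>2 (u (x - a))) / (2 * h) \<le> (g\<^sub>1 (v (x + a)) + g\<^sub>2 (v (x - a))) / (2 * h)"
    if "bounded_field M u" "bounded_field M v" "\<And>x. u x \<le> v x" for u v :: "'a \<Rightarrow> real" and x
    using that h bounded_fieldD[OF that(1)] bounded_fieldD[OF that(2)]
    by (intro divide_right_mono add_mono mono_onD[OF mono(1)] mono_onD[OF mono(2)]) auto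
  show "(g\<^sub>1 c + g\<^sub>2 c) / (2 * h) = K / h * c" for c
    unfolding sum by simp
  show "(\<lambda>n. (g\<^sub>1 (U n (x + a)) + g\<^sub>2 (U n (x - a))) / (2 * h))
      \<longlonglongrightarrow> (g\<^sub>1 (u (x + a)) + g\<^sub>2 (u (x - a))) / (2 * h)"
    if "\<And>x. (\<lambda>n. U n x) \<longlonglongrightarrow> u x" for U u and x :: 'a
    using h by (intro tendsto_intros continuous_on_tendsto_compose[OF cont(1) that]
        continuous_on_tendsto_compose[OF cont(2) that]) auto
  show "(g\<^sub>1 (u (x + a + y)) + g\<^sub>2 (u (x - a + y))) / (2 * h)
      = (g\<^sub>1 (u (x + y + a)) + g\<^sub>2 (u (x + y - a))) / (2 * h)" for u and x y :: 'a
    by (simp add: algebra_simps)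
  fix u v :: "'a \<Rightarrow> real" assume uv: "bounded_field M u" "bounded_field M v"
  have [measurable]: "u \<in> borel_measurable borel" "v \<in> borel_measurable borel"
    using uv by (auto intro: bounded_fieldD)
  have "(\<integral>\<^sup>+x. \<bar>(g\<^sub>1 (u (x + a)) + g\<^sub>2 (u (x - a))) / (2 * h) - (g\<^sub>1 (v (x + a)) + g\<^sub>2 (v (x - a))) / (2 * h)\<bar> \<partial>lborel)
      \<le> (\<integral>\<^sup>+x. ennreal (\<bar>g\<^sub>1 (u (x + a)) - g\<^sub>1 (v (x + a))\<bar> / (2 * h))
        + ennreal (\<bar>g\<^sub>2 (u (x + - a)) - g\<^sub>2 (v (x + - a))\<bar> / (2 * h)) \<partial>lborel)"
  proof (rule nn_integral_mono)
    fix x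
    have "\<bar>(g\<^sub>1 (u (x + a)) + g\<^sub>2 (u (x - a))) / (2 * h) - (g\<^sub>1 (v (x + a)) + g\<^sub>2 (v (x - a))) / (2 * h)\<bar>
        = \<bar>(g\<^sub>1 (u (x + a)) - g\<^sub>1 (v (x + a))) + (g\<^sub>2 (u (x - a)) - g\<^sub>2 (v (x - a)))\<bar> / (2 * h)"
      using h by (simp add: diff_divide_distrib[symmetric] algebra_simps)
    also have "\<dots> \<le> (\<bar>g\<^sub>1 (u (x + a)) - g\<^sub>1 (v (x + a))\<bar> + \<bar>g\<^sub>2 (u (x - a)) - g\<^sub>2 (v (x - a))\<bar>) / (2 * h)"
      using h by (intro divide_right_mono) auto
    finally show "ennreal \<bar>(g\<^sub>1 (u (x + a)) + g\<^sub>2 (u (x - a))) / (2 * h) - (g\<^sub>1 (v (x + a)) + g\<^sub>2 (v (x - a))) / (2 * h)\<bar>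
        \<le> ennreal (\<bar>g\<^sub>1 (u (x + a)) - g\<^sub>1 (v (x + a))\<bar> / (2 * h))
        + ennreal (\<bar>g\<^sub>2 (u (x + - a)) - g\<^sub>2 (v (x + - a))\<bar> / (2 * h))"
      using h by (simp add: ennreal_plus[symmetric] add_divide_distrib ennreal_leI del: ennreal_plus)
  qed
  also have "\<dots> = (\<integral>\<^sup>+x. ennreal (\<bar>g\<^sub>1 (u (x + a)) - g\<^sub>1 (v (x + a))\<bar> / (2 * h)) \<partial>lborel)
      + (\<integral>\<^sup>+x. ennreal (\<bar>g\<^sub>2 (u (x + - a)) - g\<^sub>2 (v (x + - a))\<bar> / (2 * h)) \<partial>lborel)"
    by (rule nn_integral_add) measurable
  also have "(\<integral>\<^sup>+x. ennreal (\<bar>g\<^sub>1 (u (x + a)) - g\<^sub>1 (v (x + a))\<bar> / (2 * h)) \<partial>lborel)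
      = (\<integral>\<^sup>+x. ennreal (\<bar>g\<^sub>1 (u x) - g\<^sub>1 (v x)\<bar> / (2 * h)) \<partial>lborel)"
    by (rule nn_integral_translate[where g = "\<lambda>x. ennreal (\<bar>g\<^sub>1 (u x) - g\<^sub>1 (v x)\<bar> / (2 * h))"]) measurable
  also have "(\<integral>\<^sup>+x. ennreal (\<bar>g\<^sub>2 (u (x + - a)) - g\<^sub>2 (v (x + - a))\<bar> / (2 * h)) \<partial>lborel)
      = (\<integral>\<^sup>+x. ennreal (\<bar>g\<^sub>2 (u x) - g\<^sub>2 (v x)\<bar> / (2 * h)) \<partial>lborel)"
    by (rule nn_integral_translate[where g = "\<lambda>x. ennreal (\<bar>g\<^sub>2 (u x) - g\<^sub>2 (v x)\<bar> / (2 * h))"]) measurable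
  also have "(\<integral>\<^sup>+x. ennreal (\<bar>g\<^sub>1 (u x) - g\<^sub>1 (v x)\<bar> / (2 * h)) \<partial>lborel)
      + (\<integral>\<^sup>+x. ennreal (\<bar>g\<^sub>2 (u x) - g\<^sub>2 (v x)\<bar> / (2 * h)) \<partial>lborel)
      = (\<integral>\<^sup>+x. ennreal (\<bar>g\<^sub>1 (u x) - g\<^sub>1 (v x)\<bar> / (2 * h)) + ennreal (\<bar>g\<^sub>2 (u x) - g\<^sub>2 (v x)\<bar> / (2 * h)) \<partial>lborel)"
    by (rule nn_integral_add[symmetric]) measurable
  also have "\<dots> = (\<integral>\<^sup>+x. ennreal (K / h) * ennreal \<bar>u x - v x\<bar> \<partial>lborel)"
  proof (rule nn_integral_cong)
    fix x
    have u: "u x \<in> {-M..M}" and v: "v x \<in> {-M..M}"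
      using bounded_fieldD(3,4)[OF uv(1), of x] bounded_fieldD(3,4)[OF uv(2), of x] by auto
    have d: "(g\<^sub>1 (u x) - g\<^sub>1 (v x)) + (g\<^sub>2 (u x) - g\<^sub>2 (v x)) = 2 * K * (u x - v x)"
      using sum[of "u x"] sum[of "v x"] by (simp add: algebra_simps)
    have "\<bar>g\<^sub>1 (u x) - g\<^sub>1 (v x)\<bar> + \<bar>g\<^sub>2 (u x) - g\<^sub>2 (v x)\<bar>
        = \<bar>(g\<^sub>1 (u x) - g\<^sub>1 (v x)) + (g\<^sub>2 (u x) - g\<^sub>2 (v x))\<bar>"
      using mono_onD[OF mono(1) u v] mono_onD[OF mono(2) u v]
        mono_onD[OF mono(1) v u] mono_onD[OF mono(2) v u] by linarith
    also have "\<dots> = 2 * K * \<bar>u x - v x\<bar>" unfolding d using K by (simp add: abs_mult)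
    finally have "\<bar>g\<^sub>1 (u x) - g\<^sub>1 (v x)\<bar> + \<bar>g\<^sub>2 (u x) - g\<^sub>2 (v x)\<bar> = 2 * K * \<bar>u x - v x\<bar>" .
    then have "\<bar>g\<^sub>1 (u x) - g\<^sub>1 (v x)\<bar> / (2 * h) + \<bar>g\<^sub>2 (u x) - g\<^sub>2 (v x)\<bar> / (2 * h) = K / h * \<bar>u x - v x\<bar>"
      using h by (simp add: add_divide_distrib[symmetric])
    then show "ennreal (\<bar>g\<^sub>1 (u x) - g\<^sub>1 (v x)\<bar> / (2 * h)) + ennreal (\<bar>g\<^sub>2 (u x) - g\<^sub>2 (v x)\<bar> / (2 * h))
        = ennreal (K / h) * ennreal \<bar>u x - v x\<bar>"
      using h K by (simp add: ennreal_plus[symmetric] ennreal_mult[symmetric] del: ennreal_plus)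
  qed
  also have "\<dots> = ennreal (K / h) * L1_dist u v"
    by (rule nn_integral_cmult) measurable
  finally show "(\<integral>\<^sup>+x. \<bar>(g\<^sub>1 (u (x + a)) + g\<^sub>2 (u (x - a))) / (2 * h) - (g\<^sub>1 (v (x + a)) + g\<^sub>2 (v (x - a))) / (2 * h)\<bar> \<partial>lborel)
      \<le> ennreal (K / h) * L1_dist u v" .
qed

lemma monotone_averaging_convolution:
  fixes k :: "'a::euclidean_space \<Rightarrow> real"
  assumes k: "integrable lborel k" and k0: "\<And>z. 0 \<le> k z"
  shows "monotone_averaging M (LBINT z. k z) (\<lambda>u x. \<integral>z. u (x + z) * k z \<partial>lborel)"
proof
  have [measurable]: "k \<in> borel_measurable borel" using k by auto
  have int: "integrable lborel (\<lambda>z. u (x + z) * k z)" if "bounded_field M u" for u and x :: 'a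
  proof -
    have [measurable]: "u \<in> borel_measurable borel" using that by (rule bounded_fieldD)
    show ?thesis by (rule integrable_bounded_mult[OF k]) (use bounded_fieldD(2)[OF that] in auto)
  qed
  show "0 \<le> (LBINT z. k z)" using k0 by (intro integral_nonneg_AE) auto
  show "(\<lambda>x. \<integral>z. u (x + z) * k z \<partial>lborel) \<in> borel_measurable borel"
    if "bounded_field M u" for u :: "'a \<Rightarrow> real"
  proof -
    have [measurable]: "u \<in> borel_measurable borel" using that by (rule bounded_fieldD)
    show ?thesis by measurable
  qed
  show "(LBINT z. u (x + z) * k z) \<le> (LBINT z. v (x + z) * k z)"
    if "bounded_field M u" "bounded_field M v" "\<And>x. u x \<le> v x" for u v :: "'a \<Rightarrow> real" and x
    using int that k0 by (intro integral_mono mult_right_mono) auto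
  show "(LBINT z. c * k z) = (LBINT z. k z) * c" for c by simp
  show "(\<lambda>n. \<integral>z. U n (x + z) * k z \<partial>lborel) \<longlonglongrightarrow> (LBINT z. u (x + z) * k z)"
    if U: "\<And>n. bounded_field M (U n)" and u: "bounded_field M u" and lim: "\<And>x. (\<lambda>n. U n x) \<longlonglongrightarrow> u x"
    for U u and x :: 'a
  proof (rule integral_dominated_convergence[where w = "\<lambda>z. M * k z"])
    have [measurable]: "u \<in> borel_measurable borel" "U n \<in> borel_measurable borel" for n
      using bounded_fieldD(1)[OF U] bounded_fieldD(1)[OF u] by auto
    show "(\<lambda>z. u (x + z) * k z) \<in> borel_measurable lborel" "(\<lambda>z. U n (x + z) * k z) \<in> borel_measurable lborel" for n
      by measurable
    show "AE z in lborel. (\<lambda>n. U n (x + z) * k z) \<longlonglongrightarrow> u (x + z) * k z"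
      by (intro AE_I2 tendsto_intros lim)
    show "AE z in lborel. norm (U n (x + z) * k z) \<le> M * k z" for n
      using bounded_fieldD(2)[OF U] k0 by (auto simp: abs_mult intro!: mult_right_mono)
  qed (use k in auto)
  show "(LBINT z. u (x + z + y) * k z) = (LBINT z. u (x + y + z) * k z)" for u and x y :: 'a
    by (simp add: add_ac)
  fix u v :: "'a \<Rightarrow> real" assume uv: "bounded_field M u" "bounded_field M v"
  have [measurable]: "u \<in> borel_measurable borel" "v \<in> borel_measurable borel"
    using uv by (auto intro: bounded_fieldD)
  have "(\<integral>\<^sup>+x. \<bar>(LBINT z. u (x + z) * k z) - (LBINT z. v (x + z) * k z)\<bar> \<partial>lborel)
      \<le> (\<integral>\<^sup>+x. (\<integral>\<^sup>+z. ennreal (k z) * ennreal \<bar>u (x + z) - v (x + z)\<bar> \<partial>lborel) \<partial>lborel)"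
  proof (rule nn_integral_mono)
    fix x
    have "ennreal \<bar>(LBINT z. u (x + z) * k z) - (LBINT z. v (x + z) * k z)\<bar>
        = ennreal \<bar>\<integral>z. u (x + z) * k z - v (x + z) * k z \<partial>lborel\<bar>"
      using int uv by simp
    also have "\<dots> \<le> (\<integral>\<^sup>+z. ennreal (norm (u (x + z) * k z - v (x + z) * k z)) \<partial>lborel)"
      using integral_norm_bound_ennreal[OF Bochner_Integration.integrable_diff[OF int[OF uv(1)] int[OF uv(2)]]]
      by simp
    also have "\<dots> = (\<integral>\<^sup>+z. ennreal (k z) * ennreal \<bar>u (x + z) - v (x + z)\<bar> \<partial>lborel)"
    proof (rule nn_integral_cong)
      fix z
      have "norm (u (x + z) * k z - v (x + z) * k z) = k z * \<bar>u (x + z) - v (x + z)\<bar>"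
        using k0[of z] by (metis abs_mult abs_of_nonneg left_diff_distrib mult.commute real_norm_def)
      then show "ennreal (norm (u (x + z) * k z - v (x + z) * k z)) = ennreal (k z) * ennreal \<bar>u (x + z) - v (x + z)\<bar>"
        by (simp add: ennreal_mult'')
    qed
    finally show "ennreal \<bar>(LBINT z. u (x + z) * k z) - (LBINT z. v (x + z) * k z)\<bar>
        \<le> (\<integral>\<^sup>+z. ennreal (k z) * ennreal \<bar>u (x + z) - v (x + z)\<bar> \<partial>lborel)" .
  qed
  also have "\<dots> = (\<integral>\<^sup>+z. (\<integral>\<^sup>+x. ennreal (k z) * ennreal \<bar>u (x + z) - v (x + z)\<bar> \<partial>lborel) \<partial>lborel)"
    by (rule lborel_pair.Fubini') measurable
  also have "\<dots> = (\<integral>\<^sup>+z. ennreal (k z) * L1_dist u v \<partial>lborel)"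
  proof (rule nn_integral_cong)
    fix z
    have "(\<integral>\<^sup>+x. ennreal (k z) * ennreal \<bar>u (x + z) - v (x + z)\<bar> \<partial>lborel)
        = ennreal (k z) * (\<integral>\<^sup>+x. ennreal \<bar>u (x + z) - v (x + z)\<bar> \<partial>lborel)"
      by (rule nn_integral_cmult) measurable
    also have "(\<integral>\<^sup>+x. ennreal \<bar>u (x + z) - v (x + z)\<bar> \<partial>lborel) = L1_dist u v"
      by (rule nn_integral_translate[where g = "\<lambda>x. ennreal \<bar>u x - v x\<bar>"]) measurable
    finally show "(\<integral>\<^sup>+x. ennreal (k z) * ennreal \<bar>u (x + z) - v (x + z)\<bar> \<partial>lborel)
        = ennreal (k z) * L1_dist u v" .
  qed
  also have "\<dots> = (\<integral>\<^sup>+z. ennreal (k z) \<partial>lborel) * L1_dist u v"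
    by (rule nn_integral_multc) measurable
  also have "(\<integral>\<^sup>+z. ennreal (k z) \<partial>lborel) = ennreal (LBINT z. k z)"
    by (rule nn_integral_eq_integral[OF k]) (simp add: k0)
  finally show "(\<integral>\<^sup>+x. \<bar>(LBINT z. u (x + z) * k z) - (LBINT z. v (x + z) * k z)\<bar> \<partial>lborel)
      \<le> ennreal (LBINT z. k z) * L1_dist u v" .
qed

section \<open>Entropies, entropy fluxes and test functions\<close>

text \<open>
  Lipschitz functions map null sets to null sets. So if \<open>p a > p b\<close>, and after the addition of a
  small linear term, some value \<open>y\<close> between those at the end points is taken only where the derivative
  exists and is positive. At the last point with a value of at least \<open>y\<close> this is impossible.
\<close>
lemma AE_deriv_nonneg_imp_le:
  fixes p :: "real \<Rightarrow> real"
  assumes lip: "L-lipschitz_on {a..b} p" and ab: "a \<le> b"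
    and deriv: "AE t in lebesgue. t \<in> {a<..<b} \<longrightarrow> (\<exists>D\<ge>0. (p has_real_derivative D) (at t))"
  shows "p a \<le> p b"
proof (rule ccontr)
  assume "\<not> p a \<le> p b"
  then have neg: "p b < p a" and ab': "a < b" using ab by (auto simp: not_le) (metis order_le_less less_irrefl)
  \<comment> \<open>A small linear term makes the derivative positive and keeps the wrong order of the end points.\<close>
  define c where "c = b - a"
  have c: "c > 0" using ab' by (simp add: c_def)
  define e where "e = (p a - p b) / 2 / c"
  have e: "e > 0" using neg c by (simp add: e_def)
  define q where "q t = p t + e * (t - a)" for t
  have qab: "q b < q a"
  proof -
    have "e * (b - a) = (p a - p b) / 2"
      unfolding c_def[symmetric] using c by (simp add: e_def)
    then show ?thesis using neg by (simp add: q_def)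
  qed
  have lipq: "(L + e)-lipschitz_on {a..b} q"
  proof -
    have "e-lipschitz_on {a..b} (\<lambda>t. e * (t - a))"
      using e by (intro lipschitz_onI) (auto simp: dist_real_def right_diff_distrib[symmetric] abs_mult)
    then show ?thesis unfolding q_def by (intro lipschitz_on_add lip)
  qed
  then have cont: "continuous_on {a..b} q" by (rule lipschitz_on_continuous_on)
  define E where "E = {t \<in> {a<..<b}. \<not> (\<exists>D>0. (q has_real_derivative D) (at t))}"
  have "negligible E"
  proof -
    define P where "P t \<longleftrightarrow> (\<exists>D\<ge>0. (p has_real_derivative D) (at t))" for t
    have "AE t in lebesgue. t \<in> {a<..<b} \<longrightarrow> P t" using deriv by (simp add: P_def)
    then obtain N where N: "N \<in> null_sets lebesgue" and "{t \<in> space lebesgue. \<not> (t \<in> {a<..<b} \<longrightarrow> P t)} \<subseteq> N"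
      unfolding eventually_ae_filter by blast
    then have D_ex: "P t" if "t \<notin> N" "t \<in> {a<..<b}" for t
      using that by auto
    have "E \<subseteq> N"
    proof
      fix t assume t: "t \<in> E"
      show "t \<in> N"
      proof (rule ccontr)
        assume "t \<notin> N"
        then obtain D where D: "D \<ge> 0" "(p has_real_derivative D) (at t)"
          using D_ex[of t] t by (auto simp: E_def P_def)
        have "(q has_real_derivative (D + e)) (at t)"
          unfolding q_def by (auto intro!: derivative_eq_intros D(2))
        with t D(1) e show False by (auto simp: E_def intro: add_nonneg_pos)
      qed
    qed
    then show ?thesis using N negligible_iff_null_sets negligible_subset by blast
  qed
  then have "negligible (q ` E)"
  proof (rule negligible_locally_Lipschitz_image[rotated])
    fix x assume x: "x \<in> E"
    have "norm (q y - q x) \<le> (L + e) * norm (y - x)" if "y \<in> E" for y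
      using lipschitz_onD[OF lipq, of y x] x that by (auto simp: E_def dist_norm)
    then show "\<exists>T B. open T \<and> x \<in> T \<and> (\<forall>y\<in>E \<inter> T. norm (q y - q x) \<le> B * norm (y - x))"
      by (intro exI[of _ UNIV] exI[of _ "L + e"]) auto
  qed simp
  moreover have "\<not> negligible {q b<..<q a}"
  proof -
    have "box (q b) (q a) \<noteq> {}" using qab by (simp add: box_ne_empty)
    then have "\<not> negligible (box (q b) (q a))" using negligible_interval(2) by blast
    then show ?thesis by simp
  qed
  ultimately obtain y where y: "q b < y" "y < q a" "y \<notin> q ` E"
    by (meson greaterThanLessThan_iff negligible_subset subsetI)
  define S where "S = {a..b} \<inter> q -` {y..}"
  have "compact S"
    unfolding compact_eq_bounded_closed S_def
    by (intro conjI continuous_closed_preimage[OF cont]) (auto intro: bounded_subset[of "{a..b}"])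
  moreover have "a \<in> S" using y ab by (auto simp: S_def)
  ultimately obtain t where t: "t \<in> S" and max: "\<And>r. r \<in> S \<Longrightarrow> r \<le> t"
    using compact_attains_sup[of S] by auto
  have tb: "t < b" using t y by (auto simp: S_def order.strict_iff_order)
  have qt: "q t = y"
  proof (rule ccontr)
    assume "q t \<noteq> y"
    then have "y \<le> q t" "q b \<le> y" using t y by (auto simp: S_def)
    moreover have "continuous_on {t..b} q"
      using t by (intro continuous_on_subset[OF cont]) (auto simp: S_def)
    ultimately obtain r where r: "t \<le> r" "r \<le> b" "q r = y"
      using IVT2'[of q b y t] tb by auto
    then have "r \<in> S" using t by (auto simp: S_def)
    with max[of r] r \<open>q t \<noteq> y\<close> show False by auto
  qed
  have "t \<in> {a<..<b}" using t tb qt y by (auto simp: S_def order.strict_iff_order)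
  moreover have "t \<notin> E" using qt y by auto
  ultimately obtain D where D: "D > 0" "(q has_real_derivative D) (at t)" by (auto simp: E_def)
  obtain d where d: "d > 0" "\<And>h. h > 0 \<Longrightarrow> h < d \<Longrightarrow> q t < q (t + h)"
    using DERIV_pos_inc_right[OF D(2,1)] by auto
  define h where "h = min (d / 2) (b - t)"
  have h: "h > 0" "h < d" "t + h \<le> b" using d tb by (auto simp: h_def)
  then have "t + h \<in> S" using d(2)[of h] qt t by (auto simp: S_def)
  then show False using max[of "t + h"] h by simp
qed

lemma C_class_2_real:
  fixes \<eta> :: "real \<Rightarrow> real"
  assumes "C_class 2 \<eta>"
  shows "\<And>r. (\<eta> has_real_derivative deriv \<eta> r) (at r)" "continuous_on UNIV (deriv \<eta>)" "continuous_on UNIV \<eta>"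
proof -
  have C: "\<And>x. \<eta> differentiable (at x)" "C_class (Suc 0) (\<lambda>x. frechet_derivative \<eta> (at x) 1)"
    using assms by (auto simp: numeral_2_eq_2)
  show d: "(\<eta> has_real_derivative deriv \<eta> r) (at r)" for r
    using C(1)[of r] by (metis DERIV_imp_deriv real_differentiableE)
  have "frechet_derivative \<eta> (at r) 1 = deriv \<eta> r" for r
  proof -
    have "(\<eta> has_derivative (\<lambda>x. deriv \<eta> r * x)) (at r)" using d[of r] by (simp add: has_field_derivative_def)
    from frechet_derivative_at[OF this] show ?thesis by (metis mult.right_neutral)
  qed
  then have "C_class (Suc 0) (deriv \<eta>)" using C(2) by simp
  then have "\<And>x. deriv \<eta> differentiable (at x)" by simp
  then show "continuous_on UNIV (deriv \<eta>)"
    by (simp add: continuous_at_imp_continuous_on differentiable_imp_continuous_within)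
  show "continuous_on UNIV \<eta>"
    by (simp add: C(1) continuous_at_imp_continuous_on differentiable_imp_continuous_within)
qed

lemma convex_above_tangent:
  fixes \<eta> :: "real \<Rightarrow> real"
  assumes "C_class 2 \<eta>" "convex_on UNIV \<eta>"
  shows "deriv \<eta> u * (v - u) \<le> \<eta> v - \<eta> u"
  using convex_on_imp_above_tangent[OF assms(2) connected_UNIV, of u v "deriv \<eta> u"] C_class_2_real(1)[OF assms(1)]
  by simp

lemma convex_deriv_mono:
  fixes \<eta> :: "real \<Rightarrow> real"
  assumes "C_class 2 \<eta>" "convex_on UNIV \<eta>" "u \<le> v"
  shows "deriv \<eta> u \<le> deriv \<eta> v"
proof (cases "u = v")
  case False
  have "deriv \<eta> u * (v - u) \<le> deriv \<eta> v * (v - u)"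
    using convex_above_tangent[OF assms(1,2), of u v] convex_above_tangent[OF assms(1,2), of v u]
    by (simp add: algebra_simps)
  then show ?thesis using False assms(3) by (simp add: mult_le_cancel_right)
qed simp

lemma locally_lipschitz_imp_lipschitz_on:
  assumes "locally_lipschitz F"
  obtains K where "K-lipschitz_on {-M..M} F"
proof -
  have "local_lipschitz {0::real} {-M..M} (\<lambda>_::real. F)"
    using assms unfolding locally_lipschitz_def by (rule local_lipschitz_subset) auto
  then obtain K where "\<And>t. t \<in> {0::real} \<Longrightarrow> K-lipschitz_on {-M..M} F"
    by (rule local_lipschitz_compact_implies_lipschitz) auto
  then show ?thesis using that by blast
qed

lemma locally_lipschitz_continuous:
  assumes "locally_lipschitz F"
  shows "continuous_on UNIV F"
proof -
  have "isCont F x" for x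
  proof -
    obtain K where "K-lipschitz_on {-(\<bar>x\<bar>+1)..(\<bar>x\<bar>+1)} F" using locally_lipschitz_imp_lipschitz_on[OF assms] .
    then have "continuous_on {-(\<bar>x\<bar>+1)..(\<bar>x\<bar>+1)} F" by (rule lipschitz_on_continuous_on)
    then show ?thesis by (rule continuous_on_interior) auto
  qed
  then show ?thesis by (simp add: continuous_at_imp_continuous_on)
qed

lemma lipschitz_on_component:
  fixes F :: "real \<Rightarrow> real ^ 'n"
  assumes "K-lipschitz_on S F"
  shows "K-lipschitz_on S (\<lambda>r. F r $ i)"
proof (rule lipschitz_onI)
  fix x y assume "x \<in> S" "y \<in> S"
  have "dist (F x $ i) (F y $ i) \<le> dist (F x) (F y)"
    by (metis component_le_norm_cart dist_norm real_norm_def vector_minus_component)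
  then show "dist (F x $ i) (F y $ i) \<le> K * dist x y"
    using lipschitz_onD[OF assms \<open>x \<in> S\<close> \<open>y \<in> S\<close>] by linarith
qed (rule lipschitz_on_nonneg[OF assms])

lemma monotone_numerical_flux:
  fixes F :: "real \<Rightarrow> real"
  assumes "K-lipschitz_on S F" "\<bar>\<sigma>\<bar> = 1"
  shows "mono_on S (\<lambda>r. K * r + \<sigma> * F r)"
proof (rule mono_onI)
  fix r s assume rs: "r \<in> S" "s \<in> S" "r \<le> s"
  have "\<bar>\<sigma> * (F r - F s)\<bar> \<le> K * (s - r)"
    using lipschitz_onD[OF assms(1) rs(1,2)] rs(3) assms(2) by (simp add: dist_real_def abs_mult)
  then show "K * r + \<sigma> * F r \<le> K * s + \<sigma> * F s" by (simp add: algebra_simps abs_le_iff)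
qed

lemma mono_on_deriv_nonneg:
  fixes g :: "real \<Rightarrow> real"
  assumes "mono_on {a..b} g" "t \<in> {a<..<b}" "(g has_real_derivative D) (at t)"
  shows "0 \<le> D"
proof (rule ccontr)
  assume "\<not> 0 \<le> D"
  then obtain d where d: "d > 0" "\<And>h. h > 0 \<Longrightarrow> h < d \<Longrightarrow> g (t + h) < g t"
    using DERIV_neg_dec_right[OF assms(3)] by (auto simp: not_le)
  define h where "h = min (d / 2) (b - t)"
  have h: "h > 0" "h < d" "t + h \<le> b" using d assms(2) by (auto simp: h_def)
  have "g t \<le> g (t + h)" using assms(2) h by (intro mono_onD[OF assms(1)]) auto
  then show False using d(2)[OF h(1,2)] by simp
qed

lemma entropy_lipschitz:
  fixes \<eta> :: "real \<Rightarrow> real"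
  assumes "C_class 2 \<eta>" "convex_on UNIV \<eta>"
  obtains B where "B-lipschitz_on {-M..M} \<eta>"
proof -
  define B where "B = max \<bar>deriv \<eta> (-M)\<bar> \<bar>deriv \<eta> M\<bar>"
  have B: "\<bar>deriv \<eta> r\<bar> \<le> B" if "r \<in> {-M..M}" for r
    using convex_deriv_mono[OF assms, of "-M" r] convex_deriv_mono[OF assms, of r M] that
    unfolding B_def by auto
  have one: "\<eta> r - \<eta> s \<le> B * \<bar>r - s\<bar>" if "r \<in> {-M..M}" "s \<in> {-M..M}" for r s
  proof -
    have "\<eta> r - \<eta> s \<le> deriv \<eta> r * (r - s)"
      using convex_above_tangent[OF assms, of r s] by (simp add: algebra_simps)
    also have "\<dots> \<le> \<bar>deriv \<eta> r\<bar> * \<bar>r - s\<bar>" by (metis abs_ge_self abs_mult)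
    also have "\<dots> \<le> B * \<bar>r - s\<bar>" using B[OF that(1)] by (intro mult_right_mono) auto
    finally show ?thesis .
  qed
  have "B-lipschitz_on {-M..M} \<eta>"
  proof (rule lipschitz_onI)
    fix r s assume "r \<in> {-M..M}" "s \<in> {-M..M}"
    with one[of r s] one[of s r] show "dist (\<eta> r) (\<eta> s) \<le> B * dist r s"
      by (simp add: dist_real_def abs_le_iff abs_minus_commute)
  qed (simp add: B_def)
  then show ?thesis by (rule that)
qed

text \<open>
  Almost everywhere, the difference \<open>p\<close> of the entropy flux and \<open>deriv \<eta> u\<close> times the numerical
  flux has the derivative \<open>(deriv \<eta> t - deriv \<eta> u) * (K + \<sigma> * F' t)\<close>. The second factor is
  nonnegative, because \<open>K\<close> is a Lipschitz constant of \<open>F\<close>, and the first has the sign of \<open>t - u\<close>,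
  because \<open>\<eta>\<close> is convex. Hence \<open>p\<close> is minimal at \<open>u\<close>.
\<close>
lemma numerical_entropy_flux:
  fixes F \<Phi> :: "real \<Rightarrow> real ^ 'n"
  assumes F: "K-lipschitz_on {-M..M} F" and \<eta>: "C_class 2 \<eta>" "convex_on UNIV \<eta>"
    and \<Phi>: "entropy_flux F \<eta> \<Phi>" and \<sigma>: "\<bar>\<sigma>\<bar> = 1" and u: "\<bar>u\<bar> \<le> M" and v: "\<bar>v\<bar> \<le> M"
  shows "deriv \<eta> u * ((K * v + \<sigma> * F v $ i) - (K * u + \<sigma> * F u $ i))
    \<le> (K * \<eta> v + \<sigma> * \<Phi> v $ i) - (K * \<eta> u + \<sigma> * \<Phi> u $ i)"
proof -
  define p where "p r = (K * \<eta> r + \<sigma> * \<Phi> r $ i) - deriv \<eta> u * (K * r + \<sigma> * F r $ i)" for r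
  note Fi = lipschitz_on_component[OF F, of i]
  have mono: "mono_on {-M..M} (\<lambda>r. K * r + \<sigma> * F r $ i)"
    by (rule monotone_numerical_flux[OF Fi \<sigma>])
  obtain L where L: "L-lipschitz_on {-M..M} p"
  proof -
    obtain B where B: "B-lipschitz_on {-M..M} \<eta>" using entropy_lipschitz[OF \<eta>] .
    obtain K' where "K'-lipschitz_on {-M..M} \<Phi>"
      using \<Phi> locally_lipschitz_imp_lipschitz_on unfolding entropy_flux_def by blast
    note K' = lipschitz_on_component[OF this, of i]
    have id: "1-lipschitz_on {-M..M} (\<lambda>r::real. r)" by (rule lipschitz_onI) auto
    have "\<exists>L. L-lipschitz_on {-M..M} p"
      unfolding p_def
      using lipschitz_on_diff[OF lipschitz_on_add[OF lipschitz_on_cmult_real[OF B] lipschitz_on_cmult_real[OF K']]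
          lipschitz_on_cmult_real[OF lipschitz_on_add[OF lipschitz_on_cmult_real[OF id] lipschitz_on_cmult_real[OF Fi]]]]
      by (rule exI)
    then show ?thesis using that by blast
  qed
  have deriv: "AE t in lebesgue. t \<in> {-M<..<M} \<longrightarrow>
      (\<exists>D\<ge>0. (p has_real_derivative (deriv \<eta> t - deriv \<eta> u) * D) (at t))"
  proof -
    have "AE t in lebesgue. \<exists>D. ((\<lambda>r. F r $ i) has_real_derivative D) (at t) \<and>
        ((\<lambda>r. \<Phi> r $ i) has_real_derivative (deriv \<eta> t * D)) (at t)"
      using \<Phi> unfolding entropy_flux_def by blast
    then show ?thesis
    proof eventually_elim
      case (elim t)
      then obtain D where D: "((\<lambda>r. F r $ i) has_real_derivative D) (at t)"
        "((\<lambda>r. \<Phi> r $ i) has_real_derivative (deriv \<eta> t * D)) (at t)" by blast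
      show ?case
      proof
        assume t: "t \<in> {-M<..<M}"
        have d1: "((\<lambda>r. K * r + \<sigma> * F r $ i) has_real_derivative (K + \<sigma> * D)) (at t)"
          by (auto intro!: derivative_eq_intros D(1))
        have "0 \<le> K + \<sigma> * D" by (rule mono_on_deriv_nonneg[OF mono t d1])
        moreover have "(p has_real_derivative (deriv \<eta> t - deriv \<eta> u) * (K + \<sigma> * D)) (at t)"
          unfolding p_def
          by (rule derivative_eq_intros D d1 C_class_2_real(1)[OF \<eta>(1)] refl)+ (simp add: algebra_simps)
        ultimately show "\<exists>D\<ge>0. (p has_real_derivative (deriv \<eta> t - deriv \<eta> u) * D) (at t)" by blast
      qed
    qed
  qed
  have "p u \<le> p v"
  proof (cases "u \<le> v")
    case True
    show ?thesis
    proof (rule AE_deriv_nonneg_imp_le[OF lipschitz_on_subset[OF L] True])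
      show "{u..v} \<subseteq> {-M..M}" using u v by auto
      show "AE t in lebesgue. t \<in> {u<..<v} \<longrightarrow> (\<exists>D\<ge>0. (p has_real_derivative D) (at t))"
        using deriv
      proof eventually_elim
        case (elim t)
        show ?case
        proof
          assume t: "t \<in> {u<..<v}"
          then have "deriv \<eta> u \<le> deriv \<eta> t" by (intro convex_deriv_mono[OF \<eta>]) auto
          moreover have "t \<in> {-M<..<M}" using t u v by auto
          ultimately show "\<exists>D\<ge>0. (p has_real_derivative D) (at t)"
            using elim by (metis diff_ge_0_iff_ge mult_nonneg_nonneg)
        qed
      qed
    qed
  next
    case False
    have "- p v \<le> - p u"
    proof (rule AE_deriv_nonneg_imp_le[of L v u "\<lambda>r. - p r"])
      show "L-lipschitz_on {v..u} (\<lambda>r. - p r)"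
        using u v by (intro lipschitz_on_minus lipschitz_on_subset[OF L]) auto
      show "AE t in lebesgue. t \<in> {v<..<u} \<longrightarrow> (\<exists>D\<ge>0. ((\<lambda>r. - p r) has_real_derivative D) (at t))"
        using deriv
      proof eventually_elim
        case (elim t)
        show ?case
        proof
          assume t: "t \<in> {v<..<u}"
          then have le: "deriv \<eta> t \<le> deriv \<eta> u" by (intro convex_deriv_mono[OF \<eta>]) auto
          have "t \<in> {-M<..<M}" using t u v by auto
          then obtain D where D: "D \<ge> 0" "(p has_real_derivative (deriv \<eta> t - deriv \<eta> u) * D) (at t)"
            using elim by blast
          have "((\<lambda>r. - p r) has_real_derivative - ((deriv \<eta> t - deriv \<eta> u) * D)) (at t)"
            by (rule DERIV_minus[OF D(2)])
          moreover have "0 \<le> - ((deriv \<eta> t - deriv \<eta> u) * D)"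
            using le D(1) by (simp add: mult_nonpos_nonneg)
          ultimately show "\<exists>D\<ge>0. ((\<lambda>r. - p r) has_real_derivative D) (at t)" by blast
        qed
      qed
    qed (use False in auto)
    then show ?thesis by simp
  qed
  then show ?thesis by (simp add: p_def algebra_simps)
qed

text \<open>
  The directional derivatives along a basis are continuous with compact support, so the
  derivatives are uniformly bounded.
\<close>
lemma C1_compact_support_Lipschitz:
  fixes g :: "'a::euclidean_space \<Rightarrow> real"
  assumes g: "C_class 1 g" and supp: "\<And>x. R < norm x \<Longrightarrow> g x = 0"
  obtains L where "0 \<le> L" "\<And>x y. \<bar>g x - g y\<bar> \<le> L * norm (x - y)"
proof -
  have d: "(g has_derivative frechet_derivative g (at x)) (at x)" for x
    using g by (simp add: frechet_derivative_works[symmetric])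
  have cont: "continuous_on UNIV (\<lambda>x. frechet_derivative g (at x) v)" for v using g by simp
  have zero: "frechet_derivative g (at x) v = 0" if "R < norm x" for x v
  proof -
    have "((\<lambda>_. 0) has_derivative (\<lambda>_. 0)) (at x)" by simp
    then have "(g has_derivative (\<lambda>_. 0)) (at x)"
    proof (rule has_derivative_transform_within_open)
      show "open {x. R < norm x}" by (intro open_Collect_less continuous_intros)
    qed (use that supp in auto)
    from frechet_derivative_at[OF this] show ?thesis by metis
  qed
  have "\<exists>B. 0 \<le> B \<and> (\<forall>x. \<bar>frechet_derivative g (at x) v\<bar> \<le> B)" for v
  proof -
    have "compact ((\<lambda>x. frechet_derivative g (at x) v) ` cball 0 R)"
      by (intro compact_continuous_image continuous_on_subset[OF cont]) auto
    then obtain B where B: "\<forall>x\<in>cball 0 R. \<bar>frechet_derivative g (at x) v\<bar> \<le> B"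
      by (auto dest!: compact_imp_bounded simp: bounded_iff)
    have "\<bar>frechet_derivative g (at x) v\<bar> \<le> \<bar>B\<bar>" for x
      using B[rule_format, of x] zero[of x v] by (cases "norm x \<le> R") auto
    then show ?thesis by (intro exI[of _ "\<bar>B\<bar>"]) auto
  qed
  then obtain B where B: "\<And>v. 0 \<le> B v" "\<And>v x. \<bar>frechet_derivative g (at x) v\<bar> \<le> B v" by metis
  define L where "L = (\<Sum>i\<in>Basis. B i)"
  have L: "\<bar>frechet_derivative g (at x) w\<bar> \<le> L * norm w" for x w
  proof -
    have lin: "linear (frechet_derivative g (at x))" using d[of x] by (rule has_derivative_linear)
    have "frechet_derivative g (at x) w = frechet_derivative g (at x) (\<Sum>i\<in>Basis. (w \<bullet> i) *\<^sub>R i)"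
      by (simp add: euclidean_representation)
    also have "\<dots> = (\<Sum>i\<in>Basis. (w \<bullet> i) * frechet_derivative g (at x) i)"
      by (simp add: linear_sum[OF lin] linear_cmul[OF lin])
    also have "\<bar>\<dots>\<bar> \<le> (\<Sum>i\<in>Basis. \<bar>(w \<bullet> i) * frechet_derivative g (at x) i\<bar>)" by (rule sum_abs)
    also have "\<dots> \<le> (\<Sum>i\<in>Basis. norm w * B i)"
      unfolding abs_mult by (intro sum_mono mult_mono B Basis_le_norm) auto
    finally show ?thesis by (simp add: L_def sum_distrib_left mult.commute)
  qed
  have "onorm (frechet_derivative g (at x)) \<le> L" for x
    by (rule onorm_le) (use L in simp)
  then have "\<bar>g x - g y\<bar> \<le> L * norm (x - y)" for x y
    using differentiable_bound[of UNIV g "\<lambda>x. frechet_derivative g (at x)" L x y] d by simp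
  moreover have "0 \<le> L" using B by (auto simp: L_def intro!: sum_nonneg)
  ultimately show ?thesis using that by blast
qed

text \<open>
  What is used of a test function: a radius of its support, and one constant for its size, its
  differences and its Taylor remainders.
\<close>
definition test_bounds :: "(real ^ 'n \<Rightarrow> real) \<Rightarrow> real \<Rightarrow> real \<Rightarrow> bool" where
  "test_bounds \<phi> R L \<longleftrightarrow> 0 < R \<and> 0 \<le> L \<and> (\<forall>x. R < norm x \<longrightarrow> \<phi> x = 0) \<and> (\<forall>x. \<bar>\<phi> x\<bar> \<le> L) \<and>
     (\<forall>x y. \<bar>\<phi> x - \<phi> y\<bar> \<le> L * norm (x - y)) \<and> (\<forall>x. R < norm x \<longrightarrow> grad \<phi> x = 0) \<and>
     (\<forall>x. (\<phi> has_derivative (\<lambda>z. grad \<phi> x \<bullet> z)) (at x)) \<and>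
     continuous_on UNIV \<phi> \<and> continuous_on UNIV (grad \<phi>) \<and>
     (\<forall>x z. \<bar>\<phi> (x + z) - \<phi> x - grad \<phi> x \<bullet> z\<bar> \<le> L * (norm z)\<^sup>2)"

lemma test_boundsD:
  assumes "test_bounds \<phi> R L"
  shows "0 < R" "0 \<le> L" "\<And>x. R < norm x \<Longrightarrow> \<phi> x = 0" "\<And>x. \<bar>\<phi> x\<bar> \<le> L"
    "\<And>x y. \<bar>\<phi> x - \<phi> y\<bar> \<le> L * norm (x - y)"
    "\<And>x. R < norm x \<Longrightarrow> grad \<phi> x = 0"
    "\<And>x. (\<phi> has_derivative (\<lambda>z. grad \<phi> x \<bullet> z)) (at x)"
    "continuous_on UNIV \<phi>" "continuous_on UNIV (grad \<phi>)"
    "\<And>x z. \<bar>\<phi> (x + z) - \<phi> x - grad \<phi> x \<bullet> z\<bar> \<le> L * (norm z)\<^sup>2"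
  using assms unfolding test_bounds_def by blast+

lemma test_function_bounds:
  fixes \<phi> :: "real ^ 'n \<Rightarrow> real"
  assumes "test_function \<phi>"
  shows "\<exists>R L. test_bounds \<phi> R L"
proof -
  have C: "C_class k \<phi>" for k using assms by (auto simp: test_function_def)
  have C1: "C_class 1 (\<lambda>x. frechet_derivative \<phi> (at x) v)" for v
    using C[of 2] by (simp add: numeral_2_eq_2)
  have "bounded (closure {x. \<phi> x \<noteq> 0})"
    using assms by (auto simp: test_function_def intro: compact_imp_bounded)
  then obtain R where R: "0 < R" "\<And>x. x \<in> closure {x. \<phi> x \<noteq> 0} \<Longrightarrow> norm x \<le> R"
    by (auto simp: bounded_pos)
  have supp: "\<phi> x = 0" if "R < norm x" for x
    using R(2)[of x] that closure_subset[of "{x. \<phi> x \<noteq> 0}"] by fastforce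
  have fd: "(\<phi> has_derivative frechet_derivative \<phi> (at x)) (at x)" for x
    using C[of 1] by (simp add: frechet_derivative_works[symmetric])
  have zero: "frechet_derivative \<phi> (at x) v = 0" if "R < norm x" for x v
  proof -
    have "((\<lambda>_. 0) has_derivative (\<lambda>_. 0)) (at x)" by simp
    then have "(\<phi> has_derivative (\<lambda>_. 0)) (at x)"
    proof (rule has_derivative_transform_within_open)
      show "open {x::real^'n. R < norm x}" by (intro open_Collect_less continuous_intros)
    qed (use that supp in auto)
    from frechet_derivative_at[OF this] show ?thesis by metis
  qed
  have g: "grad \<phi> x \<bullet> z = frechet_derivative \<phi> (at x) z" for x z
  proof -
    have lin: "linear (frechet_derivative \<phi> (at x))" using fd[of x] by (rule has_derivative_linear)
    have "frechet_derivative \<phi> (at x) z = frechet_derivative \<phi> (at x) (\<Sum>i\<in>UNIV. (z $ i) *\<^sub>R axis i 1)"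
      using basis_expansion[of z] by (simp add: scalar_mult_eq_scaleR)
    also have "\<dots> = (\<Sum>i\<in>UNIV. z $ i * frechet_derivative \<phi> (at x) (axis i 1))"
      by (simp add: linear_sum[OF lin] linear_cmul[OF lin])
    finally show ?thesis by (simp add: inner_vec_def grad_def mult.commute)
  qed
  have d: "(\<phi> has_derivative (\<lambda>z. grad \<phi> x \<bullet> z)) (at x)" for x using fd[of x] unfolding g .
  obtain L1 where L1: "0 \<le> L1" "\<And>x y. \<bar>\<phi> x - \<phi> y\<bar> \<le> L1 * norm (x - y)"
    using C1_compact_support_Lipschitz[OF C supp] by blast
  have "\<exists>L. 0 \<le> L \<and> (\<forall>x y. \<bar>frechet_derivative \<phi> (at x) v - frechet_derivative \<phi> (at y) v\<bar> \<le> L * norm (x - y))" for v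
    using C1_compact_support_Lipschitz[OF C1[of v] zero] by metis
  then obtain B where B: "\<And>v. 0 \<le> B v"
    "\<And>v x y. \<bar>frechet_derivative \<phi> (at x) v - frechet_derivative \<phi> (at y) v\<bar> \<le> B v * norm (x - y)" by metis
  define L2 where "L2 = (\<Sum>i\<in>(UNIV::'n set). B (axis i 1))"
  have L2: "0 \<le> L2" "norm (grad \<phi> x - grad \<phi> y) \<le> L2 * norm (x - y)" for x y
  proof -
    show "0 \<le> L2" using B by (auto simp: L2_def intro!: sum_nonneg)
    have "norm (grad \<phi> x - grad \<phi> y) \<le> (\<Sum>i\<in>UNIV. \<bar>(grad \<phi> x - grad \<phi> y) $ i\<bar>)" by (rule norm_le_l1_cart)
    also have "\<dots> \<le> (\<Sum>i\<in>UNIV. B (axis i 1) * norm (x - y))"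
      by (intro sum_mono) (simp add: grad_def B)
    finally show "norm (grad \<phi> x - grad \<phi> y) \<le> L2 * norm (x - y)" by (simp add: L2_def sum_distrib_right)
  qed
  have taylor: "\<bar>\<phi> (x + z) - \<phi> x - grad \<phi> x \<bullet> z\<bar> \<le> L2 * (norm z)\<^sup>2" for x z
  proof -
    define q where "q y = \<phi> y - grad \<phi> x \<bullet> y" for y
    have "norm (q (x + z) - q x) \<le> (L2 * norm z) * norm ((x + z) - x)"
    proof (rule differentiable_bound[of "cball x (norm z)" q "\<lambda>y w. (grad \<phi> y - grad \<phi> x) \<bullet> w"])
      fix y assume y: "y \<in> cball x (norm z)"
      show "(q has_derivative (\<lambda>w. (grad \<phi> y - grad \<phi> x) \<bullet> w)) (at y within cball x (norm z))"
        unfolding q_def inner_diff_left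
        by (intro has_derivative_diff has_derivative_at_withinI[OF d] has_derivative_inner_right has_derivative_ident)
      have "norm (grad \<phi> y - grad \<phi> x) \<le> L2 * norm z"
        using L2(2)[of y x] y L2(1) by (auto simp: dist_norm norm_minus_commute intro: order_trans mult_left_mono)
      then show "onorm (\<lambda>w. (grad \<phi> y - grad \<phi> x) \<bullet> w) \<le> L2 * norm z"
        by (intro onorm_le) (metis Cauchy_Schwarz_ineq2 mult_right_mono norm_ge_zero order_trans real_norm_def)
    qed (auto simp: dist_norm)
    then show ?thesis by (simp add: q_def inner_add_right power2_eq_square algebra_simps)
  qed
  have cont: "continuous_on UNIV \<phi>" 
    using d by (meson continuous_at_imp_continuous_on has_derivative_continuous)
  have contg: "continuous_on UNIV (grad \<phi>)"
  proof -
    have "L2-lipschitz_on UNIV (grad \<phi>)"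
      using L2 by (intro lipschitz_onI) (auto simp: dist_norm)
    then show ?thesis by (rule lipschitz_on_continuous_on)
  qed
  obtain L3 where L3: "\<And>x. \<bar>\<phi> x\<bar> \<le> L3"
  proof -
    have "compact (\<phi> ` cball 0 R)"
      by (intro compact_continuous_image continuous_on_subset[OF cont]) auto
    then obtain B where B: "\<forall>x\<in>cball 0 R. \<bar>\<phi> x\<bar> \<le> B"
      by (auto dest!: compact_imp_bounded simp: bounded_iff)
    have "\<bar>\<phi> x\<bar> \<le> \<bar>B\<bar>" for x
      using B[rule_format, of x] supp[of x] by (cases "norm x \<le> R") auto
    then show ?thesis by (rule that)
  qed
  define L where "L = L1 + L2 + \<bar>L3\<bar>"
  have f1: "0 \<le> L" using L1 L2 by (simp add: L_def)
  have f2: "\<bar>\<phi> x\<bar> \<le> L" for x using L1(1) L2(1) L3[of x] unfolding L_def by linarith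
  have f3: "\<bar>\<phi> x - \<phi> y\<bar> \<le> L * norm (x - y)" for x y
    by (rule order_trans[OF L1(2)]) (use L2 in \<open>auto simp: L_def intro!: mult_right_mono\<close>)
  have f4: "\<bar>\<phi> (x + z) - \<phi> x - grad \<phi> x \<bullet> z\<bar> \<le> L * (norm z)\<^sup>2" for x z
    by (rule order_trans[OF taylor]) (use L1 in \<open>auto simp: L_def intro!: mult_right_mono\<close>)
  have f5: "grad \<phi> x = 0" if "R < norm x" for x
    using zero[OF that] by (simp add: grad_def vec_eq_iff)
  have "test_bounds \<phi> R L"
    unfolding test_bounds_def using R(1) f1 supp f2 f3 f5 d cont contg f4 by blast
  then show ?thesis by blast
qed

section \<open>The discrete entropy inequality\<close>

lemma continuous_bounded_on_range:
  fixes g :: "real \<Rightarrow> real"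
  assumes "continuous_on UNIV g"
  shows "\<exists>B\<ge>0. \<forall>r. \<bar>r\<bar> \<le> M \<longrightarrow> \<bar>g r\<bar> \<le> B"
proof -
  have "compact (g ` {-M..M})"
    by (intro compact_continuous_image continuous_on_subset[OF assms]) auto
  then obtain B where B: "\<forall>r\<in>{-M..M}. \<bar>g r\<bar> \<le> B"
    by (auto dest!: compact_imp_bounded simp: bounded_iff)
  have "\<bar>g r\<bar> \<le> \<bar>B\<bar>" if "\<bar>r\<bar> \<le> M" for r
  proof -
    have "r \<in> {-M..M}" using that by auto
    then have "\<bar>g r\<bar> \<le> B" using B by blast
    then show ?thesis by linarith
  qed
  then show ?thesis by (intro exI[of _ "\<bar>B\<bar>"]) auto
qed

lemma integrable_compact_support:
  fixes g :: "'a::euclidean_space \<Rightarrow> real"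
  assumes "g \<in> borel_measurable borel" "\<And>x. R < norm x \<Longrightarrow> g x = 0" "\<And>x. \<bar>g x\<bar> \<le> B"
  shows "integrable lborel g"
proof -
  have "emeasure lborel (cball (0::'a) R) < \<infinity>" using emeasure_bounded_finite[of "cball (0::'a) R"] by simp
  then have "integrable lborel (\<lambda>x. indicator (cball 0 R) x * g x)"
    using assms by (intro integrable_bounded_on_finite) auto
  moreover have "indicator (cball 0 R) x * g x = g x" for x
    using assms(2)[of x] by (cases "norm x \<le> R") auto
  ultimately show ?thesis by simp
qed

lemma summation_by_parts:
  fixes w \<phi> :: "'a::euclidean_space \<Rightarrow> real"
  assumes [measurable]: "w \<in> borel_measurable borel" and B: "\<And>x. \<bar>w x\<bar> \<le> B" and \<phi>: "integrable lborel \<phi>"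
  shows "(LBINT x. (w (x + a) - w x) * \<phi> x) = (LBINT x. w x * (\<phi> (x - a) - \<phi> x))"
proof -
  have [measurable]: "\<phi> \<in> borel_measurable borel" using \<phi> by auto
  have i1: "integrable lborel (\<lambda>x. w (x + a) * \<phi> x)"
    by (rule integrable_bounded_mult[OF \<phi>, where B = B]) (auto simp: B)
  have i2: "integrable lborel (\<lambda>x. w x * \<phi> x)"
    by (rule integrable_bounded_mult[OF \<phi>, where B = B]) (auto simp: B)
  have i3: "integrable lborel (\<lambda>x. w x * \<phi> (x - a))"
    using integrable_bounded_mult[OF integrable_translate[OF \<phi>, of "- a"], of w B] B by simp
  have "(LBINT x. w (x + a) * \<phi> x) = (LBINT x. w x * \<phi> (x - a))"
    using integral_translate[of "\<lambda>x. w x * \<phi> (x - a)" a] by simp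
  then show ?thesis using i1 i2 i3 by (simp add: left_diff_distrib right_diff_distrib)
qed

text \<open>
  The shift \<open>a\<close> allows for both sides of a translation in \<open>x\<close> by \<open>z\<close>: it is \<open>0\<close> before the
  translation and \<open>- z\<close> after it.
\<close>
lemma integrable_kernel_product:
  fixes k \<phi> :: "'a::euclidean_space \<Rightarrow> real" and W :: "'a \<Rightarrow> 'a \<Rightarrow> real"
  assumes k: "integrable lborel k" and \<phi>: "integrable lborel \<phi>"
    and a [measurable]: "a \<in> borel_measurable borel"
    and W [measurable]: "(\<lambda>(z, x). W z x) \<in> borel_measurable (borel \<Otimes>\<^sub>M borel)" and B: "\<And>z x. \<bar>W z x\<bar> \<le> B"
  shows "integrable (lborel \<Otimes>\<^sub>M lborel) (\<lambda>(z, x). k z * (\<phi> (x + a z) * W z x))"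
proof -
  have [measurable]: "k \<in> borel_measurable borel" "\<phi> \<in> borel_measurable borel" using k \<phi> by auto
  have "integrable (lborel \<Otimes>\<^sub>M lborel) (\<lambda>(z, x). k z * \<phi> (x + a z))"
  proof (rule lborel_pair.Fubini_integrable)
    have "(LBINT x. norm (case (z, x) of (z, x) \<Rightarrow> k z * \<phi> (x + a z))) = \<bar>k z\<bar> * (LBINT x. \<bar>\<phi> x\<bar>)" for z
      using integral_translate[of "\<lambda>x. \<bar>\<phi> x\<bar>" "a z"] by (simp add: abs_mult)
    then show "integrable lborel (\<lambda>z. \<integral>x. norm (case (z, x) of (z, x) \<Rightarrow> k z * \<phi> (x + a z)) \<partial>lborel)"
      using k by simp
    show "AE z in lborel. integrable lborel (\<lambda>x. case (z, x) of (z, x) \<Rightarrow> k z * \<phi> (x + a z))"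
      using integrable_translate[OF \<phi>] by auto
  qed measurable
  then have "integrable (lborel \<Otimes>\<^sub>M lborel) (\<lambda>p. B * (case p of (z, x) \<Rightarrow> k z * \<phi> (x + a z)))"
    by simp
  then show ?thesis
  proof (rule Bochner_Integration.integrable_bound)
    show "AE p in lborel \<Otimes>\<^sub>M lborel. norm (case p of (z, x) \<Rightarrow> k z * (\<phi> (x + a z) * W z x))
        \<le> norm (B * (case p of (z, x) \<Rightarrow> k z * \<phi> (x + a z)))"
    proof (rule AE_I2, clarify)
      fix z x
      have "\<bar>k z * \<phi> (x + a z)\<bar> * \<bar>W z x\<bar> \<le> \<bar>k z * \<phi> (x + a z)\<bar> * \<bar>B\<bar>"
        using B[of z x] by (intro mult_left_mono) auto
      then show "norm (k z * (\<phi> (x + a z) * W z x)) \<le> norm (B * (k z * \<phi> (x + a z)))"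
        by (simp add: abs_mult mult_ac)
    qed
  qed measurable
qed

text \<open>
  Translation in \<open>x\<close> moves the difference to \<open>\<phi>\<close> with \<open>z\<close> replaced by \<open>- z\<close>, and the kernel is even.
\<close>
lemma nonlocal_by_parts:
  fixes w \<phi> k :: "'a::euclidean_space \<Rightarrow> real"
  assumes [measurable]: "w \<in> borel_measurable borel" and B: "\<And>x. \<bar>w x\<bar> \<le> B"
    and \<phi>: "integrable lborel \<phi>" "\<And>x. \<bar>\<phi> x\<bar> \<le> C" and k: "integrable lborel k" and even: "\<And>z. k (- z) = k z"
  shows "(LBINT x. (LBINT z. (w (x + z) - w x) * k z) * \<phi> x)
    = (LBINT x. w x * (LBINT z. (\<phi> (x + z) - \<phi> x) * k z))"
proof -
  have [measurable]: "k \<in> borel_measurable borel" "\<phi> \<in> borel_measurable borel" using k \<phi> by auto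
  define k0 where "k0 = (LBINT z. k z)"
  have kw: "integrable lborel (\<lambda>z. w (x + z) * k z)" for x
    by (rule integrable_bounded_mult[OF k, where B = B]) (auto simp: B)
  have k\<phi>: "integrable lborel (\<lambda>z. \<phi> (x + z) * k z)" for x
    by (rule integrable_bounded_mult[OF k, where B = C]) (auto simp: \<phi>)
  have i0: "integrable lborel (\<lambda>x. w x * \<phi> x)"
    by (rule integrable_bounded_mult[OF \<phi>(1), where B = B]) (auto simp: B)
  have p1: "integrable (lborel \<Otimes>\<^sub>M lborel) (\<lambda>(z, x). k z * (\<phi> (x + 0) * w (x + z)))"
    by (rule integrable_kernel_product[OF k \<phi>(1), where B = B]) (auto simp: B)
  have p2: "integrable (lborel \<Otimes>\<^sub>M lborel) (\<lambda>(z, x). k z * (\<phi> (x + - z) * w x))"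
    by (rule integrable_kernel_product[OF k \<phi>(1), where B = B]) (auto simp: B)
  have flip: "(LBINT z. \<phi> (x + - z) * k z) = (LBINT z. \<phi> (x + z) * k z)" for x
    using integral_reflect[of "\<lambda>z. \<phi> (x + z) * k z"] even by simp
  have flip': "(LBINT z. k z * (\<phi> (x + - z) * w x)) = w x * (LBINT z. \<phi> (x + z) * k z)" for x
    unfolding flip[symmetric] by (subst integral_mult_right_zero[symmetric]) (simp add: mult_ac)
  have i1: "integrable lborel (\<lambda>x. (LBINT z. w (x + z) * k z) * \<phi> x)"
    using lborel_pair.integrable_snd[OF p1] by (simp add: mult_ac)
  have i2: "integrable lborel (\<lambda>x. w x * (LBINT z. \<phi> (x + z) * k z))"
    using lborel_pair.integrable_snd[OF p2] unfolding flip' .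
  have "(LBINT x. (LBINT z. (w (x + z) - w x) * k z) * \<phi> x)
      = (LBINT x. (LBINT z. w (x + z) * k z) * \<phi> x - k0 * (w x * \<phi> x))"
  proof (rule Bochner_Integration.integral_cong[OF refl])
    fix x
    have eq: "(LBINT z. (w (x + z) - w x) * k z) = (LBINT z. w (x + z) * k z) - w x * k0"
      using kw[of x] k by (simp add: left_diff_distrib k0_def)
    show "(LBINT z. (w (x + z) - w x) * k z) * \<phi> x
        = (LBINT z. w (x + z) * k z) * \<phi> x - k0 * (w x * \<phi> x)"
      unfolding eq by (simp add: left_diff_distrib right_diff_distrib mult_ac)
  qed
  also have "\<dots> = (LBINT x. (LBINT z. w (x + z) * k z) * \<phi> x) - k0 * (LBINT x. w x * \<phi> x)"
    using i1 i0 by simp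
  also have "(LBINT x. (LBINT z. w (x + z) * k z) * \<phi> x)
      = (LBINT x. (LBINT z. k z * (\<phi> x * w (x + z))))"
    by (simp add: mult_ac)
  also have "\<dots> = (LBINT z. (LBINT x. k z * (\<phi> x * w (x + z))))"
    using lborel_pair.Fubini_integral[OF p1] by simp
  also have "\<dots> = (LBINT z. (LBINT x. k z * (\<phi> (x + - z) * w x)))"
  proof (rule Bochner_Integration.integral_cong[OF refl])
    fix z
    show "(LBINT x. k z * (\<phi> x * w (x + z))) = (LBINT x. k z * (\<phi> (x + - z) * w x))"
      using integral_translate[of "\<lambda>x. k z * (\<phi> (x + - z) * w x)" z] by simp
  qed
  also have "\<dots> = (LBINT x. (LBINT z. k z * (\<phi> (x + - z) * w x)))"
    using lborel_pair.Fubini_integral[OF p2] by simp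
  also have "\<dots> = (LBINT x. w x * (LBINT z. \<phi> (x + z) * k z))"
    unfolding flip' ..
  also have "\<dots> - k0 * (LBINT x. w x * \<phi> x)
      = (LBINT x. w x * (LBINT z. \<phi> (x + z) * k z) - k0 * (w x * \<phi> x))"
    using i2 i0 by simp
  also have "\<dots> = (LBINT x. w x * (LBINT z. (\<phi> (x + z) - \<phi> x) * k z))"
  proof (rule Bochner_Integration.integral_cong[OF refl])
    fix x
    have eq: "(LBINT z. (\<phi> (x + z) - \<phi> x) * k z) = (LBINT z. \<phi> (x + z) * k z) - \<phi> x * k0"
      using k\<phi>[of x] k by (simp add: left_diff_distrib k0_def)
    show "w x * (LBINT z. \<phi> (x + z) * k z) - k0 * (w x * \<phi> x)
        = w x * (LBINT z. (\<phi> (x + z) - \<phi> x) * k z)"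
      unfolding eq by (simp add: left_diff_distrib right_diff_distrib mult_ac)
  qed
  finally show ?thesis .
qed

lemma integral_odd_eq_0:
  fixes g :: "'a::euclidean_space \<Rightarrow> real"
  assumes "g \<in> borel_measurable borel" "\<And>z. g (- z) = - g z"
  shows "(LBINT z. g z) = 0"
  using integral_reflect[OF assms(1)] by (simp add: assms(2))


lemma abs_kernel_integral_le:
  fixes w k :: "'a::euclidean_space \<Rightarrow> real"
  assumes k: "integrable lborel k" "\<And>z. 0 \<le> k z" and w: "w \<in> borel_measurable borel" and B: "\<And>z. \<bar>w z\<bar> \<le> B"
  shows "\<bar>\<integral>z. w z * k z \<partial>lborel\<bar> \<le> B * (LBINT z. k z)"
proof -
  have "\<bar>\<integral>z. w z * k z \<partial>lborel\<bar> \<le> (LBINT z. B * k z)"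
    using B k(2) by (intro integral_abs_bound_integral integrable_bounded_mult[OF k(1) w B])
      (auto simp: k(1) abs_mult intro!: mult_right_mono)
  then show ?thesis by simp
qed

definition outer_kernel :: "real \<Rightarrow> real \<Rightarrow> 'a::euclidean_space \<Rightarrow> real" where
  "outer_kernel s r z = indicator {z. r \<le> norm z} z * levy_kernel s z"

definition shell_kernel :: "real \<Rightarrow> real \<Rightarrow> real \<Rightarrow> 'a::euclidean_space \<Rightarrow> real" where
  "shell_kernel s \<delta> r z = indicator {z. \<delta> \<le> norm z \<and> norm z < r} z * levy_kernel s z"

lemma kernel_measurable [measurable]:
  "outer_kernel s r \<in> borel_measurable borel" "shell_kernel s \<delta> r \<in> borel_measurable borel"
  unfolding outer_kernel_def shell_kernel_def by measurable

lemma kernel_nonneg [simp]: "0 \<le> outer_kernel s r z" "0 \<le> shell_kernel s \<delta> r z"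
  by (simp_all add: outer_kernel_def shell_kernel_def)

lemma integrable_outer_kernel:
  assumes "0 < s" "0 < r"
  shows "integrable lborel (outer_kernel s r :: 'a::euclidean_space \<Rightarrow> real)"
  using integrable_levy_kernel_outer[OF assms] by (simp add: outer_kernel_def[abs_def])

lemma integrable_shell_kernel:
  assumes "0 < s" "0 < \<delta>"
  shows "integrable lborel (shell_kernel s \<delta> r :: 'a::euclidean_space \<Rightarrow> real)"
  by (rule Bochner_Integration.integrable_bound[OF integrable_outer_kernel[OF assms]])
    (auto simp: shell_kernel_def outer_kernel_def indicator_def)

text \<open>
  The Lax-Friedrichs average: the neighbours enter through the functions \<open>\<lambda>r. K * r + \<sigma> * F r $ i\<close> with
  \<open>\<sigma> = - 1\<close> and \<open>\<sigma> = 1\<close>, which are nondecreasing if \<open>K\<close> is a Lipschitz constant of \<open>F\<close>.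
\<close>
definition flux_average :: "real \<Rightarrow> real \<Rightarrow> (real \<Rightarrow> real ^ 'n) \<Rightarrow> (real ^ 'n \<Rightarrow> real) \<Rightarrow> real ^ 'n \<Rightarrow> real" where
  "flux_average K h F u x = (\<Sum>i\<in>UNIV. ((K * u (x + axis i h) + (- 1) * F (u (x + axis i h)) $ i)
      + (K * u (x - axis i h) + 1 * F (u (x - axis i h)) $ i)) / (2 * h))"

text \<open>
  The mesh size \<open>h\<close> is at the same time the radius at which the singular kernel is cut off.
\<close>
definition scheme_solution ::
  "real \<Rightarrow> real \<Rightarrow> real \<Rightarrow> real \<Rightarrow> (real \<Rightarrow> real) \<Rightarrow> (real \<Rightarrow> real ^ 'n) \<Rightarrow> (real ^ 'n \<Rightarrow> real) \<Rightarrow>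
    real \<Rightarrow> real \<Rightarrow> (real ^ 'n \<Rightarrow> real) \<Rightarrow> bool" where
  "scheme_solution c s K M b F f h \<epsilon> u \<longleftrightarrow> bounded_field M u \<and>
     (\<forall>x. b (u x) + \<epsilon> * (u x + M)
        + ((\<Sum>i\<in>(UNIV::'n set). K / h) + c * (LBINT z. outer_kernel s h (z :: real ^ 'n))) * u x
      = flux_average K h F u x + c * (LBINT z. u (x + z) * outer_kernel s h z) + f x)"

definition centred_difference :: "'n \<Rightarrow> real \<Rightarrow> (real ^ 'n \<Rightarrow> real) \<Rightarrow> real ^ 'n \<Rightarrow> real" where
  "centred_difference i h \<phi> x = (\<phi> (x + axis i h) - \<phi> (x - axis i h)) / (2 * h)"

text \<open>
  The denominator is that of the numerical viscosity and not \<open>h\<^sup>2\<close>: the quotient tends to \<open>0\<close>.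
\<close>
definition second_difference :: "'n \<Rightarrow> real \<Rightarrow> (real ^ 'n \<Rightarrow> real) \<Rightarrow> real ^ 'n \<Rightarrow> real" where
  "second_difference i h \<phi> x = (\<phi> (x + axis i h) - 2 * \<phi> x + \<phi> (x - axis i h)) / (2 * h)"

definition jump_term where
  "jump_term \<eta> u k x = (LBINT z. (deriv \<eta> (u x) * (u (x + z) - u x)) * k z)"

definition taylor_term where
  "taylor_term \<phi> k x = (LBINT z. (\<phi> (x + z) - \<phi> x - grad \<phi> x \<bullet> z) * k z)"

text \<open>
  The left hand side of the entropy inequality for the scheme, with all differences of short range
  on the test function.
\<close>
definition discrete_entropy where
  "discrete_entropy c s K M b f \<eta> \<Phi> \<phi> r h \<epsilon> u =
     (LBINT x. ((f x - b (u x) - \<epsilon> * (u x + M)) * deriv \<eta> (u x)) * \<phi> x)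
   + (LBINT x. (\<Sum>i\<in>UNIV. \<Phi> (u x) $ i * centred_difference i h \<phi> x + K * \<eta> (u x) * second_difference i h \<phi> x))
   + c * (LBINT x. jump_term \<eta> u (outer_kernel s r) x * \<phi> x)
   + c * (LBINT x. \<eta> (u x) * taylor_term \<phi> (shell_kernel s h r) x)"

text \<open>
  The left hand side of the entropy inequality, for Borel functions. The sphere \<open>norm z = r\<close> is
  counted in the outer integral only.
\<close>
definition entropy_form where
  "entropy_form c s b f \<eta> \<Phi> \<phi> r u =
     (LBINT x. ((f x - b (u x)) * deriv \<eta> (u x)) * \<phi> x)
   + (LBINT x. \<Phi> (u x) \<bullet> grad \<phi> x)
   + c * (LBINT x. jump_term \<eta> u (outer_kernel s r) x * \<phi> x)
   + c * (LBINT x. \<eta> (u x) * taylor_term \<phi> (shell_kernel s 0 r) x)"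

locale entropy_test =
  fixes F \<Phi> :: "real \<Rightarrow> real ^ 'n" and f \<phi> :: "real ^ 'n \<Rightarrow> real" and b \<eta> :: "real \<Rightarrow> real"
    and s C R L :: real
  assumes f_measurable [measurable]: "f \<in> borel_measurable borel" and f_bound: "\<And>x. \<bar>f x\<bar> \<le> C"
    and b_cont: "continuous_on UNIV b" and s: "0 < s" "s < 2"
    and tb: "test_bounds \<phi> R L" and \<eta>: "C_class 2 \<eta>" and \<Phi>: "entropy_flux F \<eta> \<Phi>"
begin

lemmas \<phi>_bounds = test_boundsD[OF tb]

lemma \<Phi>_cont: "continuous_on UNIV \<Phi>" "continuous_on UNIV (\<lambda>r. \<Phi> r $ i)"
proof -
  show "continuous_on UNIV \<Phi>" using \<Phi> locally_lipschitz_continuous by (auto simp: entropy_flux_def)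
  then show "continuous_on UNIV (\<lambda>r. \<Phi> r $ i)" by (intro continuous_intros)
qed

lemmas \<eta>_cont = C_class_2_real(2,3)[OF \<eta>]

lemmas [measurable] = borel_measurable_continuous_onI[OF b_cont]
  borel_measurable_continuous_onI[OF \<phi>_bounds(8)] borel_measurable_continuous_onI[OF \<phi>_bounds(9)]
  borel_measurable_continuous_onI[OF \<eta>_cont(1)] borel_measurable_continuous_onI[OF \<eta>_cont(2)]
  borel_measurable_continuous_onI[OF \<Phi>_cont(1)] borel_measurable_continuous_onI[OF \<Phi>_cont(2)]

lemma \<phi>_integrable: "integrable lborel \<phi>"
  by (rule integrable_compact_support[of _ R L]) (use \<phi>_bounds(3,4) in auto)

lemma values_bounded:
  "\<exists>B\<ge>0. \<forall>r. \<bar>r\<bar> \<le> M \<longrightarrow> \<bar>b r\<bar> \<le> B \<and> \<bar>deriv \<eta> r\<bar> \<le> B \<and> \<bar>\<eta> r\<bar> \<le> B \<and> norm (\<Phi> r) \<le> B"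
proof -
  have "continuous_on UNIV (\<lambda>r. \<bar>b r\<bar> + \<bar>deriv \<eta> r\<bar> + \<bar>\<eta> r\<bar> + norm (\<Phi> r))"
    by (intro continuous_intros b_cont \<eta>_cont \<Phi>_cont)
  from continuous_bounded_on_range[OF this, of M] obtain B where B: "B \<ge> 0"
    "\<And>r. \<bar>r\<bar> \<le> M \<Longrightarrow> \<bar>\<bar>b r\<bar> + \<bar>deriv \<eta> r\<bar> + \<bar>\<eta> r\<bar> + norm (\<Phi> r)\<bar> \<le> B" by blast
  have "\<bar>b r\<bar> \<le> B \<and> \<bar>deriv \<eta> r\<bar> \<le> B \<and> \<bar>\<eta> r\<bar> \<le> B \<and> norm (\<Phi> r) \<le> B" if "\<bar>r\<bar> \<le> M" for r
    using B(2)[OF that] norm_ge_zero[of "\<Phi> r"] by linarith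
  with B(1) show ?thesis by blast
qed

text \<open>
  The outer integrals are controlled by the integral of their kernel; the test function provides
  integrability in \<open>x\<close>.
\<close>
lemma jump_term_bound:
  assumes u: "bounded_field M u" and B: "0 \<le> B" "\<And>r. \<bar>r\<bar> \<le> M \<Longrightarrow> \<bar>deriv \<eta> r\<bar> \<le> B"
    and k: "integrable lborel k" "\<And>z. 0 \<le> k z"
  shows "\<bar>deriv \<eta> (u x) * (u y - u x)\<bar> \<le> B * (2 * M)"
    and "\<bar>jump_term \<eta> u k x\<bar> \<le> B * (2 * M) * (LBINT z. k z)"
proof -
  note uD = bounded_fieldD[OF u]
  note [measurable] = uD(1)
  show le: "\<bar>deriv \<eta> (u x) * (u y - u x)\<bar> \<le> B * (2 * M)" for y
  proof -
    have "\<bar>u y - u x\<bar> \<le> 2 * M" using uD(2)[of x] uD(2)[of y] by linarith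
    then show ?thesis unfolding abs_mult by (intro mult_mono B uD(2)) auto
  qed
  show "\<bar>jump_term \<eta> u k x\<bar> \<le> B * (2 * M) * (LBINT z. k z)"
    unfolding jump_term_def by (rule abs_kernel_integral_le[OF k _ le]) measurable
qed

text \<open>
  The equation is multiplied by \<open>deriv \<eta> (u x) * \<phi> x\<close> and integrated. Numerical entropy fluxes
  estimate the local part, and convexity of \<open>\<eta>\<close> estimates the jumps shorter than \<open>r\<close>; both
  estimates are differences of functions of \<open>u\<close>, which summation by parts moves to \<open>\<phi>\<close>.
\<close>
lemma discrete_entropy_inequality:
  assumes u: "scheme_solution c s K M b F f h \<epsilon> u" and F: "K-lipschitz_on {-M..M} F"
    and c: "0 \<le> c" and h: "0 < h" "h \<le> r" and \<phi>: "\<And>x. 0 \<le> \<phi> x" and conv: "convex_on UNIV \<eta>"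
  shows "0 \<le> discrete_entropy c s K M b f \<eta> \<Phi> \<phi> r h \<epsilon> u"
proof -
  have ub: "bounded_field M u" and eq: "\<And>x. b (u x) + \<epsilon> * (u x + M)
        + ((\<Sum>i\<in>(UNIV::'n set). K / h) + c * (LBINT z. outer_kernel s h (z :: real ^ 'n))) * u x
      = flux_average K h F u x + c * (LBINT z. u (x + z) * outer_kernel s h z) + f x"
    using u by (auto simp: scheme_solution_def)
  note uD = bounded_fieldD[OF ub]
  note [measurable] = uD(1)
  define kL :: "real ^ 'n \<Rightarrow> real" where "kL = outer_kernel s r"
  define kS :: "real ^ 'n \<Rightarrow> real" where "kS = shell_kernel s h r"
  have [measurable]: "kL \<in> borel_measurable borel" "kS \<in> borel_measurable borel"
    unfolding kL_def kS_def by measurable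
  have kLi: "integrable lborel kL" and kSi: "integrable lborel kS"
    using integrable_outer_kernel[OF s(1), of r] integrable_shell_kernel[OF s(1) h(1)] h
    unfolding kL_def kS_def by auto
  have k0: "0 \<le> kL z" "0 \<le> kS z" for z by (auto simp: kL_def kS_def)
  have split: "outer_kernel s h z = kL z + kS z" for z :: "real ^ 'n"
    using h by (auto simp: outer_kernel_def shell_kernel_def kL_def kS_def indicator_def)
  have bk: "integrable lborel (\<lambda>z. w z * kL z)" "integrable lborel (\<lambda>z. w z * kS z)"
    if "w \<in> borel_measurable borel" "\<And>z. \<bar>w z\<bar> \<le> B" for w B
    using integrable_bounded_mult[OF kLi that] integrable_bounded_mult[OF kSi that] by auto
  have uu: "\<bar>u (x + z) - u x\<bar> \<le> 2 * M" for x z using uD(2)[of x] uD(2)[of "x + z"] by linarith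
  obtain B where B0: "0 \<le> B" and B: "\<And>r. \<bar>r\<bar> \<le> M \<Longrightarrow>
      \<bar>b r\<bar> \<le> B \<and> \<bar>deriv \<eta> r\<bar> \<le> B \<and> \<bar>\<eta> r\<bar> \<le> B \<and> norm (\<Phi> r) \<le> B"
    using values_bounded[of M] by blast
  have \<eta>\<eta>: "\<bar>\<eta> (u (x + z)) - \<eta> (u x)\<bar> \<le> 2 * B" for x z
    using B[OF uD(2), of "x + z"] B[OF uD(2), of x] by linarith
  define Gm where "Gm i r = K * \<eta> r + (- 1) * \<Phi> r $ i" for i r
  define Gp where "Gp i r = K * \<eta> r + 1 * \<Phi> r $ i" for i r
  have Gc: "continuous_on UNIV (Gm i)" "continuous_on UNIV (Gp i)" for i
    unfolding Gm_def Gp_def by (intro continuous_intros \<eta>_cont \<Phi>_cont)+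
  note [measurable] = borel_measurable_continuous_onI[OF Gc(1)] borel_measurable_continuous_onI[OF Gc(2)]
  define A where "A x = (f x - b (u x) - \<epsilon> * (u x + M)) * deriv \<eta> (u x)" for x
  define E where "E x = (\<Sum>i\<in>UNIV. ((Gm i (u (x + axis i h)) - Gm i (u x))
      + (Gp i (u (x - axis i h)) - Gp i (u x))) / (2 * h))" for x
  define J where "J = jump_term \<eta> u kL"
  define S where "S x = (LBINT z. (\<eta> (u (x + z)) - \<eta> (u x)) * kS z)" for x
  have [measurable]: "J \<in> borel_measurable borel" "S \<in> borel_measurable borel"
    unfolding J_def jump_term_def[abs_def] S_def by measurable
  \<comment> \<open>The equation times \<open>deriv \<eta> (u x)\<close>: every difference is replaced by the one that convexity
    allows, except for the jumps longer than \<open>r\<close>, which the definition of entropy solutions keeps.\<close>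
  have pointwise: "0 \<le> A x + E x + c * J x + c * S x" for x
  proof -
    let ?e = "deriv \<eta> (u x)"
    have iL: "integrable lborel (\<lambda>z. (u (x + z) - u x) * kL z)" and iS: "integrable lborel (\<lambda>z. (u (x + z) - u x) * kS z)"
      using bk[of "\<lambda>z. u (x + z) - u x" "2 * M"] uu by auto
    have iu: "integrable lborel (\<lambda>z. u (x + z) * kL z)" "integrable lborel (\<lambda>z. u (x + z) * kS z)"
      using bk[of "\<lambda>z. u (x + z)" M] uD by auto
    have t1: "(LBINT z. u (x + z) * outer_kernel s h z) - (LBINT z. outer_kernel s h (z::real^'n)) * u x
        = (LBINT z. (u (x + z) - u x) * kL z) + (LBINT z. (u (x + z) - u x) * kS z)"
      using iu kLi kSi by (simp add: split left_diff_distrib distrib_left algebra_simps)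
    have t2: "flux_average K h F u x - (\<Sum>i\<in>(UNIV::'n set). K / h) * u x
        = (\<Sum>i\<in>UNIV. (((K * u (x + axis i h) + (- 1) * F (u (x + axis i h)) $ i) - (K * u x + (- 1) * F (u x) $ i))
          + ((K * u (x - axis i h) + 1 * F (u (x - axis i h)) $ i) - (K * u x + 1 * F (u x) $ i))) / (2 * h))"
      unfolding flux_average_def sum_distrib_right sum_subtractf[symmetric]
      using h by (intro sum.cong refl) (simp add: field_simps)
    have "0 = ?e * ((f x - b (u x) - \<epsilon> * (u x + M))
        + (flux_average K h F u x - (\<Sum>i\<in>(UNIV::'n set). K / h) * u x)
        + c * ((LBINT z. u (x + z) * outer_kernel s h z) - (LBINT z. outer_kernel s h (z::real^'n)) * u x))"
      using eq[of x] by (simp add: algebra_simps)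
    also have "\<dots> = A x + ?e * (flux_average K h F u x - (\<Sum>i\<in>(UNIV::'n set). K / h) * u x)
        + (c * (?e * (LBINT z. (u (x + z) - u x) * kL z)) + c * (?e * (LBINT z. (u (x + z) - u x) * kS z)))"
      unfolding t1 A_def by (simp add: algebra_simps)
    also have "\<dots> \<le> A x + E x + (c * J x + c * S x)"
    proof (intro add_mono order_refl mult_left_mono c)
      show "?e * (flux_average K h F u x - (\<Sum>i\<in>(UNIV::'n set). K / h) * u x) \<le> E x"
        unfolding t2 E_def sum_distrib_left times_divide_eq_right distrib_left Gm_def Gp_def using h
        by (intro sum_mono divide_right_mono add_mono numerical_entropy_flux[OF F \<eta> conv \<Phi>] uD(2)) auto
      show "?e * (LBINT z. (u (x + z) - u x) * kL z) \<le> J x"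
        by (simp add: J_def jump_term_def mult.assoc)
      have "?e * (LBINT z. (u (x + z) - u x) * kS z) = (LBINT z. ?e * ((u (x + z) - u x) * kS z))"
        by simp
      also have "\<dots> \<le> S x" unfolding S_def
      proof (rule integral_mono)
        show "integrable lborel (\<lambda>z. ?e * ((u (x + z) - u x) * kS z))" using iS by simp
        show "integrable lborel (\<lambda>z. (\<eta> (u (x + z)) - \<eta> (u x)) * kS z)"
          by (rule bk(2)[OF _ \<eta>\<eta>]) measurable
        show "?e * ((u (x + z) - u x) * kS z) \<le> (\<eta> (u (x + z)) - \<eta> (u x)) * kS z" for z
          unfolding mult.assoc[symmetric]
          by (intro mult_right_mono convex_above_tangent[OF \<eta> conv] k0)
      qed
      finally show "?e * (LBINT z. (u (x + z) - u x) * kS z) \<le> S x" .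
    qed
    finally show ?thesis by simp
  qed
  have int: "integrable lborel (\<lambda>x. w x * \<phi> x)" if "w \<in> borel_measurable borel" "\<And>x. \<bar>w x\<bar> \<le> B" for w B
    by (rule integrable_bounded_mult[OF \<phi>_integrable that])
  have iA: "integrable lborel (\<lambda>x. A x * \<phi> x)"
  proof (rule int)
    show "A \<in> borel_measurable borel" unfolding A_def by measurable
    show "\<bar>A x\<bar> \<le> (C + B + \<bar>\<epsilon>\<bar> * (2 * M)) * B" for x
      unfolding A_def abs_mult
    proof (rule mult_mono)
      have "\<bar>\<epsilon> * (u x + M)\<bar> \<le> \<bar>\<epsilon>\<bar> * (2 * M)"
        unfolding abs_mult using uD(2)[of x] by (intro mult_left_mono) auto
      then show "\<bar>f x - b (u x) - \<epsilon> * (u x + M)\<bar> \<le> C + B + \<bar>\<epsilon>\<bar> * (2 * M)"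
        using f_bound[of x] B[OF uD(2), of x] by linarith
      then show "0 \<le> C + B + \<bar>\<epsilon>\<bar> * (2 * M)" by linarith
    qed (use B[OF uD(2), of x] in auto)
  qed
  have iJ: "integrable lborel (\<lambda>x. J x * \<phi> x)"
    unfolding J_def by (rule int[OF _ jump_term_bound(2)[OF ub B0 _ kLi k0(1)]]) (use B in \<open>auto simp: J_def[symmetric]\<close>)
  have iS: "integrable lborel (\<lambda>x. S x * \<phi> x)"
  proof (rule int)
    show "\<bar>S x\<bar> \<le> (2 * B) * (LBINT z. kS z)" for x
      unfolding S_def by (rule abs_kernel_integral_le[OF kSi k0(2) _ \<eta>\<eta>]) measurable
  qed measurable
  have G: "integrable lborel (\<lambda>x. (G (u (x + a)) - G (u x)) * \<phi> x)"
      "(LBINT x. (G (u (x + a)) - G (u x)) * \<phi> x) = (LBINT x. G (u x) * (\<phi> (x - a) - \<phi> x))"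
      "integrable lborel (\<lambda>x. G (u x) * (\<phi> (x - a) - \<phi> x))"
    if Gcont: "continuous_on UNIV G" for G and a :: "real ^ 'n"
  proof -
    have [measurable]: "G \<in> borel_measurable borel" by (rule borel_measurable_continuous_onI[OF Gcont])
    obtain B where B: "0 \<le> B" "\<And>r. \<bar>r\<bar> \<le> M \<Longrightarrow> \<bar>G r\<bar> \<le> B"
      using continuous_bounded_on_range[OF Gcont, of M] by blast
    have "\<bar>G (u (x + a)) - G (u x)\<bar> \<le> 2 * B" for x
      using B(2)[OF uD(2), of "x + a"] B(2)[OF uD(2), of x] by linarith
    then show "integrable lborel (\<lambda>x. (G (u (x + a)) - G (u x)) * \<phi> x)" by (intro int) auto
    show "(LBINT x. (G (u (x + a)) - G (u x)) * \<phi> x) = (LBINT x. G (u x) * (\<phi> (x - a) - \<phi> x))"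
      by (rule summation_by_parts[where B = B]) (use B uD \<phi>_integrable in auto)
    have "integrable lborel (\<lambda>x. \<phi> (x - a) - \<phi> x)"
      using integrable_translate[OF \<phi>_integrable, of "- a"] \<phi>_integrable by simp
    then show "integrable lborel (\<lambda>x. G (u x) * (\<phi> (x - a) - \<phi> x))"
      by (rule integrable_bounded_mult[where B = B]) (use B uD in auto)
  qed
  have E_eq: "(\<lambda>x. E x * \<phi> x) = (\<lambda>x. \<Sum>i\<in>UNIV. ((Gm i (u (x + axis i h)) - Gm i (u x)) * \<phi> x
      + (Gp i (u (x + - axis i h)) - Gp i (u x)) * \<phi> x) / (2 * h))"
    by (simp add: E_def sum_distrib_right distrib_right)
  have iE: "integrable lborel (\<lambda>x. E x * \<phi> x)"
    unfolding E_eq by (intro Bochner_Integration.integrable_sum Bochner_Integration.integrable_divide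
        Bochner_Integration.integrable_add G Gc)
  have "(LBINT x. E x * \<phi> x) = (\<Sum>i\<in>UNIV. ((LBINT x. (Gm i (u (x + axis i h)) - Gm i (u x)) * \<phi> x)
      + (LBINT x. (Gp i (u (x + - axis i h)) - Gp i (u x)) * \<phi> x)) / (2 * h))"
    unfolding E_eq using G(1)[OF Gc(1)] G(1)[OF Gc(2)]
    by (subst Bochner_Integration.integral_sum) (auto simp del: add_uminus_conv_diff)
  also have "\<dots> = (\<Sum>i\<in>UNIV. ((LBINT x. Gm i (u x) * (\<phi> (x - axis i h) - \<phi> x))
      + (LBINT x. Gp i (u x) * (\<phi> (x - - axis i h) - \<phi> x))) / (2 * h))"
    by (simp only: G(2)[OF Gc(1)] G(2)[OF Gc(2)])
  also have "\<dots> = (LBINT x. (\<Sum>i\<in>UNIV. (Gm i (u x) * (\<phi> (x - axis i h) - \<phi> x)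
      + Gp i (u x) * (\<phi> (x - - axis i h) - \<phi> x)) / (2 * h)))"
    using G(3)[OF Gc(1)] G(3)[OF Gc(2)]
    by (subst Bochner_Integration.integral_sum) (auto simp del: diff_minus_eq_add)
  also have "\<dots> = (LBINT x. (\<Sum>i\<in>UNIV. \<Phi> (u x) $ i * centred_difference i h \<phi> x
        + K * \<eta> (u x) * second_difference i h \<phi> x))"
    using h by (intro Bochner_Integration.integral_cong sum.cong refl)
      (simp add: Gm_def Gp_def centred_difference_def second_difference_def field_simps)
  finally have E_int: "(LBINT x. E x * \<phi> x) = \<dots>" .
  have S_int: "(LBINT x. S x * \<phi> x) = (LBINT x. \<eta> (u x) * taylor_term \<phi> kS x)"
  proof -
    have even: "kS (- z) = kS z" for z by (simp add: kS_def shell_kernel_def indicator_def)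
    \<comment> \<open>The linear term may be inserted because the kernel is even.\<close>
    have taylor: "(LBINT z. (\<phi> (x + z) - \<phi> x) * kS z) = taylor_term \<phi> kS x" for x
    proof -
      have z0: "(LBINT z. (grad \<phi> x \<bullet> z) * kS z) = 0"
        by (rule integral_odd_eq_0) (auto simp: even)
      have i1: "integrable lborel (\<lambda>z. (\<phi> (x + z) - \<phi> x) * kS z)"
      proof (rule bk(2))
        show "\<bar>\<phi> (x + z) - \<phi> x\<bar> \<le> 2 * L" for z
          using \<phi>_bounds(4)[of x] \<phi>_bounds(4)[of "x + z"] by linarith
      qed measurable
      have i2: "integrable lborel (\<lambda>z. (grad \<phi> x \<bullet> z) * kS z)"
      proof (rule Bochner_Integration.integrable_bound)
        show "integrable lborel (\<lambda>z. (norm (grad \<phi> x) * r) * kS z)" using kSi by simp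
        show "AE z in lborel. norm ((grad \<phi> x \<bullet> z) * kS z) \<le> norm ((norm (grad \<phi> x) * r) * kS z)"
        proof (rule AE_I2)
          fix z
          show "norm ((grad \<phi> x \<bullet> z) * kS z) \<le> norm ((norm (grad \<phi> x) * r) * kS z)"
          proof (cases "norm z < r")
            case True
            have "\<bar>grad \<phi> x \<bullet> z\<bar> \<le> norm (grad \<phi> x) * norm z" by (rule Cauchy_Schwarz_ineq2)
            also have "\<dots> \<le> norm (grad \<phi> x) * r" using True by (intro mult_left_mono) auto
            finally show ?thesis using k0(2)[of z] h
              by (simp add: abs_mult mult_right_mono)
          qed (simp add: kS_def shell_kernel_def)
        qed
      qed measurable
      show ?thesis
        using z0 Bochner_Integration.integral_diff[OF i1 i2] by (simp add: taylor_term_def left_diff_distrib)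
    qed
    show ?thesis
      unfolding S_def taylor[symmetric]
      by (rule nonlocal_by_parts[where w = "\<lambda>x. \<eta> (u x)" and B = B and C = L])
        (use B[OF uD(2)] \<phi>_integrable \<phi>_bounds(4) kSi even in auto)
  qed
  have "0 \<le> (LBINT x. (A x + E x + c * J x + c * S x) * \<phi> x)"
    using pointwise \<phi> by (intro integral_nonneg_AE AE_I2 mult_nonneg_nonneg)
  also have "\<dots> = (LBINT x. A x * \<phi> x + E x * \<phi> x + c * (J x * \<phi> x) + c * (S x * \<phi> x))"
    by (simp add: distrib_right mult.assoc)
  also have "\<dots> = (LBINT x. A x * \<phi> x) + (LBINT x. E x * \<phi> x)
      + c * (LBINT x. J x * \<phi> x) + c * (LBINT x. S x * \<phi> x)"
    using iA iE iJ iS by simp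
  finally show ?thesis
    unfolding discrete_entropy_def E_int S_int unfolding A_def J_def kL_def kS_def .
qed

end

section \<open>Passage to the limit in the entropy inequality\<close>

lemma axis_scaled: "axis i y = y *\<^sub>R axis i (1::real)"
  by (simp add: axis_def vec_eq_iff)

lemma norm_axis_real: "norm (axis i y :: real ^ 'n) = \<bar>y\<bar>"
  by (subst axis_scaled) simp

lemma difference_quotient_limit:
  fixes \<phi> :: "real ^ 'n \<Rightarrow> real"
  assumes d: "(\<phi> has_derivative (\<lambda>z. grad \<phi> x \<bullet> z)) (at x)" and t: "\<And>k. t k \<noteq> 0" "t \<longlonglongrightarrow> 0"
  shows "(\<lambda>k. (\<phi> (x + axis i (t k)) - \<phi> x) / t k) \<longlonglongrightarrow> grad \<phi> x $ i"
proof -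
  note ax = axis_scaled[of i]
  have "((\<lambda>y. \<phi> (x + y *\<^sub>R axis i 1)) has_derivative (\<lambda>y. grad \<phi> x \<bullet> (y *\<^sub>R axis i 1))) (at 0)"
  proof (rule has_derivative_compose[where f = "\<lambda>y. x + y *\<^sub>R axis i 1" and g = \<phi>])
    show "((\<lambda>y. x + y *\<^sub>R axis i 1) has_derivative (\<lambda>y. y *\<^sub>R axis i 1)) (at 0)"
      by (auto intro!: derivative_eq_intros)
    show "(\<phi> has_derivative (\<bullet>) (grad \<phi> x)) (at (x + 0 *\<^sub>R axis i 1))" using d by simp
  qed
  then have "((\<lambda>y. \<phi> (x + axis i y)) has_real_derivative (grad \<phi> x $ i)) (at 0)"
    by (simp add: has_field_derivative_def ax[symmetric] inner_axis mult_commute_abs)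
  then have "((\<lambda>y. (\<phi> (x + axis i y) - \<phi> x) / y) \<longlongrightarrow> grad \<phi> x $ i) (at 0)"
    using ax[of 0] by (simp add: DERIV_def)
  moreover have "filterlim t (at 0) sequentially"
    using t by (simp add: filterlim_at)
  ultimately show ?thesis by (rule filterlim_compose)
qed

context entropy_test
begin

text \<open>
  Dominated convergence in each of the four integrals. The inner integral over the long jumps
  converges for almost every \<open>x\<close>, since translates of null sets are null sets. The two difference
  quotients of \<open>\<phi>\<close> have the same limit, so they add up to the gradient in the centred difference
  and cancel in the second difference.
\<close>
lemma discrete_entropy_tendsto:
  assumes v: "\<And>k. bounded_field M (v k)" and u: "bounded_field M u"
    and lim: "AE x in lborel. (\<lambda>k. v k x) \<longlonglongrightarrow> u x" and K: "0 \<le> K"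
    and h: "\<And>k. 0 < h k" "\<And>k. h k \<le> 1" "h \<longlonglongrightarrow> 0"
    and \<epsilon>: "\<And>k. 0 \<le> \<epsilon> k" "\<And>k. \<epsilon> k \<le> 1" "\<epsilon> \<longlonglongrightarrow> 0" and r: "0 < r"
  shows "(\<lambda>k. discrete_entropy c s K M b f \<eta> \<Phi> \<phi> r (h k) (\<epsilon> k) (v k)) \<longlonglongrightarrow> entropy_form c s b f \<eta> \<Phi> \<phi> r u"
proof -
  note uD = bounded_fieldD[OF u] and vD = bounded_fieldD[OF v]
  note [measurable] = uD(1) vD(1)
  note R = \<phi>_bounds(1-3)
  have M: "0 \<le> M" using uD(2)[of 0] by linarith
  have C: "0 \<le> C" using f_bound[of 0] by linarith
  obtain B where B0: "0 \<le> B" and B: "\<And>r. \<bar>r\<bar> \<le> M \<Longrightarrow>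
      \<bar>b r\<bar> \<le> B \<and> \<bar>deriv \<eta> r\<bar> \<le> B \<and> \<bar>\<eta> r\<bar> \<le> B \<and> norm (\<Phi> r) \<le> B"
    using values_bounded[of M] by blast
  note comp = continuous_on_tendsto_compose[OF _ _ UNIV_I, simplified]
  have cball: "integrable lborel (\<lambda>x::real^'n. indicator (cball 0 \<rho>) x * (a::real))" for \<rho> a
    using emeasure_bounded_finite[of "cball (0::real^'n) \<rho>"]
    by (intro integrable_mult_left integrable_real_indicator) auto
  have T1: "(\<lambda>k. \<integral>x. ((f x - b (v k x) - \<epsilon> k * (v k x + M)) * deriv \<eta> (v k x)) * \<phi> x \<partial>lborel)
      \<longlonglongrightarrow> (LBINT x. ((f x - b (u x)) * deriv \<eta> (u x)) * \<phi> x)"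
  proof (rule integral_dominated_convergence[where w = "\<lambda>x. ((C + B + 2 * M) * B) * \<bar>\<phi> x\<bar>"])
    show "AE x in lborel. (\<lambda>k. ((f x - b (v k x) - \<epsilon> k * (v k x + M)) * deriv \<eta> (v k x)) * \<phi> x)
        \<longlonglongrightarrow> ((f x - b (u x)) * deriv \<eta> (u x)) * \<phi> x"
      using lim
    proof eventually_elim
      case (elim x)
      have "(\<lambda>k. ((f x - b (v k x) - \<epsilon> k * (v k x + M)) * deriv \<eta> (v k x)) * \<phi> x)
          \<longlonglongrightarrow> ((f x - b (u x) - 0 * (u x + M)) * deriv \<eta> (u x)) * \<phi> x"
        by (intro tendsto_intros elim \<epsilon> comp[OF b_cont] comp[OF \<eta>_cont(1)])
      then show ?case by simp
    qed
    show "AE x in lborel. norm (((f x - b (v k x) - \<epsilon> k * (v k x + M)) * deriv \<eta> (v k x)) * \<phi> x)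
        \<le> ((C + B + 2 * M) * B) * \<bar>\<phi> x\<bar>" for k
    proof (rule AE_I2)
      fix x
      have "\<bar>\<epsilon> k * (v k x + M)\<bar> \<le> 1 * (2 * M)"
        unfolding abs_mult using vD(2)[of k x] \<epsilon>(1,2)[of k] by (intro mult_mono) auto
      then have "\<bar>f x - b (v k x) - \<epsilon> k * (v k x + M)\<bar> \<le> C + B + 2 * M"
        using f_bound[of x] B[OF vD(2), of k x] by linarith
      then show "norm (((f x - b (v k x) - \<epsilon> k * (v k x + M)) * deriv \<eta> (v k x)) * \<phi> x)
          \<le> ((C + B + 2 * M) * B) * \<bar>\<phi> x\<bar>"
        unfolding real_norm_def abs_mult using C M B0 B[OF vD(2), of k x]
        by (intro mult_mono mult_nonneg_nonneg) auto
    qed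
    show "integrable lborel (\<lambda>x. ((C + B + 2 * M) * B) * \<bar>\<phi> x\<bar>)" using \<phi>_integrable by simp
  qed measurable
  define q where "q k x = (\<Sum>i\<in>UNIV. \<Phi> (v k x) $ i * centred_difference i (h k) \<phi> x
      + K * \<eta> (v k x) * second_difference i (h k) \<phi> x)" for k x
  have T2: "(\<lambda>k. \<integral>x. q k x \<partial>lborel) \<longlonglongrightarrow> (LBINT x. \<Phi> (u x) \<bullet> grad \<phi> x)"
  proof (rule integral_dominated_convergence[where w = "\<lambda>x. indicator (cball 0 (R + 1)) x * (\<Sum>i\<in>(UNIV::'n set). B * L + K * B * L)"])
    have neg: "axis i (- t) = - axis i t" for i :: 'n and t :: real by (simp add: axis_def vec_eq_iff)
    show "AE x in lborel. (\<lambda>k. q k x) \<longlonglongrightarrow> \<Phi> (u x) \<bullet> grad \<phi> x"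
      using lim
    proof eventually_elim
      case (elim x)
      have "(\<lambda>k. \<Phi> (v k x) $ i * centred_difference i (h k) \<phi> x + K * \<eta> (v k x) * second_difference i (h k) \<phi> x)
          \<longlonglongrightarrow> \<Phi> (u x) $ i * grad \<phi> x $ i" for i
      proof -
        define p p' where "p k = (\<phi> (x + axis i (h k)) - \<phi> x) / h k"
          and "p' k = (\<phi> (x + axis i (- h k)) - \<phi> x) / (- h k)" for k
        have p: "p \<longlonglongrightarrow> grad \<phi> x $ i" unfolding p_def
          by (rule difference_quotient_limit[OF \<phi>_bounds(7) _ h(3)]) (use h(1) in \<open>auto simp: less_imp_neq[symmetric]\<close>)
        have p': "p' \<longlonglongrightarrow> grad \<phi> x $ i" unfolding p'_def
          by (rule difference_quotient_limit[OF \<phi>_bounds(7)])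
            (use h(1) tendsto_minus[OF h(3)] in \<open>auto simp: less_imp_neq[symmetric]\<close>)
        have pp: "centred_difference i (h k) \<phi> x = (p k + p' k) / 2"
          "second_difference i (h k) \<phi> x = (p k - p' k) / 2" for k
          using h(1)[of k] by (simp_all add: centred_difference_def second_difference_def p_def p'_def neg field_simps)
        have "(\<lambda>k. \<Phi> (v k x) $ i * ((p k + p' k) / 2) + K * \<eta> (v k x) * ((p k - p' k) / 2))
            \<longlonglongrightarrow> \<Phi> (u x) $ i * ((grad \<phi> x $ i + grad \<phi> x $ i) / 2) + K * \<eta> (u x) * ((grad \<phi> x $ i - grad \<phi> x $ i) / 2)"
          by (intro tendsto_intros p p' elim comp[OF \<Phi>_cont(2)] comp[OF \<eta>_cont(2)]) auto
        moreover have "\<Phi> (u x) $ i * ((grad \<phi> x $ i + grad \<phi> x $ i) / 2) + K * \<eta> (u x) * ((grad \<phi> x $ i - grad \<phi> x $ i) / 2)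
            = \<Phi> (u x) $ i * grad \<phi> x $ i" by simp
        ultimately show ?thesis unfolding pp by (simp only:)
      qed
      then show ?case unfolding inner_vec_def q_def by (intro tendsto_sum) simp
    qed
    show "AE x in lborel. norm (q k x) \<le> indicator (cball 0 (R + 1)) x * (\<Sum>i\<in>(UNIV::'n set). B * L + K * B * L)" for k
    proof (rule AE_I2)
      fix x
      have na: "norm (axis i (h k) :: real ^ 'n) = h k" for i using h(1)[of k] by (simp add: norm_axis_real)
      show "norm (q k x) \<le> indicator (cball 0 (R + 1)) x * (\<Sum>i\<in>(UNIV::'n set). B * L + K * B * L)"
      proof (cases "norm x \<le> R + 1")
        case True
        have "norm (\<Phi> (v k x) $ i * centred_difference i (h k) \<phi> x + K * \<eta> (v k x) * second_difference i (h k) \<phi> x)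
          \<le> B * L + K * B * L" for i
        proof -
          have 1: "\<bar>\<phi> (x + axis i (h k)) - \<phi> x\<bar> \<le> L * h k" "\<bar>\<phi> (x - axis i (h k)) - \<phi> x\<bar> \<le> L * h k"
            using \<phi>_bounds(5)[of "x + axis i (h k)" x] \<phi>_bounds(5)[of "x - axis i (h k)" x] by (simp_all add: na)
          have 2: "\<bar>centred_difference i (h k) \<phi> x\<bar> \<le> L" "\<bar>second_difference i (h k) \<phi> x\<bar> \<le> L"
            using 1 h(1)[of k] unfolding centred_difference_def second_difference_def
            by (simp_all add: abs_div field_simps abs_le_iff)
          have "\<bar>\<Phi> (v k x) $ i\<bar> \<le> B" "\<bar>\<eta> (v k x)\<bar> \<le> B"
            using B[OF vD(2), of k x] component_le_norm_cart[of "\<Phi> (v k x)" i] by auto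
          with 2 have "\<bar>\<Phi> (v k x) $ i * centred_difference i (h k) \<phi> x\<bar> \<le> B * L"
            "\<bar>K * \<eta> (v k x) * second_difference i (h k) \<phi> x\<bar> \<le> K * B * L"
            unfolding abs_mult using K B0 by (intro mult_mono; auto)+
          then show ?thesis unfolding real_norm_def by linarith
        qed
        then have "norm (q k x) \<le> (\<Sum>i\<in>(UNIV::'n set). B * L + K * B * L)"
          unfolding q_def by (intro sum_norm_le) simp
        then show ?thesis using True by simp
      next
        case False
        have "R < norm (x + axis i (h k))" "R < norm (x - axis i (h k))" "R < norm x" for i
          using False h(2)[of k] na[of i] norm_triangle_ineq4[of "x + axis i (h k)" "axis i (h k)"]
            norm_triangle_ineq[of "x - axis i (h k)" "axis i (h k)"] R(1) by simp_all
        then show ?thesis using R(3) False by (simp add: q_def centred_difference_def second_difference_def)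
      qed
    qed
  qed (use cball in \<open>simp_all add: q_def centred_difference_def second_difference_def\<close>)
  define kL :: "real ^ 'n \<Rightarrow> real" where "kL = outer_kernel s r"
  have kLi: "integrable lborel kL" and kL0: "0 \<le> kL z" for z
    using integrable_outer_kernel[OF s(1) r] unfolding kL_def by auto
  have [measurable]: "kL \<in> borel_measurable borel" unfolding kL_def by measurable
  have Jb: "\<bar>deriv \<eta> (v k x) * (v k y - v k x)\<bar> \<le> B * (2 * M)"
    "\<bar>jump_term \<eta> (v k) kL x\<bar> \<le> B * (2 * M) * (LBINT z. kL z)" for k x y
    using jump_term_bound[OF v B0 _ kLi kL0] B by auto
  have T3: "(\<lambda>k. \<integral>x. jump_term \<eta> (v k) kL x * \<phi> x \<partial>lborel) \<longlonglongrightarrow> (LBINT x. jump_term \<eta> u kL x * \<phi> x)"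
  proof (rule integral_dominated_convergence[where w = "\<lambda>x. (B * (2 * M) * (LBINT z. kL z)) * \<bar>\<phi> x\<bar>"])
    show "AE x in lborel. (\<lambda>k. jump_term \<eta> (v k) kL x * \<phi> x) \<longlonglongrightarrow> jump_term \<eta> u kL x * \<phi> x"
      using lim
    proof eventually_elim
      case (elim x)
      have "(\<lambda>k. jump_term \<eta> (v k) kL x) \<longlonglongrightarrow> jump_term \<eta> u kL x"
        unfolding jump_term_def
      proof (rule integral_dominated_convergence[where w = "\<lambda>z. (B * (2 * M)) * kL z"])
        show "AE z in lborel. (\<lambda>k. (deriv \<eta> (v k x) * (v k (x + z) - v k x)) * kL z)
            \<longlonglongrightarrow> (deriv \<eta> (u x) * (u (x + z) - u x)) * kL z"
          using AE_translate[OF lim, of x]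
        proof eventually_elim
          case (elim z)
          show ?case by (intro tendsto_intros comp[OF \<eta>_cont(1)] elim \<open>(\<lambda>k. v k x) \<longlonglongrightarrow> u x\<close>)
        qed
        show "AE z in lborel. norm ((deriv \<eta> (v k x) * (v k (x + z) - v k x)) * kL z) \<le> (B * (2 * M)) * kL z" for k
          using Jb(1)[of k x] kL0 by (intro AE_I2) (simp add: abs_mult[of _ "kL _"] mult_right_mono)
      qed (use kLi in auto)
      then show ?case by (intro tendsto_intros)
    qed
    show "AE x in lborel. norm (jump_term \<eta> (v k) kL x * \<phi> x) \<le> (B * (2 * M) * (LBINT z. kL z)) * \<bar>\<phi> x\<bar>" for k
      unfolding real_norm_def abs_mult by (intro AE_I2 mult_right_mono Jb(2)) auto
    show "integrable lborel (\<lambda>x. (B * (2 * M) * (LBINT z. kL z)) * \<bar>\<phi> x\<bar>)" using \<phi>_integrable by simp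
  qed (unfold jump_term_def, measurable)
  define kI where "kI z = indicator {z. norm z \<le> r} z * ((norm z)\<^sup>2 * levy_kernel s z)" for z :: "real ^ 'n"
  have kIi: "integrable lborel kI" and kI0: "0 \<le> kI z" for z
    using integrable_levy_kernel_inner[OF s r] unfolding kI_def by auto
  define I where "I = (LBINT z. kI z)"
  define Q where "Q d x z = (\<phi> (x + z) - \<phi> x - grad \<phi> x \<bullet> z) * shell_kernel s d r z" for d x z
  have tQ: "taylor_term \<phi> (shell_kernel s d r) x = (LBINT z. Q d x z)" for d x
    by (simp add: taylor_term_def Q_def)
  have Qm [measurable]: "(\<lambda>(x, z). Q d x z) \<in> borel_measurable (borel \<Otimes>\<^sub>M borel)" for d
    unfolding Q_def by measurable
  have Qb: "\<bar>Q d x z\<bar> \<le> L * kI z" for d x z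
  proof (cases "d \<le> norm z \<and> norm z < r")
    case True
    then show ?thesis using mult_right_mono[OF \<phi>_bounds(10)[of x z], of "levy_kernel s z"]
      by (simp add: Q_def shell_kernel_def kI_def abs_mult mult.assoc)
  qed (use R(2) kI0[of z] in \<open>simp add: Q_def shell_kernel_def\<close>)
  have Q0: "Q d x z = 0" if "R + r < norm x" for d x z
  proof (cases "norm z < r")
    case True
    have "norm x \<le> norm (x + z) + norm z" using norm_triangle_ineq4[of "x + z" z] by simp
    then have "R < norm (x + z)" "R < norm x" using that True r by auto
    then show ?thesis using R(3) \<phi>_bounds(6) by (simp add: Q_def)
  qed (simp add: Q_def shell_kernel_def)
  have T4: "(\<lambda>k. \<integral>x. \<eta> (v k x) * (LBINT z. Q (h k) x z) \<partial>lborel)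
      \<longlonglongrightarrow> (LBINT x. \<eta> (u x) * (LBINT z. Q 0 x z))"
  proof (rule integral_dominated_convergence[where w = "\<lambda>x. indicator (cball 0 (R + r)) x * (B * (L * I))"])
    have Sb: "\<bar>\<integral>z. Q d x z \<partial>lborel\<bar> \<le> L * I" for d x
    proof -
      have "integrable lborel (Q d x)"
        by (rule Bochner_Integration.integrable_bound[of _ "\<lambda>z. L * kI z"])
          (use kIi Qb[of d x] R(2) kI0 in \<open>auto simp: abs_mult\<close>)
      then have "\<bar>\<integral>z. Q d x z \<partial>lborel\<bar> \<le> (LBINT z. L * kI z)"
        using kIi Qb by (intro integral_abs_bound_integral) auto
      then show ?thesis by (simp add: I_def)
    qed
    show "AE x in lborel. (\<lambda>k. \<eta> (v k x) * (LBINT z. Q (h k) x z)) \<longlonglongrightarrow> \<eta> (u x) * (LBINT z. Q 0 x z)"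
      using lim
    proof eventually_elim
      case (elim x)
      have "(\<lambda>k. (LBINT z. Q (h k) x z)) \<longlonglongrightarrow> (LBINT z. Q 0 x z)"
      proof (rule integral_dominated_convergence[where w = "\<lambda>z. L * kI z"])
        show "AE z in lborel. (\<lambda>k. Q (h k) x z) \<longlonglongrightarrow> Q 0 x z"
        proof (rule AE_I2)
          fix z
          show "(\<lambda>k. Q (h k) x z) \<longlonglongrightarrow> Q 0 x z"
          proof (cases "z = 0")
            case False
            then have "\<forall>\<^sub>F k in sequentially. h k < norm z" using h(3) by (intro order_tendstoD) auto
            then have "\<forall>\<^sub>F k in sequentially. Q (h k) x z = Q 0 x z"
              by eventually_elim (simp add: Q_def shell_kernel_def indicator_def)
            then show ?thesis by (rule tendsto_eventually)
          qed (simp add: Q_def)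
        qed
        show "AE z in lborel. norm (Q (h k) x z) \<le> L * kI z" for k using Qb by simp
      qed (use kIi in auto)
      then show ?case by (intro tendsto_intros comp[OF \<eta>_cont(2)] elim)
    qed
    show "AE x in lborel. norm (\<eta> (v k x) * (LBINT z. Q (h k) x z)) \<le> indicator (cball 0 (R + r)) x * (B * (L * I))" for k
    proof (rule AE_I2)
      fix x
      show "norm (\<eta> (v k x) * (LBINT z. Q (h k) x z)) \<le> indicator (cball 0 (R + r)) x * (B * (L * I))"
      proof (cases "norm x \<le> R + r")
        case True
        have "\<bar>\<eta> (v k x)\<bar> * \<bar>\<integral>z. Q (h k) x z \<partial>lborel\<bar> \<le> B * (L * I)"
          using B[OF vD(2), of k x] B0 by (intro mult_mono Sb) auto
        then show ?thesis using True by (simp add: abs_mult)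
      qed (simp add: Q0)
    qed
  qed (use cball in simp_all)
  show ?thesis
    unfolding discrete_entropy_def entropy_form_def tQ
    using tendsto_add[OF tendsto_add[OF tendsto_add[OF T1 T2] tendsto_mult[OF tendsto_const[of c] T3]] tendsto_mult[OF tendsto_const[of c] T4]]
    unfolding kL_def q_def by simp
qed

end

section \<open>Existence of entropy solutions\<close>

lemma scheme_operator:
  fixes F :: "real \<Rightarrow> real ^ 'n"
  assumes F: "K-lipschitz_on {-M..M} F" "continuous_on UNIV F" and s: "0 < s" and c: "0 \<le> c" and h: "0 < h"
  shows "monotone_averaging M ((\<Sum>i\<in>(UNIV::'n set). K / h) + c * (LBINT z. outer_kernel s h (z :: real ^ 'n)))
    (\<lambda>u x. flux_average K h F u x + c * (LBINT z. u (x + z) * outer_kernel s h z))"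
proof (rule monotone_averaging_add)
  have K: "0 \<le> K" by (rule lipschitz_on_nonneg[OF F(1)])
  have Fc: "continuous_on UNIV (\<lambda>r. F r $ i)" for i by (intro continuous_intros F)
  show "monotone_averaging M (\<Sum>i\<in>(UNIV::'n set). K / h) (flux_average K h F)"
    unfolding flux_average_def[abs_def]
  proof (rule monotone_averaging_sum)
    fix i :: 'n
    show "monotone_averaging M (K / h) (\<lambda>u x. ((K * u (x + axis i h) + (- 1) * F (u (x + axis i h)) $ i)
      + (K * u (x - axis i h) + 1 * F (u (x - axis i h)) $ i)) / (2 * h))"
    proof (rule monotone_averaging_flux[where g\<^sub>1 = "\<lambda>r. K * r + (- 1) * F r $ i" and g\<^sub>2 = "\<lambda>r. K * r + 1 * F r $ i"])
      show "mono_on {-M..M} (\<lambda>r. K * r + (- 1) * F r $ i)" "mono_on {-M..M} (\<lambda>r. K * r + 1 * F r $ i)"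
        by (rule monotone_numerical_flux[OF lipschitz_on_component[OF F(1)]]; simp)+
      show "continuous_on UNIV (\<lambda>r. K * r + (- 1) * F r $ i)" "continuous_on UNIV (\<lambda>r. K * r + 1 * F r $ i)"
        by (intro continuous_intros Fc)+
    qed (use K h in auto)
  qed simp
  have "integrable lborel (\<lambda>z. c * outer_kernel s h (z :: real ^ 'n))"
    by (intro integrable_mult_right integrable_outer_kernel s h)
  from monotone_averaging_convolution[OF this, of M] c
  show "monotone_averaging M (c * (LBINT z. outer_kernel s h (z :: real ^ 'n)))
      (\<lambda>(u :: real ^ 'n \<Rightarrow> real) x. c * (LBINT z. u (x + z) * outer_kernel s h z))"
    by (simp add: mult.left_commute)
qed

text \<open>
  The functions \<open>U m k\<close> belong to the penalisation \<open>\<epsilon> m\<close> and the mesh size \<open>h k\<close>. The number \<open>\<beta> m k\<close>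
  is the value of \<open>b\<close> on the constant solution for the datum \<open>0\<close>; because of the penalisation it
  is small but not \<open>0\<close>, and it is \<open>b (U m k x) - \<beta> m k\<close>, not \<open>b (U m k x)\<close>, that is integrable.
\<close>
definition approximation_family where
  "approximation_family c s K M b F f h \<epsilon> (U :: nat \<Rightarrow> nat \<Rightarrow> real ^ 'n \<Rightarrow> real) \<beta> \<longleftrightarrow>
    (\<forall>m k. scheme_solution c s K M b F f (h k) (\<epsilon> m) (U m k)) \<and>
    (\<forall>m. \<forall>e>0. \<exists>d>0. \<forall>k y. norm y < d \<longrightarrow>
        L1_dist (\<lambda>x. U m k (x + y)) (U m k) \<le> ennreal e) \<and>
    (\<forall>m m' k x. m \<le> m' \<longrightarrow> U m k x \<le> U m' k x) \<and>
    (\<forall>m k. \<bar>\<beta> m k\<bar> \<le> \<epsilon> m * (2 * M)) \<and>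
    (\<forall>m k. (\<integral>\<^sup>+x. \<bar>b (U m k x) - \<beta> m k\<bar> \<partial>lborel) \<le> ennreal (LBINT x. \<bar>f x\<bar>))"

lemma approximation_familyD:
  assumes "approximation_family c s K M b F f h \<epsilon> U \<beta>"
  shows "\<And>m k. scheme_solution c s K M b F f (h k) (\<epsilon> m) (U m k)"
    "\<And>m e. e > 0 \<Longrightarrow> \<exists>d>0. \<forall>k y. norm y < d \<longrightarrow>
        L1_dist (\<lambda>x. U m k (x + y)) (U m k) \<le> ennreal e"
    "\<And>m m' k x. m \<le> m' \<Longrightarrow> U m k x \<le> U m' k x"
    "\<And>m k. \<bar>\<beta> m k\<bar> \<le> \<epsilon> m * (2 * M)"
    "\<And>m k. (\<integral>\<^sup>+x. \<bar>b (U m k x) - \<beta> m k\<bar> \<partial>lborel) \<le> ennreal (LBINT x. \<bar>f x\<bar>)"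
  using assms unfolding approximation_family_def by blast+

text \<open>
  Equicontinuity compares the solutions for a translate of \<open>f\<close> and for \<open>f\<close>: the first is the translate of
  the second, and the modulus is that of \<open>f\<close> divided by \<open>\<epsilon> m\<close>, whatever the mesh size is.
\<close>
lemma approximate_solutions:
  fixes F :: "real \<Rightarrow> real ^ 'n" and f :: "real ^ 'n \<Rightarrow> real"
  assumes F: "K-lipschitz_on {-M..M} F" "continuous_on UNIV F" and s: "0 < s" and c: "0 \<le> c"
    and b: "L-lipschitz_on UNIV b" "mono b" "b 0 = 0" and M: "0 \<le> M"
    and f: "integrable lborel f" "\<And>x. b (- M) \<le> f x" "\<And>x. f x \<le> b M"
    and h: "\<And>k. 0 < h k" and \<epsilon>: "\<And>m. 0 < \<epsilon> m" "\<And>m. \<epsilon> m \<le> 1" "decseq \<epsilon>"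
  shows "\<exists>U \<beta>. approximation_family c s K M b F f h \<epsilon> U \<beta>"
proof -
  define D where "D k = (\<Sum>i\<in>(UNIV::'n set). K / h k) + c * (LBINT z. outer_kernel s (h k) (z :: real ^ 'n))" for k
  define T where "T k u x = flux_average K (h k) F u x + c * (LBINT z. u (x + z) * outer_kernel s (h k) z)"
    for k u x
  have ie: "implicit_equation M (D k) (T k) b L" for k
  proof -
    have "monotone_averaging M (D k) (T k)"
      unfolding D_def T_def by (rule scheme_operator[OF F s c h])
    then show ?thesis
      unfolding implicit_equation_def implicit_equation_axioms_def
      using M b(2) lipschitz_onD[OF b(1)] lipschitz_on_nonneg[OF b(1)] by (auto simp: dist_real_def)
  qed
  have df: "implicit_equation.datum M b f"
    using f by (auto simp: implicit_equation.datum_def[OF ie])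
  have b0: "b (- M) \<le> 0" "0 \<le> b M" using monoD[OF b(2), of "- M" 0] monoD[OF b(2), of 0 M] b(3) M by auto
  have d0: "implicit_equation.datum M b (\<lambda>_ :: real ^ 'n. 0)"
    using b0 by (auto simp: implicit_equation.datum_def[OF ie])
  define U where "U m k = implicit_equation.sol M (D k) (T k) b L (\<epsilon> m) f" for m k
  \<comment> \<open>The solution for the datum \<open>0\<close> is constant, since the problem is invariant under translations.\<close>
  define Z where "Z m k = implicit_equation.sol M (D k) (T k) b L (\<epsilon> m) (\<lambda>_. 0)" for m k
  have \<epsilon>0: "0 \<le> \<epsilon> m" for m using \<epsilon>(1)[of m] by simp
  have p1: "scheme_solution c s K M b F f (h k) (\<epsilon> m) (U m k)" for m k
    using implicit_equation.sol_bounded_field[OF ie df \<epsilon>0 \<epsilon>(2), of k m]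
      implicit_equation.sol_equation[OF ie df \<epsilon>0 \<epsilon>(2), of k m]
    unfolding scheme_solution_def U_def D_def T_def by blast
  have p2: "\<exists>d>0. \<forall>k y. norm y < d \<longrightarrow> L1_dist (\<lambda>x. U m k (x + y)) (U m k) \<le> ennreal e"
    if e: "e > 0" for e m
  proof -
    have "translation_continuous f" by (rule translation_continuous_integrable[OF f(1)])
    then obtain d where d: "d > 0" "\<And>y. norm y < d \<Longrightarrow> L1_dist (\<lambda>x. f (x + y)) f \<le> ennreal (e * \<epsilon> m)"
      using e \<epsilon>(1)[of m] unfolding translation_continuous_def by (meson mult_pos_pos)
    have "L1_dist (\<lambda>x. U m k (x + y)) (U m k) \<le> ennreal e" if "norm y < d" for k y
    proof -
      have "(\<integral>\<^sup>+x. \<bar>implicit_equation.sol M (D k) (T k) b L (\<epsilon> m) (\<lambda>x. f (x + y)) x - U m k x\<bar> \<partial>lborel)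
          \<le> ennreal (e * \<epsilon> m / \<epsilon> m)"
        unfolding U_def using e \<epsilon>0[of m]
        by (intro implicit_equation.sol_L1[OF ie implicit_equation.datum_translate[OF ie df] df \<epsilon>(1,2) d(2)[OF that]]) auto
      moreover have "implicit_equation.sol M (D k) (T k) b L (\<epsilon> m) (\<lambda>x. f (x + y)) x = U m k (x + y)" for x
        unfolding U_def by (rule implicit_equation.sol_translate[OF ie df \<epsilon>0 \<epsilon>(2)])
      ultimately show ?thesis using \<epsilon>(1)[of m] by simp
    qed
    with d(1) show ?thesis by blast
  qed
  have p3: "U m k x \<le> U m' k x" if "m \<le> m'" for m m' k x
    unfolding U_def by (rule implicit_equation.sol_antimono[OF ie df \<epsilon>0 decseqD[OF \<epsilon>(3) that] \<epsilon>(2)])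
  have Zc: "Z m k x = Z m k 0" for m k x
    unfolding Z_def
    using implicit_equation.sol_translate[OF ie[of k] d0 \<epsilon>0[of m] \<epsilon>(2)[of m], where x = 0 and y = x] by simp
  have p4: "\<bar>b (Z m k 0)\<bar> \<le> \<epsilon> m * (2 * M)" for m k
  proof -
    have Zb: "\<bar>Z m k 0\<bar> \<le> M"
      unfolding Z_def by (rule bounded_fieldD(2)[OF implicit_equation.sol_bounded_field[OF ie d0 \<epsilon>0 \<epsilon>(2)]])
    have "b (Z m k 0) + \<epsilon> m * (Z m k 0 + M) + D k * Z m k 0 = T k (Z m k) 0 + 0"
      unfolding Z_def by (rule implicit_equation.sol_equation[OF ie d0 \<epsilon>0 \<epsilon>(2)])
    moreover have "Z m k = (\<lambda>_. Z m k 0)" using Zc by blast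
    then have "T k (Z m k) 0 = D k * Z m k 0"
      using monotone_averaging.T_const[OF implicit_equation.axioms(1)[OF ie] Zb] by metis
    ultimately have "b (Z m k 0) = - (\<epsilon> m * (Z m k 0 + M))" by simp
    then have "\<bar>b (Z m k 0)\<bar> = \<epsilon> m * \<bar>Z m k 0 + M\<bar>" using \<epsilon>0[of m] by (simp add: abs_mult)
    also have "\<dots> \<le> \<epsilon> m * (2 * M)" using Zb \<epsilon>0[of m] by (intro mult_left_mono) auto
    finally show ?thesis .
  qed
  have p5: "(\<integral>\<^sup>+x. \<bar>b (U m k x) - b (Z m k 0)\<bar> \<partial>lborel) \<le> ennreal (LBINT x. \<bar>f x\<bar>)" for m k
  proof -
    have "L1_dist f (\<lambda>_. 0) \<le> ennreal (LBINT x. \<bar>f x\<bar>)"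
      using f(1) by (simp add: nn_integral_eq_integral)
    then have le: "(\<integral>\<^sup>+x. \<bar>b (U m k x) - b (Z m k x)\<bar> \<partial>lborel) \<le> ennreal (LBINT x. \<bar>f x\<bar>)"
      unfolding U_def Z_def
      by (intro implicit_equation.sol_reaction_L1[OF ie df d0 \<epsilon>(1,2)]) auto
    have "(\<integral>\<^sup>+x. \<bar>b (U m k x) - b (Z m k 0)\<bar> \<partial>lborel) = (\<integral>\<^sup>+x. \<bar>b (U m k x) - b (Z m k x)\<bar> \<partial>lborel)"
    proof (rule nn_integral_cong)
      fix x
      show "ennreal \<bar>b (U m k x) - b (Z m k 0)\<bar> = ennreal \<bar>b (U m k x) - b (Z m k x)\<bar>"
        by (subst Zc[of m k x]) (rule refl)
    qed
    then show ?thesis using le by simp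
  qed
  show ?thesis
    by (rule exI[of _ U], rule exI[of _ "\<lambda>m k. b (Z m k 0)"], unfold approximation_family_def, intro conjI allI impI)
      (rule p1 p2 p3 p4 p5; assumption)+
qed

text \<open>
  All integrands except \<open>g\<close> are Borel functions, for which Lebesgue measure and its restriction to
  Borel sets have the same integrals, and \<open>g\<close> agrees with a Borel function almost everywhere.
\<close>
lemma (in entropy_test) entropy_form_lebesgue:
  fixes g :: "real ^ 'n \<Rightarrow> real"
  assumes u: "bounded_field M u" and g: "g \<in> borel_measurable lebesgue" "AE x in lebesgue. g x = f x"
  shows "(LINT x|lebesgue. (g x - b (u x)) * deriv \<eta> (u x) * \<phi> x + \<Phi> (u x) \<bullet> grad \<phi> x)
        + c * (LINT x|lebesgue. (LINT z:{z. norm z \<ge> r}|lebesgue.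
            deriv \<eta> (u x) * ((u (x + z) - u x) / norm z powr (real CARD('n) + s)) * \<phi> x))
        + c * (LINT x|lebesgue. (LINT z:{z. norm z \<le> r}|lebesgue.
            \<eta> (u x) * ((\<phi> (x + z) - \<phi> x - grad \<phi> x \<bullet> z) / norm z powr (real CARD('n) + s))))
      = entropy_form c s b f \<eta> \<Phi> \<phi> r u"
proof -
  note uD = bounded_fieldD[OF u]
  note [measurable] = uD(1)
  obtain B where B0: "0 \<le> B" and B: "\<And>r. \<bar>r\<bar> \<le> M \<Longrightarrow>
      \<bar>b r\<bar> \<le> B \<and> \<bar>deriv \<eta> r\<bar> \<le> B \<and> \<bar>\<eta> r\<bar> \<le> B \<and> norm (\<Phi> r) \<le> B"
    using values_bounded[of M] by blast
  have leb: "integral\<^sup>L lebesgue g = integral\<^sup>L lborel g" if "g \<in> borel_measurable borel" for g :: "real ^ 'n \<Rightarrow> real"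
    using that by (intro integral_completion) simp
  have lev: "levy_kernel s z = 1 / norm z powr (real CARD('n) + s)" for z :: "real ^ 'n"
    by (simp add: levy_kernel_def divide_inverse)
  have i1: "integrable lborel (\<lambda>x. ((f x - b (u x)) * deriv \<eta> (u x)) * \<phi> x)"
  proof (rule integrable_bounded_mult[OF \<phi>_integrable])
    show "\<bar>(f x - b (u x)) * deriv \<eta> (u x)\<bar> \<le> (C + B) * B" for x
    proof -
      have "\<bar>f x - b (u x)\<bar> \<le> C + B" using f_bound[of x] B[OF uD(2), of x] by linarith
      then show ?thesis unfolding abs_mult using B[OF uD(2), of x] by (intro mult_mono) auto
    qed
  qed measurable
  have i2: "integrable lborel (\<lambda>x. \<Phi> (u x) \<bullet> grad \<phi> x)"
  proof -
    have "continuous_on (cball 0 R) (\<lambda>x. norm (grad \<phi> x))"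
      by (intro continuous_intros continuous_on_subset[OF \<phi>_bounds(9)]) auto
    then have "compact ((\<lambda>x. norm (grad \<phi> x)) ` cball 0 R)" by (rule compact_continuous_image) simp
    then obtain G where G: "\<forall>x\<in>cball 0 R. \<bar>norm (grad \<phi> x)\<bar> \<le> G"
      by (auto dest!: compact_imp_bounded simp: bounded_iff)
    have "\<bar>norm (grad \<phi> x)\<bar> \<le> \<bar>G\<bar>" for x
      using G[rule_format, of x] \<phi>_bounds(6)[of x] by (cases "norm x \<le> R") auto
    then have ng: "integrable lborel (\<lambda>x. norm (grad \<phi> x))"
      by (intro integrable_compact_support[of _ R "\<bar>G\<bar>"]) (use \<phi>_bounds(6) in auto)
    show ?thesis
    proof (rule Bochner_Integration.integrable_bound)
      show "integrable lborel (\<lambda>x. B * norm (grad \<phi> x))" using ng by simp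
      show "AE x in lborel. norm (\<Phi> (u x) \<bullet> grad \<phi> x) \<le> norm (B * norm (grad \<phi> x))"
      proof (rule AE_I2)
        fix x
        have "\<bar>\<Phi> (u x) \<bullet> grad \<phi> x\<bar> \<le> norm (\<Phi> (u x)) * norm (grad \<phi> x)" by (rule Cauchy_Schwarz_ineq2)
        also have "\<dots> \<le> B * norm (grad \<phi> x)" using B[OF uD(2), of x] by (intro mult_right_mono) auto
        finally show "norm (\<Phi> (u x) \<bullet> grad \<phi> x) \<le> norm (B * norm (grad \<phi> x))" using B0 by simp
      qed
    qed measurable
  qed
  have t1: "(LINT x|lebesgue. (g x - b (u x)) * deriv \<eta> (u x) * \<phi> x + \<Phi> (u x) \<bullet> grad \<phi> x)
      = (LBINT x. ((f x - b (u x)) * deriv \<eta> (u x)) * \<phi> x) + (LBINT x. \<Phi> (u x) \<bullet> grad \<phi> x)"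
  proof -
    have bl: "g \<in> borel_measurable lebesgue" if "g \<in> borel_measurable borel" for g :: "real ^ 'n \<Rightarrow> real"
      using that by (intro measurable_completion) simp
    have m: "(\<lambda>x. b (u x)) \<in> borel_measurable lebesgue" "(\<lambda>x. deriv \<eta> (u x)) \<in> borel_measurable lebesgue"
      "\<phi> \<in> borel_measurable lebesgue" "(\<lambda>x. \<Phi> (u x) \<bullet> grad \<phi> x) \<in> borel_measurable lebesgue" "f \<in> borel_measurable lebesgue"
      by (intro bl; measurable)+
    have "(LINT x|lebesgue. (g x - b (u x)) * deriv \<eta> (u x) * \<phi> x + \<Phi> (u x) \<bullet> grad \<phi> x)
        = (LINT x|lebesgue. (f x - b (u x)) * deriv \<eta> (u x) * \<phi> x + \<Phi> (u x) \<bullet> grad \<phi> x)"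
    proof (rule integral_cong_AE)
      show "AE x in lebesgue. (g x - b (u x)) * deriv \<eta> (u x) * \<phi> x + \<Phi> (u x) \<bullet> grad \<phi> x
          = (f x - b (u x)) * deriv \<eta> (u x) * \<phi> x + \<Phi> (u x) \<bullet> grad \<phi> x"
        using g(2) by eventually_elim simp
    qed (intro borel_measurable_add borel_measurable_times borel_measurable_diff m g(1))+
    also have "\<dots> = (LBINT x. (f x - b (u x)) * deriv \<eta> (u x) * \<phi> x + \<Phi> (u x) \<bullet> grad \<phi> x)"
      by (rule leb) measurable
    finally show ?thesis using Bochner_Integration.integral_add[OF i1 i2] by simp
  qed
  have t2: "(LINT x|lebesgue. (LINT z:{z. norm z \<ge> r}|lebesgue.
            deriv \<eta> (u x) * ((u (x + z) - u x) / norm z powr (real CARD('n) + s)) * \<phi> x))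
      = (LBINT x. jump_term \<eta> u (outer_kernel s r) x * \<phi> x)"
  proof -
    have "(LINT z:{z. norm z \<ge> r}|lebesgue. deriv \<eta> (u x) * ((u (x + z) - u x) / norm z powr (real CARD('n) + s)) * \<phi> x)
        = jump_term \<eta> u (outer_kernel s r) x * \<phi> x" for x
    proof -
      have "(LINT z:{z. norm z \<ge> r}|lebesgue. deriv \<eta> (u x) * ((u (x + z) - u x) / norm z powr (real CARD('n) + s)) * \<phi> x)
          = (LINT z|lebesgue. ((deriv \<eta> (u x) * (u (x + z) - u x)) * outer_kernel s r z) * \<phi> x)"
        unfolding set_lebesgue_integral_def outer_kernel_def lev
        by (rule Bochner_Integration.integral_cong[OF refl]) (simp add: mult_ac)
      also have "\<dots> = (LBINT z. ((deriv \<eta> (u x) * (u (x + z) - u x)) * outer_kernel s r z) * \<phi> x)"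
        by (rule leb) measurable
      finally show ?thesis by (simp add: jump_term_def)
    qed
    then show ?thesis by (simp only:) (rule leb, unfold jump_term_def, measurable)
  qed
  have t3: "(LINT x|lebesgue. (LINT z:{z. norm z \<le> r}|lebesgue.
            \<eta> (u x) * ((\<phi> (x + z) - \<phi> x - grad \<phi> x \<bullet> z) / norm z powr (real CARD('n) + s))))
      = (LBINT x. \<eta> (u x) * taylor_term \<phi> (shell_kernel s 0 r) x)"
  proof -
    have sph: "AE z in lborel. z \<notin> sphere (0 :: real ^ 'n) r"
    proof -
      from negligible_sphere[of "0 :: real ^ 'n" r] have "sphere (0 :: real ^ 'n) r \<in> null_sets lborel"
        by (auto simp: null_sets_completion_iff negligible_iff_null_sets)
      then show ?thesis by (rule AE_not_in)
    qed
    have "(LINT z:{z. norm z \<le> r}|lebesgue. \<eta> (u x) * ((\<phi> (x + z) - \<phi> x - grad \<phi> x \<bullet> z) / norm z powr (real CARD('n) + s)))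
        = \<eta> (u x) * taylor_term \<phi> (shell_kernel s 0 r) x" for x
    proof -
      let ?P = "\<lambda>z. \<phi> (x + z) - \<phi> x - grad \<phi> x \<bullet> z"
      have "(LINT z:{z. norm z \<le> r}|lebesgue. \<eta> (u x) * (?P z / norm z powr (real CARD('n) + s)))
          = (LINT z|lebesgue. \<eta> (u x) * (?P z * (indicator {z. norm z \<le> r} z * levy_kernel s z)))"
        unfolding set_lebesgue_integral_def lev
        by (rule Bochner_Integration.integral_cong[OF refl]) (simp add: mult_ac)
      also have "\<dots> = (LBINT z. \<eta> (u x) * (?P z * (indicator {z. norm z \<le> r} z * levy_kernel s z)))"
        by (rule leb) measurable
      also have "\<dots> = \<eta> (u x) * (LBINT z. ?P z * (indicator {z. norm z \<le> r} z * levy_kernel s z))"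
        by simp
      also have "(LBINT z. ?P z * (indicator {z. norm z \<le> r} z * levy_kernel s z)) = (LBINT z. ?P z * shell_kernel s 0 r z)"
      proof (rule integral_cong_AE)
        show "AE z in lborel. ?P z * (indicator {z. norm z \<le> r} z * levy_kernel s z) = ?P z * shell_kernel s 0 r z"
          using sph by eventually_elim (auto simp: shell_kernel_def indicator_def)
      qed measurable
      finally show ?thesis by (simp add: taylor_term_def)
    qed
    then show ?thesis by (simp only:) (rule leb, unfold taylor_term_def, measurable)
  qed
  show ?thesis unfolding t1 t2 t3 entropy_form_def ..
qed

lemma frac_const_nonneg:
  assumes "0 < s" "s \<le> 1"
  shows "0 \<le> frac_const N s"
proof -
  have "0 < Gamma ((real N + s) / 2)" "0 < Gamma (1 - s / 2)" using assms by (auto intro!: Gamma_real_pos)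
  then show ?thesis using assms by (simp add: frac_const_def)
qed

lemma bounded_borel_representative:
  fixes f :: "real ^ 'n \<Rightarrow> real"
  assumes "integrable lebesgue f" "L_infinity f"
  shows "\<exists>f\<^sub>0 C. 0 < C \<and> integrable lborel f\<^sub>0 \<and> (\<forall>x. \<bar>f\<^sub>0 x\<bar> \<le> C) \<and> (AE x in lebesgue. f x = f\<^sub>0 x)"
proof -
  obtain C where C: "AE x in lebesgue. \<bar>f x\<bar> \<le> C" using assms(2) by (auto simp: L_infinity_def)
  obtain g where g [measurable]: "g \<in> borel_measurable lborel" and fg: "AE x in lborel. f x = g x"
    using completion_ex_borel_measurable_real[of f lborel] assms(1) by auto
  define C' where "C' = \<bar>C\<bar> + 1"
  define f0 where "f0 x = max (- C') (min C' (g x))" for x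
  have m [measurable]: "f0 \<in> borel_measurable lborel" unfolding f0_def by measurable
  have eq: "AE x in lebesgue. f x = f0 x"
    using C AE_completion[OF fg]
  proof eventually_elim
    case (elim x)
    then show ?case unfolding f0_def C'_def by linarith
  qed
  have "f0 \<in> borel_measurable lebesgue" by (rule measurable_completion[OF m])
  then have "integrable lebesgue f0"
    using assms(1) eq by (subst integrable_cong_AE[symmetric]) auto
  then have "integrable lborel f0" using integrable_completion[OF m] by simp
  moreover have "\<bar>f0 x\<bar> \<le> C'" for x unfolding f0_def C'_def by linarith
  moreover have "0 < C'" by (simp add: C'_def)
  ultimately show ?thesis using eq by blast
qed

theorem theorem3p3:
  fixes s lam :: real and b :: "real \<Rightarrow> real"
    and F :: "real \<Rightarrow> real ^ 'n" and f :: "real ^ 'n \<Rightarrow> real"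
  assumes "0 < s" and "s \<le> 1"
    and "\<exists>L. L-lipschitz_on UNIV b" and "mono b" and "b 0 = 0"
    and "lam > 0" and "\<And>r. b r * r \<ge> lam * \<bar>r\<bar>\<^sup>2"
    and "locally_lipschitz F" and "F 0 = 0"
    and "integrable lebesgue f" and "L_infinity f"
  shows "\<exists>u. entropy_solution s b F f u \<and> integrable lebesgue (\<lambda>x. b (u x))"
proof -
  obtain L where L: "L-lipschitz_on UNIV b" using assms(3) by blast
  then have bc: "continuous_on UNIV b" by (rule lipschitz_on_continuous_on)
  obtain f\<^sub>0 C where C: "0 < C" and f0i: "integrable lborel f\<^sub>0" and f0b: "\<And>x. \<bar>f\<^sub>0 x\<bar> \<le> C"
    and ff0: "AE x in lebesgue. f x = f\<^sub>0 x"
    using bounded_borel_representative[OF assms(10,11)] by blast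
  have [measurable]: "f\<^sub>0 \<in> borel_measurable borel" using f0i by auto
  \<comment> \<open>Coercivity of \<open>b\<close> makes the constants \<open>- M\<close> and \<open>M\<close> barriers for data bounded by \<open>C\<close>.\<close>
  define M where "M = C / lam"
  have M: "0 < M" using C assms(6) by (simp add: M_def)
  have lamM: "lam * M = C" using assms(6) by (simp add: M_def)
  have "M * C \<le> M * b M" using assms(7)[of M] M by (simp add: lamM[symmetric] power2_eq_square mult_ac)
  then have bM: "C \<le> b M" using M by simp
  have "M * C \<le> M * - b (- M)" using assms(7)[of "- M"] M by (simp add: lamM[symmetric] power2_eq_square mult_ac)
  then have "C \<le> - b (- M)" by (rule mult_left_le_imp_le[OF _ M])
  then have bM': "b (- M) \<le> - C" by simp
  obtain K where K: "K-lipschitz_on {-M..M} F" using locally_lipschitz_imp_lipschitz_on[OF assms(8)] .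
  have Fc: "continuous_on UNIV F" by (rule locally_lipschitz_continuous[OF assms(8)])
  define c where "c = frac_const CARD('n) s"
  have c: "0 \<le> c" unfolding c_def by (rule frac_const_nonneg[OF assms(1,2)])
  \<comment> \<open>The same null sequence serves as penalisation and as mesh size.\<close>
  define e where "e m = 1 / real (Suc m)" for m
  have e: "0 < e m" "e m \<le> 1" "decseq e" for m
    unfolding e_def by (auto intro!: decseq_SucI simp: field_simps)
  have e0: "e \<longlonglongrightarrow> 0" unfolding e_def using LIMSEQ_inverse_real_of_nat by (simp add: inverse_eq_divide)
  define A where "A = (LBINT x. \<bar>f\<^sub>0 x\<bar>)"
  have f0M: "b (- M) \<le> f\<^sub>0 x" "f\<^sub>0 x \<le> b M" for x using f0b[of x] bM bM' by auto
  obtain U \<beta> where fam: "approximation_family c s K M b F f\<^sub>0 e e U \<beta>"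
    using approximate_solutions[OF K Fc assms(1) c L assms(4,5) less_imp_le[OF M] f0i f0M, of e e] e by auto
  note Us = approximation_familyD(1)[OF fam] and Uequi = approximation_familyD(2)[OF fam]
    and Umono = approximation_familyD(3)[OF fam] and U\<beta> = approximation_familyD(4)[OF fam]
    and UL1 = approximation_familyD(5)[OF fam, folded A_def]
  have Ub: "bounded_field M (U m k)" for m k using Us unfolding scheme_solution_def by blast
  obtain u \<mu> \<kappa> where u: "bounded_field M u" and idx: "\<And>j. j \<le> \<mu> j" "\<And>j. j \<le> \<kappa> j"
    and lim: "AE x in lborel. (\<lambda>j. U (\<mu> j) (\<kappa> j) x) \<longlonglongrightarrow> u x"
    using monotone_diagonal_selection[of M U, OF Ub Uequi Umono] by blast
  note [measurable] = bounded_fieldD(1)[OF u] bounded_fieldD(1)[OF Ub] borel_measurable_continuous_onI[OF bc]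
  have sub: "(\<lambda>j. e (g j)) \<longlonglongrightarrow> 0" if "\<And>j. j \<le> g j" for g
  proof (rule tendsto_sandwich[OF _ _ tendsto_const e0])
    show "\<forall>\<^sub>F j in sequentially. e (g j) \<le> e j" using decseqD[OF e(3) that] by simp
  qed (use e(1) in \<open>auto intro!: always_eventually less_imp_le\<close>)
  have "entropy_solution s b F f u"
    unfolding entropy_solution_def
  proof (intro conjI allI impI)
    have "u \<in> borel_measurable lebesgue" by (rule measurable_completion) simp
    then show "L_infinity u" using bounded_fieldD(2)[OF u] by (auto simp: L_infinity_def intro!: exI[of _ M])
    fix r :: real and \<phi> :: "real ^ 'n \<Rightarrow> real" and \<eta> :: "real \<Rightarrow> real" and \<Phi> :: "real \<Rightarrow> real ^ 'n"
    assume r: "0 < r" and \<phi>: "test_function \<phi>" "\<forall>x. 0 \<le> \<phi> x" and \<eta>: "C_class 2 \<eta>" "convex_on UNIV \<eta>"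
      and \<Phi>: "entropy_flux F \<eta> \<Phi>"
    obtain R L' where "test_bounds \<phi> R L'" using test_function_bounds[OF \<phi>(1)] by blast
    then interpret E: entropy_test F \<Phi> f\<^sub>0 \<phi> b \<eta> s C R L'
      by unfold_locales (use f0b bc assms(1,2) \<eta>(1) \<Phi> in auto)
    have "0 \<le> entropy_form c s b f\<^sub>0 \<eta> \<Phi> \<phi> r u"
    proof (rule tendsto_lowerbound)
      show "(\<lambda>j. discrete_entropy c s K M b f\<^sub>0 \<eta> \<Phi> \<phi> r (e (\<kappa> j)) (e (\<mu> j)) (U (\<mu> j) (\<kappa> j)))
          \<longlonglongrightarrow> entropy_form c s b f\<^sub>0 \<eta> \<Phi> \<phi> r u"
        by (rule E.discrete_entropy_tendsto[where h = "\<lambda>j. e (\<kappa> j)" and \<epsilon> = "\<lambda>j. e (\<mu> j)",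
              OF Ub u lim lipschitz_on_nonneg[OF K] e(1,2) sub[OF idx(2)] less_imp_le[OF e(1)] e(2) sub[OF idx(1)] r])
      have "\<forall>\<^sub>F j in sequentially. e (\<kappa> j) < r" using sub[OF idx(2)] r by (intro order_tendstoD) auto
      then show "\<forall>\<^sub>F j in sequentially. 0 \<le> discrete_entropy c s K M b f\<^sub>0 \<eta> \<Phi> \<phi> r (e (\<kappa> j)) (e (\<mu> j)) (U (\<mu> j) (\<kappa> j))"
        by eventually_elim (rule E.discrete_entropy_inequality[OF Us K c e(1) less_imp_le _ \<eta>(2)], use \<phi>(2) in auto)
    qed simp
    moreover have "f \<in> borel_measurable lebesgue" using assms(10) by simp
    ultimately show "0 \<le> (LINT x|lebesgue.
            (f x - b (u x)) * deriv \<eta> (u x) * \<phi> x + \<Phi> (u x) \<bullet> grad \<phi> x)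
        + frac_const CARD('n) s *
          (LINT x|lebesgue. (LINT z:{z. norm z \<ge> r}|lebesgue.
            deriv \<eta> (u x) * ((u (x + z) - u x) / norm z powr (real CARD('n) + s)) * \<phi> x))
        + frac_const CARD('n) s *
          (LINT x|lebesgue. (LINT z:{z. norm z \<le> r}|lebesgue.
            \<eta> (u x) * ((\<phi> (x + z) - \<phi> x - grad \<phi> x \<bullet> z) / norm z powr (real CARD('n) + s))))"
      unfolding c_def[symmetric] by (subst E.entropy_form_lebesgue[OF u _ ff0])
  qed
  moreover have "integrable lebesgue (\<lambda>x. b (u x))"
  proof -
    \<comment> \<open>The integrable functions \<open>b (U m k x) - \<beta> m k\<close> converge to \<open>b (u x)\<close> along the diagonal.\<close>
    have \<beta>0: "(\<lambda>j. \<beta> (\<mu> j) (\<kappa> j)) \<longlonglongrightarrow> 0"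
    proof (rule Lim_null_comparison)
      show "\<forall>\<^sub>F j in sequentially. norm (\<beta> (\<mu> j) (\<kappa> j)) \<le> e (\<mu> j) * (2 * M)" using U\<beta> by simp
      show "(\<lambda>j. e (\<mu> j) * (2 * M)) \<longlonglongrightarrow> 0"
        using tendsto_mult[OF sub[OF idx(1)] tendsto_const[of "2 * M"]] by simp
    qed
    have "(\<integral>\<^sup>+x. \<bar>b (u x)\<bar> \<partial>lborel)
        = (\<integral>\<^sup>+x. liminf (\<lambda>j. ennreal \<bar>b (U (\<mu> j) (\<kappa> j) x) - \<beta> (\<mu> j) (\<kappa> j)\<bar>) \<partial>lborel)"
    proof (rule nn_integral_cong_AE)
      show "AE x in lborel. ennreal \<bar>b (u x)\<bar> = liminf (\<lambda>j. ennreal \<bar>b (U (\<mu> j) (\<kappa> j) x) - \<beta> (\<mu> j) (\<kappa> j)\<bar>)"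
        using lim
      proof eventually_elim
        case (elim x)
        have "(\<lambda>j. ennreal \<bar>b (U (\<mu> j) (\<kappa> j) x) - \<beta> (\<mu> j) (\<kappa> j)\<bar>) \<longlonglongrightarrow> ennreal \<bar>b (u x) - 0\<bar>"
          by (intro tendsto_ennrealI tendsto_intros \<beta>0 continuous_on_tendsto_compose[OF bc elim]) auto
        from lim_imp_Liminf[OF sequentially_bot this] show ?case by simp
      qed
    qed
    also have "\<dots> \<le> liminf (\<lambda>j. (\<integral>\<^sup>+x. ennreal \<bar>b (U (\<mu> j) (\<kappa> j) x) - \<beta> (\<mu> j) (\<kappa> j)\<bar> \<partial>lborel))"
      by (rule nn_integral_liminf) measurable
    also have "\<dots> \<le> ennreal A" by (rule Liminf_le) (auto simp: UL1)
    also have "\<dots> < \<infinity>" by simp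
    finally have "integrable lborel (\<lambda>x. b (u x))" by (intro integrableI_bounded) auto
    then show ?thesis by (subst integrable_completion) auto
  qed
  ultimately show ?thesis by blast
qed

end
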